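(* For every returning centralized parallel communicating pushdown automata system $\mathcal{A}$ there exists a returning centralized parallel communicating pushdown automata system $\mathcal{A}'$ that satisfies the known communication property and accepts the same language as $\mathcal{A}$, i.e. $L_r(\mathcal{A}')=L_r(\mathcal{A})$.
   Context: A parallel communicating pushdown automata system (PCPA) of degree $n\ge 1$ is $\mathcal{A}=(V,\Delta,A_1,\dots,A_n,K)$, where $V$ is the input alphabet, $\Delta$ the pushdown alphabet, each component $A_i=(Q_i,V,\Delta,f_i,q_i,Z_i,F_i)$ is a pushdown automaton with finite state set $Q_i$, initial state $q_i$, initial stack symbol $Z_i\in\Delta$, final states $F_i\subseteq Q_i$, and transition map $f_i$ from $Q_i\times(V\cup\{\epsilon\})\times\Delta$ to finite subsets of $Q_i\times\Delta^*$; $K\subseteq\{K_1,\dots,K_n\}\subseteq\Delta$ is the set of query symbols ($K_j$ queries component $j$). The system is centralized if only one component (the master, component 1) has transitions $(r,\alpha)\in f_1(q,a,A)$ with $\alpha$ containing a query symbol. A configuration is $(s_1,x_1,\alpha_1,\dots,s_n,x_n,\alpha_n)$ (state, unread input, stack content with top first, per component); the initial configuration on input $x$ is $(q_1,x,Z_1,\dots,q_n,x,Z_n)$. One step in returning mode, from $(s_1,x_1,B_1\alpha_1,\dots,s_n,x_n,B_n\alpha_n)$ with $B_i\in\Delta$: (i) if no top symbol $B_i$ is a query symbol, every component $i$ simultaneously performs a transition $x_i=a_iy_i$, $a_i\in V\cup\{\epsilon\}$, $(p_i,\beta_i')\in f_i(s_i,a_i,B_i)$, new stack $\beta_i'\alpha_i$;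 (ii) otherwise (communication step) for every $i$ with $B_i=K_{j}$ and $B_{j}\notin K$, the stack of $i$ becomes $B_j\alpha_j\alpha_i$ and the stack of $j$ becomes $Z_j$; all other stacks, all states and all inputs are unchanged. The returning language $L_r(\mathcal{A})$ is the set of $x\in V^*$ such that from the initial configuration one reaches a configuration in which every component has read all of $x$ and is in a final state. A returning centralized PCPA (RCPCPA) is a centralized PCPA working in returning mode. Known communication property: the state set of each component $i$ has the form $Q_i\times\{0,1\}$, and whenever component $j$ sends its stack contents to a querying component in a communication step (both in states with second coordinate $0$), then at the next ordinary transition the state of component $j$ has second coordinate $1$; and component $j$ never reaches a state with second coordinate $1$ in any other case. *)

theory Defs
  imports Main
begin

(* A pushdown automaton component A_i = (Q_i, V, Delta, f_i, q_i, Z_i, F_i).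
   Input symbol a in V \<union> {epsilon} is encoded as 'v option (None = epsilon). *)
record ('s, 'v, 'g) pda =
  states :: "'s set"
  trans  :: "'s \<Rightarrow> 'v option \<Rightarrow> 'g \<Rightarrow> ('s \<times> 'g list) set"
  init   :: "'s"
  bottom :: "'g"
  finals :: "'s set"

(* A PCPA (V, Delta, A_1, ..., A_n, K): components are indexed 1..deg;
   qsym j is the query symbol K_j; the set of query symbols is
   K = qsym ` queries with queries \<subseteq> {1..deg}. *)
record ('s, 'v, 'g) pcpa =
  deg     :: nat
  inp     :: "'v set"
  stk     :: "'g set"
  comp    :: "nat \<Rightarrow> ('s, 'v, 'g) pda"
  qsym    :: "nat \<Rightarrow> 'g"
  queries :: "nat set"

definition is_query :: "('s, 'v, 'g) pcpa \<Rightarrow> 'g \<Rightarrow> bool" where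
  "is_query A g \<longleftrightarrow> g \<in> qsym A ` queries A"

definition wf_pcpa :: "('s, 'v, 'g) pcpa \<Rightarrow> bool" where
  "wf_pcpa A \<longleftrightarrow>
     deg A \<ge> 1 \<and> finite (inp A) \<and> finite (stk A) \<and>
     queries A \<subseteq> {1..deg A} \<and> inj_on (qsym A) {1..deg A} \<and>
     qsym A ` {1..deg A} \<subseteq> stk A \<and>
     (\<forall>i\<in>{1..deg A}.
        finite (states (comp A i)) \<and> init (comp A i) \<in> states (comp A i) \<and>
        bottom (comp A i) \<in> stk A \<and> finals (comp A i) \<subseteq> states (comp A i) \<and>
        (\<forall>q a B. finite (trans (comp A i) q a B) \<and>
           (trans (comp A i) q a B \<noteq> {} \<longrightarrow>
              q \<in> states (comp A i) \<and> B \<in> stk A \<and>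
              (case a of None \<Rightarrow> True | Some b \<Rightarrow> b \<in> inp A)) \<and>
           (\<forall>(p, \<beta>) \<in> trans (comp A i) q a B. p \<in> states (comp A i) \<and> set \<beta> \<subseteq> stk A)))"

definition centralized :: "('s, 'v, 'g) pcpa \<Rightarrow> bool" where
  "centralized A \<longleftrightarrow>
     (\<forall>i\<in>{2..deg A}. \<forall>q a B p \<beta>. (p, \<beta>) \<in> trans (comp A i) q a B \<longrightarrow>
        (\<forall>g\<in>set \<beta>. \<not> is_query A g))"

definition rcpcpa :: "('s, 'v, 'g) pcpa \<Rightarrow> bool" where
  "rcpcpa A \<longleftrightarrow> wf_pcpa A \<and> centralized A"

(* configurations: component i \<mapsto> (state, unread input, stack with top first) *)
type_synonym ('s, 'v, 'g) config = "nat \<Rightarrow> 's \<times> 'v list \<times> 'g list"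

definition cst :: "('s, 'v, 'g) config \<Rightarrow> nat \<Rightarrow> 's" where
  "cst c i = fst (c i)"
definition cin :: "('s, 'v, 'g) config \<Rightarrow> nat \<Rightarrow> 'v list" where
  "cin c i = fst (snd (c i))"
definition cstk :: "('s, 'v, 'g) config \<Rightarrow> nat \<Rightarrow> 'g list" where
  "cstk c i = snd (snd (c i))"

definition opt_word :: "'v option \<Rightarrow> 'v list" where
  "opt_word a = (case a of None \<Rightarrow> [] | Some b \<Rightarrow> [b])"

definition init_cfg :: "('s, 'v, 'g) pcpa \<Rightarrow> 'v list \<Rightarrow> ('s, 'v, 'g) config" where
  "init_cfg A x = (\<lambda>i. (init (comp A i), x, [bottom (comp A i)]))"

definition ord_step :: "('s, 'v, 'g) pcpa \<Rightarrow> ('s, 'v, 'g) config \<Rightarrow> ('s, 'v, 'g) config \<Rightarrow> bool" where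
  "ord_step A c c' \<longleftrightarrow>
     (\<forall>i\<in>{1..deg A}. cstk c i \<noteq> [] \<and> \<not> is_query A (hd (cstk c i))) \<and>
     (\<forall>i\<in>{1..deg A}. \<exists>a p \<beta>.
        (p, \<beta>) \<in> trans (comp A i) (cst c i) a (hd (cstk c i)) \<and>
        cin c i = opt_word a @ cin c' i \<and> cst c' i = p \<and>
        cstk c' i = \<beta> @ tl (cstk c i)) \<and>
     (\<forall>i. i \<notin> {1..deg A} \<longrightarrow> c' i = c i)"

definition answers :: "('s, 'v, 'g) pcpa \<Rightarrow> ('s, 'v, 'g) config \<Rightarrow> nat \<Rightarrow> nat \<Rightarrow> bool" where
  "answers A c i j \<longleftrightarrow>
     i \<in> {1..deg A} \<and> j \<in> {1..deg A} \<and> j \<in> queries A \<and>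
     cstk c i \<noteq> [] \<and> cstk c j \<noteq> [] \<and>
     hd (cstk c i) = qsym A j \<and> \<not> is_query A (hd (cstk c j))"

definition sends :: "('s, 'v, 'g) pcpa \<Rightarrow> ('s, 'v, 'g) config \<Rightarrow> nat \<Rightarrow> bool" where
  "sends A c j \<longleftrightarrow> (\<exists>i. answers A c i j)"

definition com_step :: "('s, 'v, 'g) pcpa \<Rightarrow> ('s, 'v, 'g) config \<Rightarrow> ('s, 'v, 'g) config \<Rightarrow> bool" where
  "com_step A c c' \<longleftrightarrow>
     (\<forall>i\<in>{1..deg A}. cstk c i \<noteq> []) \<and>
     (\<exists>i\<in>{1..deg A}. is_query A (hd (cstk c i))) \<and>
     (\<forall>i. i \<notin> {1..deg A} \<longrightarrow> c' i = c i) \<and>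
     (\<forall>i\<in>{1..deg A}. cst c' i = cst c i \<and> cin c' i = cin c i \<and>
        (\<forall>j. answers A c i j \<longrightarrow> cstk c' i = cstk c j @ tl (cstk c i)) \<and>
        (sends A c i \<longrightarrow> cstk c' i = [bottom (comp A i)]) \<and>
        ((\<nexists>j. answers A c i j) \<and> \<not> sends A c i \<longrightarrow> cstk c' i = cstk c i))"

definition step :: "('s, 'v, 'g) pcpa \<Rightarrow> ('s, 'v, 'g) config \<Rightarrow> ('s, 'v, 'g) config \<Rightarrow> bool" where
  "step A c c' \<longleftrightarrow> ord_step A c c' \<or> com_step A c c'"

definition lang_r :: "('s, 'v, 'g) pcpa \<Rightarrow> 'v list set" where
  "lang_r A = {x. set x \<subseteq> inp A \<and>
     (\<exists>c. (step A)\<^sup>*\<^sup>* (init_cfg A x) c \<and>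
          (\<forall>i\<in>{1..deg A}. cin c i = [] \<and> cst c i \<in> finals (comp A i)))}"

definition comm_property :: "('t \<times> bool, 'v, 'g) pcpa \<Rightarrow> bool" where
  "comm_property A \<longleftrightarrow>
     (\<forall>i\<in>{1..deg A}. \<exists>Q. states (comp A i) = Q \<times> UNIV) \<and>
     (\<forall>j\<in>{1..deg A}. \<not> snd (init (comp A j))) \<and>
     (\<forall>x r m. set x \<subseteq> inp A \<and> r 0 = init_cfg A x \<and> (\<forall>k<m. step A (r k) (r (Suc k))) \<longrightarrow>
        (\<forall>j\<in>{1..deg A}.
           (\<forall>k<m. \<forall>i. answers A (r k) i j \<longrightarrow>
               \<not> snd (cst (r k) i) \<and> \<not> snd (cst (r k) j)) \<and>
           (\<forall>t<m. ord_step A (r t) (r (Suc t)) \<longrightarrow>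
               (snd (cst (r (Suc t)) j) \<longleftrightarrow>
                 (\<exists>k<t. sends A (r k) j \<and>
                    (\<forall>l. k < l \<and> l < t \<longrightarrow> \<not> ord_step A (r l) (r (Suc l))))))))"

end

theory Submission
  imports Defs "HOL-Library.Countable" "HOL-Library.Infinite_Set" "HOL-Computational_Algebra.Primes"
begin

text \<open>A flag cannot simply be added to the states of the given system: the initial stack symbol of a
  component may itself be a query symbol, so a component that has just sent its stack may be refilled before its
  next ordinary transition, and nothing that it can then see tells this apart from an ordinary delivery.

  The given system \<open>A\<close>, of degree \<open>n\<close>, is therefore simulated by a machine whose only memory is one natural
  number. The stacks of \<open>A\<close> are read as digit expansions and become exponents of distinct primes, so that one step of \<open>A\<close>
  is a regular program over multiplications by fractions and divisibility tests. A system of degree \<open>n + 2\<close> runs such a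
  program: component 1 holds the number in unary on its stack, component \<open>n + 2\<close> is a clock whose stack grows
  linearly in time, and component \<open>i + 1\<close> reads the input on behalf of component \<open>i\<close> of \<open>A\<close>. Here all
  initial stack symbols are fresh and are not queries, and only component 1 queries, with at least two ordinary
  steps in between. Hence a component has just sent its stack if and only if it sees its initial symbol
  and is not in its initial state, and it can flag this.\<close>

section \<open>Regular programs\<close>

text \<open>The obstacle is that only the master may query, that whatever it receives lands on its
  own stack, and that the sender loses it. Hence no other component can serve as a store that is
  inspected and kept, and \<open>n\<close> stacks have to shrink to a single store first. Arithmetic
  on it needs a second store only for the duration of one pass, and elapsed time is such a store: a
  stack that grows steadily turns time into height without being told anything. Rounding to whole
  periods hides the constant overhead of a pass.

  The inputs cannot be folded into the number, because they can only be read by advancing along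
  them, and the components of \<open>A\<close> do so at different speeds. The states stay with them
  in the readers. The master never learns a state, only which stack rule a reader claims to apply;
  its program either goes on with exactly this rule or gets stuck, which is harmless because
  acceptance only asks for the existence of a run.

  Control states and symbols are numbered by countability, since the result type offers just a
  \<open>nat\<close> besides the given types.\<close>

datatype 'a com = Atom 'a | Skip | Fail | Seq "'a com" "'a com" | Choice "'a com" "'a com" | Star "'a com"

instance com :: (countable) countable
  by countable_datatype

primrec sem :: "('a \<Rightarrow> 's rel) \<Rightarrow> 'a com \<Rightarrow> 's rel" where
  "sem R (Atom a) = R a"
| "sem R Skip = Id"
| "sem R Fail = {}"
| "sem R (Seq c d) = sem R c O sem R d"
| "sem R (Choice c d) = sem R c \<union> sem R d"
| "sem R (Star c) = (sem R c)\<^sup>*"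

text \<open>Substitution of programs for atoms: every stage of the compilation that changes the
  instruction set is an instance.\<close>

primrec bind_com :: "('a \<Rightarrow> 'b com) \<Rightarrow> 'a com \<Rightarrow> 'b com" where
  "bind_com f (Atom a) = f a"
| "bind_com f Skip = Skip"
| "bind_com f Fail = Fail"
| "bind_com f (Seq c d) = Seq (bind_com f c) (bind_com f d)"
| "bind_com f (Choice c d) = Choice (bind_com f c) (bind_com f d)"
| "bind_com f (Star c) = Star (bind_com f c)"

lemma sem_bind_com: "sem R (bind_com f c) = sem (\<lambda>a. sem R (f a)) c"
  by (induction c) auto

text \<open>\<open>T\<close> is moved along a run of \<open>R\<close> from its start to its end, and
  along a run of \<open>Q\<close> from its end to its start, one step at a time. The equality in the
  hypothesis serves both directions, which are the two halves of an exact simulation.\<close>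

lemma relcomp_rtrancl_commute:
  assumes "T O R = Q O T"
  shows "T O R\<^sup>* = Q\<^sup>* O T"
proof
  show "T O R\<^sup>* \<subseteq> Q\<^sup>* O T"
  proof clarify
    fix a b c assume "(b, c) \<in> R\<^sup>*" "(a, b) \<in> T"
    then show "(a, c) \<in> Q\<^sup>* O T"
    proof (induction)
      case base then show ?case by auto
    next
      case (step y z)
      then obtain d where d: "(a, d) \<in> Q\<^sup>*" "(d, y) \<in> T" by auto
      with step have "(d, z) \<in> Q O T" using assms by blast
      with d show ?case by (meson relcomp.cases relcomp.relcompI rtrancl.rtrancl_into_rtrancl prod.inject)
    qed
  qed
  show "Q\<^sup>* O T \<subseteq> T O R\<^sup>*"
  proof clarify
    fix a b c assume "(a, b) \<in> Q\<^sup>*" "(b, c) \<in> T"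
    then show "(a, c) \<in> T O R\<^sup>*"
    proof (induction rule: converse_rtrancl_induct)
      case base then show ?case by auto
    next
      case (step y z)
      then obtain d where d: "(z, d) \<in> T" "(d, c) \<in> R\<^sup>*" by auto
      with step have "(y, d) \<in> T O R" using assms by blast
      with d show ?case by (meson relcomp.cases relcomp.relcompI converse_rtrancl_into_rtrancl prod.inject)
    qed
  qed
qed

text \<open>A change of data representation \<open>T\<close> that commutes with every atom commutes
  with the whole program, so that a compilation has to be checked on atoms only.\<close>

lemma sem_refine:
  assumes "\<forall>a\<in>set_com c. T O R a = Q a O T"
  shows "T O sem R c = sem Q c O T"
  using assms
proof (induction c)
  case (Seq c d)
  then have c: "T O sem R c = sem Q c O T" and d: "T O sem R d = sem Q d O T" by auto
  have "T O sem R (Seq c d) = (T O sem R c) O sem R d" by auto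
  also have "\<dots> = sem Q c O (T O sem R d)" unfolding c by auto
  also have "\<dots> = sem Q (Seq c d) O T" unfolding d by auto
  finally show ?case .
next
  case (Choice c d)
  then have c: "T O sem R c = sem Q c O T" and d: "T O sem R d = sem Q d O T" by auto
  have "T O sem R (Choice c d) = T O sem R c \<union> T O sem R d" by auto
  then show ?case unfolding c d by auto
next
  case (Star c)
  then show ?case using relcomp_rtrancl_commute[of T "sem R c" "sem Q c"] by simp
qed auto

text \<open>The nodes of the flow graph of a program are the lists of programs still to be executed.\<close>

primrec edges :: "'a com \<Rightarrow> 'a com list \<Rightarrow> ('a com list \<times> 'a option \<times> 'a com list) set" where
  "edges (Atom a) k = {(Atom a # k, Some a, k)}"
| "edges Skip k = {(Skip # k, None, k)}"
| "edges Fail k = {}"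
| "edges (Seq c d) k = insert (Seq c d # k, None, c # d # k) (edges c (d # k) \<union> edges d k)"
| "edges (Choice c d) k = {(Choice c d # k, None, c # k), (Choice c d # k, None, d # k)} \<union> edges c k \<union> edges d k"
| "edges (Star c) k = {(Star c # k, None, k), (Star c # k, None, c # Star c # k)} \<union> edges c (Star c # k)"

lemma finite_edges: "finite (edges c k)"
  by (induction c arbitrary: k) auto

lemma edges_atoms: "(p, Some a, q) \<in> edges c k \<Longrightarrow> a \<in> set_com c"
  by (induction c arbitrary: k) auto

definition grel :: "('a \<Rightarrow> 's rel) \<Rightarrow> ('p \<times> 'a \<times> 'p) set \<Rightarrow> ('p \<times> 's) rel" where
  "grel R E = {((p, s), (q, t)) | p s q t. \<exists>a. (p, a, q) \<in> E \<and> (s, t) \<in> R a}"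

lemma grelI: "(p, a, q) \<in> E \<Longrightarrow> (s, t) \<in> R a \<Longrightarrow> ((p, s), (q, t)) \<in> grel R E"
  unfolding grel_def by auto

abbreviation osem :: "('a \<Rightarrow> 's rel) \<Rightarrow> 'a option \<Rightarrow> 's rel" where
  "osem R \<equiv> case_option Id R"

primrec semlist :: "('a \<Rightarrow> 's rel) \<Rightarrow> 'a com list \<Rightarrow> 's rel" where
  "semlist R [] = Id"
| "semlist R (c # cs) = sem R c O semlist R cs"

text \<open>\<open>semlist R p\<close> is what the programs pending at the node \<open>p\<close> can
  still compute, and taking an edge is one way to begin.\<close>

lemma edges_sound:
  "(p, a, q) \<in> edges c k \<Longrightarrow> osem R a O semlist R q \<subseteq> semlist R p"
proof (induction c arbitrary: k)
  case (Star c)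
  consider "p = Star c # k" "a = None" "q = k" | "p = Star c # k" "a = None" "q = c # Star c # k"
    | "(p, a, q) \<in> edges c (Star c # k)"
    using Star.prems by auto
  then show ?case
  proof cases
    case 2
    have "sem R c O (sem R c)\<^sup>* \<subseteq> (sem R c)\<^sup>*" by auto
    then show ?thesis using 2 relcomp_mono[of "sem R c O (sem R c)\<^sup>*" "(sem R c)\<^sup>*" "semlist R k" "semlist R k"]
      by (auto simp flip: O_assoc)
  qed (use Star.IH[of "Star c # k"] in auto)
qed (fastforce)+

text \<open>A superset \<open>E\<close> of the edges is allowed so that the induction hypothesis
  applies to a subprogram inside the graph of the whole program.\<close>

lemma edges_complete:
  assumes "(s, t) \<in> sem R c" "edges c k \<subseteq> E"
  shows "((c # k, s), (k, t)) \<in> (grel (osem R) E)\<^sup>*"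
  using assms
proof (induction c arbitrary: k s t)
  case (Atom a)
  then show ?case by (auto intro!: r_into_rtrancl grelI)
next
  case Skip
  then show ?case by (auto intro!: r_into_rtrancl grelI)
next
  case Fail
  then show ?case by auto
next
  case (Seq c d)
  from Seq.prems obtain u where u: "(s, u) \<in> sem R c" "(u, t) \<in> sem R d" by auto
  have "((Seq c d # k, s), (c # d # k, s)) \<in> grel (osem R) E"
    using Seq.prems by (intro grelI[where a=None]) auto
  moreover have "((c # d # k, s), (d # k, u)) \<in> (grel (osem R) E)\<^sup>*"
    using Seq.IH(1)[OF u(1), of "d # k"] Seq.prems by auto
  moreover have "((d # k, u), (k, t)) \<in> (grel (osem R) E)\<^sup>*"
    using Seq.IH(2)[OF u(2), of "k"] Seq.prems by auto
  ultimately show ?case by (meson converse_rtrancl_into_rtrancl rtrancl_trans)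
next
  case (Choice c d)
  have 1: "((Choice c d # k, s), (x # k, s)) \<in> grel (osem R) E" if "x \<in> {c, d}" for x
    using Choice.prems that by (intro grelI[where a=None]) auto
  from Choice.prems consider "(s, t) \<in> sem R c" | "(s, t) \<in> sem R d" by auto
  then show ?case
  proof cases
    case A: 1
    show ?thesis using Choice.IH(1)[OF A, of k] 1[of c] Choice.prems
      by (auto intro: converse_rtrancl_into_rtrancl)
  next
    case A: 2
    show ?thesis using Choice.IH(2)[OF A, of k] 1[of d] Choice.prems
      by (auto intro: converse_rtrancl_into_rtrancl)
  qed
next
  case (Star c)
  have "(s, t) \<in> (sem R c)\<^sup>*" using Star.prems by simp
  then show ?case
  proof (induction rule: converse_rtrancl_induct)
    case base
    have "((Star c # k, t), (k, t)) \<in> grel (osem R) E"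
      using Star.prems by (intro grelI[where a=None]) auto
    then show ?case by auto
  next
    case (step y z)
    have "((Star c # k, y), (c # Star c # k, y)) \<in> grel (osem R) E"
      using Star.prems by (intro grelI[where a=None]) auto
    moreover have "((c # Star c # k, y), (Star c # k, z)) \<in> (grel (osem R) E)\<^sup>*"
      using Star.IH[OF step(1), of "Star c # k"] Star.prems by auto
    ultimately show ?case using step(3) by (meson converse_rtrancl_into_rtrancl rtrancl_trans)
  qed
qed

lemma edges_correct:
  "((([c], s), ([], t)) \<in> (grel (osem R) (edges c []))\<^sup>*) \<longleftrightarrow> (s, t) \<in> sem R c"
proof
  have *: "(s, t) \<in> semlist R p" if "((p, s), (q, u)) \<in> (grel (osem R) (edges c []))\<^sup>*" "(u, t) \<in> semlist R q"
    for p q s u t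
    using that
  proof (induction p s rule: converse_rtrancl_induct2)
    case refl then show ?case by simp
  next
    case (step p s p' s')
    then obtain a where "(p, a, p') \<in> edges c []" "(s, s') \<in> osem R a" unfolding grel_def by auto
    with edges_sound[of p a p' c "[]" R] step(3,4) show ?case by auto
  qed
  assume "((([c], s), ([], t)) \<in> (grel (osem R) (edges c []))\<^sup>*)"
  from *[OF this, of t] show "(s, t) \<in> sem R c" by auto
qed (rule edges_complete, auto)

text \<open>Injectivity of \<open>f\<close> keeps distinct nodes apart, so the renaming creates no
  new paths. Labels may be merged freely, because only their meaning counts.\<close>

lemma grel_map:
  assumes "inj f"
  shows "((f p, s), (f q, t)) \<in> (grel R ((\<lambda>(p, a, q). (f p, g a, f q)) ` E))\<^sup>*
    \<longleftrightarrow> ((p, s), (q, t)) \<in> (grel (\<lambda>a. R (g a)) E)\<^sup>*" (is "?l \<longleftrightarrow> ?r")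
proof
  have "\<exists>q. p' = f q \<and> ((p, s), (q, t)) \<in> (grel (\<lambda>a. R (g a)) E)\<^sup>*"
    if "((f p, s), (p', t)) \<in> (grel R ((\<lambda>(p, a, q). (f p, g a, f q)) ` E))\<^sup>*" for p' s t
    using that
  proof (induction p' t rule: rtrancl_induct2)
    case refl then show ?case by auto
  next
    case (step p' t p'' t')
    then obtain q where q: "p' = f q" "((p, s), (q, t)) \<in> (grel (\<lambda>a. R (g a)) E)\<^sup>*" by auto
    from step(2) q(1) obtain a r where "(q, a, r) \<in> E" "p'' = f r" "(t, t') \<in> R (g a)"
      unfolding grel_def using injD[OF assms] by auto
    with q(2) show ?case by (auto intro!: exI[of _ r] intro: rtrancl_into_rtrancl grelI)
  qed
  then show "?l \<Longrightarrow> ?r" using injD[OF assms] by blast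
next
  show "?r \<Longrightarrow> ?l"
  proof (induction q t rule: rtrancl_induct2)
    case (step q t q' t')
    then obtain a where "(q, a, q') \<in> E" "(t, t') \<in> R (g a)" unfolding grel_def by auto
    then have "((f q, t), (f q', t')) \<in> grel R ((\<lambda>(p, a, q). (f p, g a, f q)) ` E)"
      by (intro grelI[of _ "g a"]) force+
    with step show ?case by (meson rtrancl_into_rtrancl)
  qed auto
qed

section \<open>Counters as exponents of primes\<close>

text \<open>Up to \<open>Recv\<close>, a Fractran-like machine with an added test for
  non-divisibility; divisibility alone is the fraction \<open>Frac v v\<close>. \<open>Recv\<close>
  leaves the number alone and acts on states and inputs, which are never encoded.\<close>

datatype natom = Frac nat nat | NDiv nat | Recv nat nat

primrec nsem :: "(nat \<Rightarrow> nat \<Rightarrow> 'r rel) \<Rightarrow> natom \<Rightarrow> (nat \<times> 'r) rel" where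
  "nsem W (Frac v u) = {((N, r), (N div v * u, r)) | N r. v dvd N}"
| "nsem W (NDiv v) = {((N, r), (N, r)) | N r. \<not> v dvd N}"
| "nsem W (Recv i t) = {((N, r), (N, r')) | N r r'. (r, r') \<in> W i t}"

text \<open>One transfer instruction covers addition (\<open>a = 0\<close>), subtraction
  (\<open>b = 0\<close>) and moving, since each of them is a multiplication by a single
  fraction.\<close>

datatype catom = Move nat nat nat nat | Zero nat | CRecv nat nat

primrec csem :: "(nat \<Rightarrow> nat \<Rightarrow> 'r rel) \<Rightarrow> catom \<Rightarrow> ((nat \<Rightarrow> nat) \<times> 'r) rel" where
  "csem W (Move i a j b) = {((e, r), ((e(i := e i - a))(j := (e(i := e i - a)) j + b), r)) | e r. a \<le> e i}"
| "csem W (Zero i) = {((e, r), (e, r)) | e r. e i = 0}"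
| "csem W (CRecv i t) = {((e, r), (e, r')) | e r r'. (r, r') \<in> W i t}"

lemma csem_Move_iff:
  "((e, r), x) \<in> csem W (Move i a j b) \<longleftrightarrow>
    a \<le> e i \<and> x = ((e(i := e i - a))(j := (e(i := e i - a)) j + b), r)"
  by auto

lemma csem_Zero_iff: "((e, r), x) \<in> csem W (Zero i) \<longleftrightarrow> e i = 0 \<and> x = (e, r)"
  by auto

declare csem.simps(1,2) [simp del] csem_Move_iff [simp] csem_Zero_iff [simp]

definition pr :: "nat \<Rightarrow> nat" where
  "pr = enumerate {p. prime p}"

lemma prime_pr: "prime (pr k)"
  using enumerate_in_set[OF primes_infinite, of k] unfolding pr_def by simp

lemma pr_eq_iff: "pr k = pr l \<longleftrightarrow> k = l"
  using enumerate_mono[OF _ primes_infinite] unfolding pr_def by (metis linorder_cases less_irrefl)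

definition godel :: "nat \<Rightarrow> (nat \<Rightarrow> nat) \<Rightarrow> nat" where
  "godel m e = (\<Prod>k\<le>m. pr k ^ e k)"

lemma godel_split:
  assumes "k \<le> m"
  shows "godel m e = pr k ^ e k * (\<Prod>l\<in>{..m} - {k}. pr l ^ e l)"
  unfolding godel_def using assms by (subst prod.remove[of _ k]) auto

text \<open>The other factors are powers of other primes, hence coprime to \<open>pr k\<close>, and
  only the exponent \<open>e k\<close> decides.\<close>

lemma godel_dvd_iff:
  assumes "k \<le> m"
  shows "pr k ^ a dvd godel m e \<longleftrightarrow> a \<le> e k"
proof -
  have "coprime (pr k ^ a) (\<Prod>l\<in>{..m} - {k}. pr l ^ e l)"
  proof (intro prod_coprime_right)
    fix l assume "l \<in> {..m} - {k}"
    then have "coprime (pr k) (pr l)"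
      using prime_pr pr_eq_iff by (intro primes_coprime) auto
    then show "coprime (pr k ^ a) (pr l ^ e l)"
      by simp
  qed
  then have "pr k ^ a dvd godel m e \<longleftrightarrow> pr k ^ a dvd pr k ^ e k"
    unfolding godel_split[OF assms] by (simp add: coprime_dvd_mult_left_iff)
  also have "\<dots> \<longleftrightarrow> a \<le> e k"
    using prime_gt_1_nat[OF prime_pr[of k]] by (simp add: dvd_power_iff_le)
  finally show ?thesis .
qed

lemma godel_add:
  assumes "k \<le> m"
  shows "godel m (e(k := e k + b)) = godel m e * pr k ^ b"
proof -
  have "(\<Prod>l\<in>{..m} - {k}. pr l ^ (e(k := e k + b)) l) = (\<Prod>l\<in>{..m} - {k}. pr l ^ e l)"
    by (intro prod.cong) auto
  then show ?thesis
    unfolding godel_split[OF assms] by (simp add: power_add)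
qed

lemma godel_sub:
  assumes "k \<le> m" "a \<le> e k"
  shows "godel m (e(k := e k - a)) = godel m e div pr k ^ a"
proof -
  have "godel m e = godel m (e(k := e k - a)) * pr k ^ a"
    using godel_add[OF assms(1), of "e(k := e k - a)" a] assms(2) by simp
  then show ?thesis
    using prime_gt_0_nat[OF prime_pr[of k]] by simp
qed

primrec catom_code :: "catom \<Rightarrow> natom" where
  "catom_code (Move i a j b) = Frac (pr i ^ a) (pr j ^ b)"
| "catom_code (Zero i) = NDiv (pr i)"
| "catom_code (CRecv i t) = Recv i t"

primrec catom_bounded :: "nat \<Rightarrow> catom \<Rightarrow> bool" where
  "catom_bounded m (Move i a j b) \<longleftrightarrow> i \<le> m \<and> j \<le> m"
| "catom_bounded m (Zero i) \<longleftrightarrow> i \<le> m"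
| "catom_bounded m (CRecv i t) \<longleftrightarrow> True"

definition godel_rel :: "nat \<Rightarrow> (((nat \<Rightarrow> nat) \<times> 'r) \<times> (nat \<times> 'r)) set" where
  "godel_rel m = {((e, r), (godel m e, r)) | e r. True}"

text \<open>\<open>godel m\<close> forgets the counters beyond \<open>m\<close>. The bound on the
  atom makes this harmless, so the simulation is exact although the coding is not injective.\<close>

lemma godel_rel_simulates:
  assumes "catom_bounded m a"
  shows "godel_rel m O nsem W (catom_code a) = csem W a O godel_rel m"
proof (cases a)
  case (Move i a' j b)
  have "godel m ((e(i := e i - a'))(j := (e(i := e i - a')) j + b)) = godel m e div pr i ^ a' * pr j ^ b"
    if "a' \<le> e i" for e
    using that assms Move godel_add[of j m "e(i := e i - a')" b] godel_sub[of i m a' e] by auto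
  then show ?thesis
    using Move assms godel_dvd_iff[of i m a'] unfolding godel_rel_def by (auto simp: relcomp_unfold)
next
  case (Zero i)
  then show ?thesis
    using assms godel_dvd_iff[of i m 1] unfolding godel_rel_def by (auto simp: relcomp_unfold)
next
  case (CRecv i t)
  then show ?thesis
    unfolding godel_rel_def by (auto simp: relcomp_unfold)
qed

section \<open>Stacks as counters\<close>

lemma csem_Move_star:
  assumes "i \<noteq> j"
  shows "((e, r), x) \<in> (csem W (Move i a j b))\<^sup>* \<longleftrightarrow>
    (\<exists>k. k * a \<le> e i \<and> x = (e(i := e i - k * a, j := e j + k * b), r))" (is "_ \<longleftrightarrow> (\<exists>k. ?P k x)")
proof
  assume "((e, r), x) \<in> (csem W (Move i a j b))\<^sup>*"
  then show "\<exists>k. ?P k x"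
  proof (induction rule: rtrancl_induct)
    case base
    then show ?case by (intro exI[of _ 0]) auto
  next
    case (step y z)
    then obtain k where k: "k * a \<le> e i" "y = (e(i := e i - k * a, j := e j + k * b), r)" by blast
    with step(2) assms have "a \<le> e i - k * a"
      "z = ((e(i := e i - k * a, j := e j + k * b))(i := e i - k * a - a, j := e j + k * b + b), r)"
      by auto
    with k(1) assms have "?P (Suc k) z" by (auto intro!: ext)
    then show ?case by blast
  qed
next
  assume "\<exists>k. ?P k x"
  then obtain k where "?P k x" by auto
  then show "((e, r), x) \<in> (csem W (Move i a j b))\<^sup>*"
  proof (induction k arbitrary: x)
    case 0
    then show ?case by auto
  next
    case (Suc k)
    let ?e = "e(i := e i - k * a, j := e j + k * b)"
    have "((e, r), (?e, r)) \<in> (csem W (Move i a j b))\<^sup>*"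
      by (rule Suc.IH) (use Suc.prems in auto)
    moreover have "((?e, r), x) \<in> csem W (Move i a j b)"
      using Suc.prems assms by (auto simp: fun_eq_iff)
    ultimately show ?case by (rule rtrancl_into_rtrancl)
  qed
qed

text \<open>A Horner step \<open>b * e i + d\<close> through the scratch counter \<open>z\<close>. A
  star may stop at any time, so a zero test follows each one and forces the transfer to be
  complete.\<close>

definition push_code :: "nat \<Rightarrow> nat \<Rightarrow> nat \<Rightarrow> nat \<Rightarrow> catom com" where
  "push_code b z i d = Seq (Star (Atom (Move i 1 z 1))) (Seq (Atom (Zero i))
     (Seq (Star (Atom (Move z 1 i b))) (Seq (Atom (Zero z)) (Atom (Move z 0 i d)))))"

text \<open>The inverse Horner step. The zero test of \<open>i\<close> blocks when \<open>b\<close>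
  does not divide what is left after the subtraction of \<open>d\<close>, so a wrong guess of the
  top digit has no continuation.\<close>

definition pop_code :: "nat \<Rightarrow> nat \<Rightarrow> nat \<Rightarrow> nat \<Rightarrow> catom com" where
  "pop_code b z i d = Seq (Atom (Move i d z 0)) (Seq (Star (Atom (Move i b z 1))) (Seq (Atom (Zero i))
     (Seq (Star (Atom (Move z 1 i 1))) (Atom (Zero z)))))"

lemma sem_push_code:
  assumes "i \<noteq> z" "e z = 0"
  shows "((e, r), x) \<in> sem (csem W) (push_code b z i d) \<longleftrightarrow> x = (e(i := b * e i + d), r)"
proof
  assume "((e, r), x) \<in> sem (csem W) (push_code b z i d)"
  then obtain x1 x1' x2 x2' where 1: "((e, r), x1) \<in> (csem W (Move i 1 z 1))\<^sup>*" "(x1, x1') \<in> csem W (Zero i)"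
    "(x1', x2) \<in> (csem W (Move z 1 i b))\<^sup>*" "(x2, x2') \<in> csem W (Zero z)" "(x2', x) \<in> csem W (Move z 0 i d)"
    unfolding push_code_def by (auto simp del: csem_Move_iff csem_Zero_iff)
  from 1(1) obtain k where "k \<le> e i" "x1 = (e(i := e i - k, z := e z + k), r)"
    using assms csem_Move_star[of i z e r x1 W 1 1] by auto
  with 1(2) assms have x1: "x1' = (e(i := 0, z := e i), r)" by auto
  from 1(3)[unfolded x1] obtain l where l: "l \<le> e i" "x2 = (e(i := l * b, z := e i - l), r)"
    using assms by (subst (asm) csem_Move_star) (auto simp: fun_upd_twist)
  with 1(4) assms have x2: "x2' = (e(z := 0, i := e i * b), r)" by (auto simp: fun_upd_twist)
  from 1(5)[unfolded x2] assms show "x = (e(i := b * e i + d), r)"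
    by (simp add: fun_upd_idem mult.commute)
next
  assume x: "x = (e(i := b * e i + d), r)"
  let ?e1 = "e(i := 0, z := e i)" and ?e2 = "e(i := b * e i)"
  have "((e, r), (?e1, r)) \<in> (csem W (Move i 1 z 1))\<^sup>*"
    using assms by (subst csem_Move_star) (auto intro!: exI[of _ "e i"])
  moreover have "((?e1, r), (?e1, r)) \<in> csem W (Zero i)" using assms by auto
  moreover have "((?e1, r), (?e2, r)) \<in> (csem W (Move z 1 i b))\<^sup>*"
    using assms by (subst csem_Move_star) (auto intro!: exI[of _ "e i"] simp: fun_eq_iff)
  moreover have "((?e2, r), (?e2, r)) \<in> csem W (Zero z)" using assms by auto
  moreover have "((?e2, r), x) \<in> csem W (Move z 0 i d)" using assms x by (auto simp: fun_eq_iff)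
  ultimately show "((e, r), x) \<in> sem (csem W) (push_code b z i d)"
    unfolding push_code_def by (auto simp del: csem_Move_iff csem_Zero_iff)
qed

lemma sem_pop_code:
  assumes "i \<noteq> z" "e z = 0" "0 < b"
  shows "((e, r), x) \<in> sem (csem W) (pop_code b z i d) \<longleftrightarrow> (\<exists>k. e i = b * k + d \<and> x = (e(i := k), r))"
proof
  assume "((e, r), x) \<in> sem (csem W) (pop_code b z i d)"
  then obtain x1 x2 x2' x3 where 1: "((e, r), x1) \<in> csem W (Move i d z 0)" "(x1, x2) \<in> (csem W (Move i b z 1))\<^sup>*"
    "(x2, x2') \<in> csem W (Zero i)" "(x2', x3) \<in> (csem W (Move z 1 i 1))\<^sup>*" "(x3, x) \<in> csem W (Zero z)"
    unfolding pop_code_def by (auto simp del: csem_Move_iff csem_Zero_iff)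
  from 1(1) assms have x1: "d \<le> e i" "x1 = (e(i := e i - d), r)" by auto
  from 1(2)[unfolded x1] obtain k where k: "k * b \<le> e i - d" "x2 = (e(i := e i - d - k * b, z := k), r)"
    using assms by (subst (asm) csem_Move_star) auto
  with 1(3) assms have x2: "x2' = (e(i := 0, z := k), r)" and "e i \<le> d + k * b" by auto
  with k(1) x1(1) have e: "e i = b * k + d" by (simp add: mult.commute)
  from 1(4)[unfolded x2] obtain l where "l \<le> k" "x3 = (e(i := l, z := k - l), r)"
    using assms by (subst (asm) csem_Move_star) (auto simp: fun_upd_twist)
  with 1(5) assms have "x = (e(i := k, z := 0), r)" by auto
  then have "x = (e(i := k), r)" using assms by (simp add: fun_upd_twist fun_upd_idem)
  with e show "\<exists>k. e i = b * k + d \<and> x = (e(i := k), r)" by blast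
next
  assume "\<exists>k. e i = b * k + d \<and> x = (e(i := k), r)"
  then obtain k where k: "e i = b * k + d" and x: "x = (e(i := k), r)" by auto
  let ?e1 = "e(i := b * k)" and ?e2 = "e(i := 0, z := k)"
  have "((e, r), (?e1, r)) \<in> csem W (Move i d z 0)"
    using assms k by (auto simp: fun_eq_iff)
  moreover have "((?e1, r), (?e2, r)) \<in> (csem W (Move i b z 1))\<^sup>*"
    using assms by (subst csem_Move_star) (auto intro!: exI[of _ "k"] simp: fun_eq_iff)
  moreover have "((?e2, r), (?e2, r)) \<in> csem W (Zero i)" using assms by auto
  moreover have "((?e2, r), x) \<in> (csem W (Move z 1 i 1))\<^sup>*"
    using assms x by (subst csem_Move_star) (auto intro!: exI[of _ "k"] simp: fun_eq_iff)
  moreover have "(x, x) \<in> csem W (Zero z)" using assms x by auto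
  ultimately show "((e, r), x) \<in> sem (csem W) (pop_code b z i d)"
    unfolding pop_code_def by (auto simp del: csem_Move_iff csem_Zero_iff)
qed

datatype 'g satom = Push nat 'g | Pop nat 'g | Empty nat | Get nat nat

definition setstk :: "('s, 'v, 'g) config \<Rightarrow> nat \<Rightarrow> 'g list \<Rightarrow> ('s, 'v, 'g) config" where
  "setstk c i w = c(i := (cst c i, cin c i, w))"

definition proj :: "('s, 'v, 'g) config \<Rightarrow> nat \<Rightarrow> 's \<times> 'v list" where
  "proj c i = (cst c i, cin c i)"

lemma setstk_simps [simp]:
  "cst (setstk c i w) = cst c" "cin (setstk c i w) = cin c" "cstk (setstk c i w) = (cstk c)(i := w)"
  "proj (setstk c i w) = proj c"
  by (auto simp: setstk_def cst_def cin_def cstk_def proj_def)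

primrec ssem :: "(nat \<Rightarrow> nat \<Rightarrow> (nat \<Rightarrow> 's \<times> 'v list) rel) \<Rightarrow> 'g satom \<Rightarrow> ('s, 'v, 'g) config rel" where
  "ssem W (Push i g) = {(c, setstk c i (g # cstk c i)) | c. True}"
| "ssem W (Pop i g) = {(c, setstk c i w) | c w. cstk c i = g # w}"
| "ssem W (Empty i) = {(c, c) | c. cstk c i = []}"
| "ssem W (Get i t) = {(c, c') | c c'. (proj c, proj c') \<in> W i t \<and> cstk c' = cstk c}"

text \<open>Digits are positive so that only the empty stack has value 0, which turns
  \<open>Empty\<close> into a zero test; they are below \<open>b\<close> so that the value modulo
  \<open>b\<close> reveals the top symbol.\<close>

locale stack_coding =
  fixes d :: "'g \<Rightarrow> nat" and b :: nat and Al :: "'g set" and n :: nat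
  assumes inj: "inj_on d Al" and pos: "g \<in> Al \<Longrightarrow> 0 < d g" and lt: "g \<in> Al \<Longrightarrow> d g < b"
    and b_pos: "0 < b"
begin

primrec val :: "'g list \<Rightarrow> nat" where
  "val [] = 0"
| "val (g # w) = b * val w + d g"

lemma val_eq_0_iff: "set w \<subseteq> Al \<Longrightarrow> val w = 0 \<longleftrightarrow> w = []"
  using pos by (cases w) auto

lemma val_eq_iff:
  assumes "set w \<subseteq> Al" "g \<in> Al"
  shows "val w = b * k + d g \<longleftrightarrow> (\<exists>w'. w = g # w' \<and> k = val w')"
proof (cases w)
  case Nil
  then show ?thesis using pos[OF assms(2)] by auto
next
  case (Cons h w')
  have h: "h \<in> Al" using assms Cons by auto
  have "(b * val w' + d h = b * k + d g) \<longleftrightarrow> d h = d g \<and> val w' = k"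
  proof
    assume eq: "b * val w' + d h = b * k + d g"
    then have "(b * val w' + d h) mod b = (b * k + d g) mod b" by simp
    then have "d h = d g" using lt[OF h] lt[OF assms(2)] by simp
    with eq b_pos show "d h = d g \<and> val w' = k" by simp
  qed auto
  then show ?thesis using Cons inj h assms(2) by (auto simp: inj_on_eq_iff)
qed

definition valid :: "('s, 'v, 'g) config \<Rightarrow> bool" where
  "valid c \<longleftrightarrow> (\<forall>i\<le>n. set (cstk c i) \<subseteq> Al)"

text \<open>The value 0 beyond \<open>n\<close> provides counter \<open>Suc n\<close> as the scratch
  counter of \<open>push_code\<close> and \<open>pop_code\<close>, empty between
  instructions.\<close>

definition vals :: "('s, 'v, 'g) config \<Rightarrow> nat \<Rightarrow> nat" where
  "vals c i = (if i \<le> n then val (cstk c i) else 0)"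

definition stack_rel :: "(('s, 'v, 'g) config \<times> ((nat \<Rightarrow> nat) \<times> (nat \<Rightarrow> 's \<times> 'v list))) set" where
  "stack_rel = {(c, (vals c, proj c)) | c. valid c}"

primrec satom_code :: "'g satom \<Rightarrow> catom com" where
  "satom_code (Push i g) = push_code b (Suc n) i (d g)"
| "satom_code (Pop i g) = pop_code b (Suc n) i (d g)"
| "satom_code (Empty i) = Atom (Zero i)"
| "satom_code (Get i t) = Atom (CRecv i t)"

primrec satom_bounded :: "'g satom \<Rightarrow> bool" where
  "satom_bounded (Push i g) \<longleftrightarrow> i \<le> n \<and> g \<in> Al"
| "satom_bounded (Pop i g) \<longleftrightarrow> i \<le> n \<and> g \<in> Al"
| "satom_bounded (Empty i) \<longleftrightarrow> i \<le> n"
| "satom_bounded (Get i t) \<longleftrightarrow> True"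

lemma vals_setstk: "i \<le> n \<Longrightarrow> vals (setstk c i w) = (vals c)(i := val w)"
  by (auto simp: vals_def)

text \<open>An equivalence rather than an implication, because \<open>stack_rel_simulates\<close> is
  an equality of relations and validity has to be carried backwards as well.\<close>

lemma valid_setstk:
  assumes "set w \<subseteq> Al \<longleftrightarrow> set (cstk c i) \<subseteq> Al"
  shows "valid (setstk c i w) \<longleftrightarrow> valid c"
  unfolding valid_def using assms by auto

lemma vals_bounded: "i \<le> n \<Longrightarrow> i \<noteq> Suc n" "vals c (Suc n) = 0" "i \<le> n \<Longrightarrow> vals c i = val (cstk c i)"
  by (auto simp: vals_def)

lemma stack_rel_simulates:
  fixes W :: "nat \<Rightarrow> nat \<Rightarrow> (nat \<Rightarrow> 's \<times> 'v list) rel"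
  assumes "satom_bounded a"
  shows "stack_rel O sem (csem W) (satom_code a) = ssem W a O stack_rel" (is "?l = ?r")
proof -
  have "(c, x) \<in> ?l \<longleftrightarrow> (c, x) \<in> ?r" for c :: "('s, 'v, 'g) config" and x
  proof (cases a)
    case (Push i g)
    then have i: "i \<le> n" and g: "g \<in> Al" using assms by auto
    have "(c, x) \<in> ?l \<longleftrightarrow> valid c \<and> ((vals c, proj c), x) \<in> sem (csem W) (push_code b (Suc n) i (d g))"
      unfolding stack_rel_def Push by auto
    also have "\<dots> \<longleftrightarrow> valid c \<and> x = ((vals c)(i := b * val (cstk c i) + d g), proj c)"
      using vals_bounded(1,2) i by (subst sem_push_code) (auto simp: vals_bounded(3))
    also have "\<dots> \<longleftrightarrow> (c, x) \<in> ?r"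
      unfolding stack_rel_def Push using vals_setstk[OF i, of c "g # cstk c i"] g
        valid_setstk[of "g # cstk c i" c i] by auto
    finally show ?thesis .
  next
    case (Pop i g)
    then have i: "i \<le> n" and g: "g \<in> Al" using assms by auto
    have "(c, x) \<in> ?l \<longleftrightarrow> valid c \<and> ((vals c, proj c), x) \<in> sem (csem W) (pop_code b (Suc n) i (d g))"
      unfolding stack_rel_def Pop by auto
    also have "\<dots> \<longleftrightarrow> valid c \<and> (\<exists>k. val (cstk c i) = b * k + d g \<and> x = ((vals c)(i := k), proj c))"
      using vals_bounded(1,2) i b_pos by (subst sem_pop_code) (auto simp: vals_bounded(3))
    also have "\<dots> \<longleftrightarrow> valid c \<and> (\<exists>w. cstk c i = g # w \<and> x = ((vals c)(i := val w), proj c))"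
      using val_eq_iff[OF _ g, of "cstk c i"] i unfolding valid_def by (metis (no_types))
    also have "\<dots> \<longleftrightarrow> (c, x) \<in> ?r"
      unfolding stack_rel_def Pop using vals_setstk[OF i, of c] g
        valid_setstk[of _ c i] by auto
    finally show ?thesis .
  next
    case (Empty i)
    then show ?thesis using assms val_eq_0_iff[of "cstk c i"] unfolding stack_rel_def
      by (auto simp: vals_def valid_def)
  next
    case (Get i t)
    show ?thesis
    proof
      assume "(c, x) \<in> ?l"
      then obtain r where r: "valid c" "x = (vals c, r)" "(proj c, r) \<in> W i t"
        unfolding stack_rel_def Get by auto
      \<comment> \<open>\<open>ssem\<close> speaks of whole configurations, so the new states and
        inputs \<open>r\<close> are completed with the old stacks.\<close>
      let ?c = "\<lambda>i. (fst (r i), snd (r i), cstk c i)"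
      have "proj ?c = r" "cstk ?c = cstk c" "vals ?c = vals c"
        by (auto simp: proj_def cst_def cin_def cstk_def vals_def fun_eq_iff)
      with r show "(c, x) \<in> ?r"
        unfolding stack_rel_def Get by (auto simp: valid_def intro!: relcompI[of _ ?c])
    next
      assume "(c, x) \<in> ?r"
      then obtain c' where "(proj c, proj c') \<in> W i t" "cstk c' = cstk c" "x = (vals c', proj c')" "valid c'"
        unfolding stack_rel_def Get by auto
      moreover from this have "vals c' = vals c" "valid c" by (auto simp: vals_def valid_def fun_eq_iff)
      ultimately show "(c, x) \<in> ?l"
        unfolding stack_rel_def Get by auto
    qed
  qed
  then show ?thesis by (intro set_eqI) (metis surj_pair)
qed

end

section \<open>A program for the steps of a system\<close>

definition seqs :: "'a com list \<Rightarrow> 'a com" where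
  "seqs cs = foldr Seq cs Skip"

definition choices :: "'a com list \<Rightarrow> 'a com" where
  "choices cs = foldr Choice cs Fail"

lemma sem_seqs [simp]: "sem R (seqs []) = Id" "sem R (seqs (c # cs)) = sem R c O sem R (seqs cs)"
  by (auto simp: seqs_def)

lemma sem_choices [simp]: "sem R (choices cs) = (\<Union>c\<in>set cs. sem R c)"
  unfolding choices_def by (induction cs) auto

lemma set_com_seqs [simp]: "set_com (seqs cs) = (\<Union>c\<in>set cs. set_com c)"
  unfolding seqs_def by (induction cs) auto

lemma set_com_choices [simp]: "set_com (choices cs) = (\<Union>c\<in>set cs. set_com c)"
  unfolding choices_def by (induction cs) auto

text \<open>Programs that each act on a component of their own do not see one another, so running
  them in sequence yields the simultaneous moves of a step.\<close>

lemma sem_seqs_local: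
  assumes "\<And>i. i \<in> set is \<Longrightarrow> sem R (P i) = {(c, c(i := y)) | c y. L i (c i) y}" "distinct is"
  shows "sem R (seqs (map P is)) = {(c, c'). (\<forall>i\<in>set is. L i (c i) (c' i)) \<and> (\<forall>i. i \<notin> set is \<longrightarrow> c' i = c i)}"
  using assms
proof (induction "is")
  case Nil
  then show ?case by (auto simp: fun_eq_iff)
next
  case (Cons i "is")
  have "sem R (seqs (map P (i # is))) =
    {(c, c(i := y)) | c y. L i (c i) y} O {(c, c'). (\<forall>i\<in>set is. L i (c i) (c' i)) \<and> (\<forall>i. i \<notin> set is \<longrightarrow> c' i = c i)}"
  proof -
    have 1: "sem R (P i) = {(c, c(i := y)) | c y. L i (c i) y}" by (rule Cons.prems) auto
    have 2: "sem R (seqs (map P is)) =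
        {(c, c'). (\<forall>i\<in>set is. L i (c i) (c' i)) \<and> (\<forall>i. i \<notin> set is \<longrightarrow> c' i = c i)}"
      by (rule Cons.IH) (use Cons.prems in auto)
    show ?thesis by (simp only: list.map sem_seqs 1 2)
  qed
  also have "\<dots> = {(c, c'). (\<forall>i\<in>set (i # is). L i (c i) (c' i)) \<and> (\<forall>i'. i' \<notin> set (i # is) \<longrightarrow> c' i' = c i')}"
    (is "?l = ?r")
  proof
    show "?l \<subseteq> ?r" using Cons.prems(2) by (auto split: if_splits)
    show "?r \<subseteq> ?l"
    proof clarify
      fix c c' assume *: "\<forall>i\<in>set (i # is). L i (c i) (c' i)" "\<forall>i'. i' \<notin> set (i # is) \<longrightarrow> c' i' = c i'"
      then have "(c, c(i := c' i)) \<in> {(c, c(i := y)) | c y. L i (c i) y}" by auto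
      moreover have "(c(i := c' i), c') \<in> {(c, c'). (\<forall>i\<in>set is. L i (c i) (c' i)) \<and> (\<forall>i. i \<notin> set is \<longrightarrow> c' i = c i)}"
        using * Cons.prems(2) by auto
      ultimately show "(c, c') \<in> ?l" by blast
    qed
  qed
  finally show ?case .
qed

text \<open>\<open>\<phi>\<close> predicts the result and is constant along runs, so a final state
  can only be the predicted one; the decreasing measure shows that one is reached. A
  nondeterministic loop with an exit test is thereby a function.\<close>

lemma loop_sem:
  assumes "\<And>c c'. (c, c') \<in> R \<Longrightarrow> \<phi> c' = \<phi> c" "\<And>c. final c \<Longrightarrow> \<phi> c = c"
    and "\<And>c. V c \<Longrightarrow> \<not> final c \<Longrightarrow> \<exists>c'. (c, c') \<in> R \<and> V c' \<and> m c' < (m c :: nat)"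
    and "V c"
  shows "(c, x) \<in> R\<^sup>* \<and> final x \<longleftrightarrow> x = \<phi> c"
proof -
  have 1: "\<phi> x = \<phi> c" if "(c, x) \<in> R\<^sup>*" for x
    using that by (induction rule: rtrancl_induct) (auto simp: assms(1))
  have 2: "\<exists>x. (c, x) \<in> R\<^sup>* \<and> final x" using assms(4)
  proof (induction "m c" arbitrary: c rule: less_induct)
    case less
    show ?case
    proof (cases "final c")
      case False
      with assms(3) less obtain c' x where "(c, c') \<in> R" "(c', x) \<in> R\<^sup>*" "final x" by meson
      then show ?thesis by (meson converse_rtrancl_into_rtrancl)
    qed auto
  qed
  from 1 2 assms(2) show ?thesis by metis
qed

definition with_stks :: "('s, 'v, 'g) config \<Rightarrow> (nat \<Rightarrow> 'g list) \<Rightarrow> ('s, 'v, 'g) config" where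
  "with_stks c F = (\<lambda>i. (cst c i, cin c i, F i))"

lemma with_stks_simps [simp]:
  "cst (with_stks c F) = cst c" "cin (with_stks c F) = cin c" "cstk (with_stks c F) = F"
  "proj (with_stks c F) = proj c" "with_stks (with_stks c F) G = with_stks c G"
  "with_stks (setstk c i w) F = with_stks c F"
  by (auto simp: with_stks_def setstk_def cst_def cin_def cstk_def proj_def)

lemma config_eq_iff: "c = c' \<longleftrightarrow> cst c = cst c' \<and> cin c = cin c' \<and> cstk c = cstk c'"
  by (auto simp: cst_def cin_def cstk_def fun_eq_iff prod_eq_iff)

lemma setstk_eq_upd: "setstk c i w = c(i := (fst (c i), fst (snd (c i)), w))"
  by (simp add: setstk_def cst_def cin_def)

lemma sem_Push_all:
  assumes "distinct Q"
  shows "sem (ssem W) (seqs (map (\<lambda>i. Atom (Push i g)) Q)) =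
    {(c, with_stks c (\<lambda>i. if i \<in> set Q then g # cstk c i else cstk c i)) | c. True}"
proof -
  have "sem (ssem W) (seqs (map (\<lambda>i. Atom (Push i g)) Q)) =
    {(c, c'). (\<forall>i\<in>set Q. c' i = (fst (c i), fst (snd (c i)), g # snd (snd (c i)))) \<and> (\<forall>i. i \<notin> set Q \<longrightarrow> c' i = c i)}"
    using assms by (intro sem_seqs_local) (auto simp: setstk_eq_upd cstk_def)
  then show ?thesis
    by (auto simp: with_stks_def cst_def cin_def cstk_def fun_eq_iff)
qed

lemma sem_Pop_all:
  fixes W :: "nat \<Rightarrow> nat \<Rightarrow> (nat \<Rightarrow> 's \<times> 'v list) rel"
    and f :: "nat \<Rightarrow> 'g"
  assumes "distinct Q"
  shows "sem (ssem W) (seqs (map (\<lambda>i. Atom (Pop i (f i))) Q)) =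
    {(c, with_stks c (\<lambda>i. if i \<in> set Q then tl (cstk c i) else cstk c i)) | c.
       \<forall>i\<in>set Q. cstk c i \<noteq> [] \<and> hd (cstk c i) = f i}"
proof -
  have "sem (ssem W) (seqs (map (\<lambda>i. Atom (Pop i (f i))) Q)) =
    {(c, c'). (\<forall>i\<in>set Q. \<exists>w. snd (snd (c i)) = f i # w \<and> c' i = (fst (c i), fst (snd (c i)), w)) \<and>
       (\<forall>i. i \<notin> set Q \<longrightarrow> c' i = c i)}"
    using assms by (intro sem_seqs_local) (auto simp: setstk_eq_upd cstk_def)
  also have "\<dots> = {(c, c'). (\<forall>i\<in>set Q. snd (snd (c i)) \<noteq> [] \<and> hd (snd (snd (c i))) = f i \<and>
      c' i = (fst (c i), fst (snd (c i)), tl (snd (snd (c i))))) \<and> (\<forall>i. i \<notin> set Q \<longrightarrow> c' i = c i)}"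
  proof -
    have "(\<exists>w. x = g # w \<and> y = (p, q, w)) \<longleftrightarrow> x \<noteq> [] \<and> hd x = g \<and> y = (p, q, tl x)"
      for x :: "'g list" and g y and p :: 's and q :: "'v list"
      by (cases x) auto
    then show ?thesis by simp
  qed
  also have "\<dots> = {(c, with_stks c (\<lambda>i. if i \<in> set Q then tl (cstk c i) else cstk c i)) | c.
       \<forall>i\<in>set Q. cstk c i \<noteq> [] \<and> hd (cstk c i) = f i}"
    by (auto simp: with_stks_def cst_def cin_def cstk_def fun_eq_iff)
  finally show ?thesis .
qed

text \<open>Popping a symbol and pushing it back is the test for the top symbol.\<close>

lemma sem_Pop_Push:
  fixes W :: "nat \<Rightarrow> nat \<Rightarrow> (nat \<Rightarrow> 's \<times> 'v list) rel" and g :: 'g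
  shows "sem (ssem W) (Seq (Atom (Pop i g)) (Atom (Push i g))) =
  {(c, c) | c. cstk c i \<noteq> [] \<and> hd (cstk c i) = g}"
proof -
  have *: "setstk (setstk c i w) i (g # w) = c" if "cstk c i = g # w" for c :: "('s, 'v, 'g) config" and w
    using that by (auto simp: config_eq_iff)
  show ?thesis by (auto simp: relcomp_unfold * neq_Nil_conv intro: *[symmetric])
qed

lemma relcomp_Collect: "{(c, f c w) | c w. P c w} O {(c, h c) | c. True} = {(c, h (f c w)) | c w. P c w}"
  by auto

lemma sem_test_tops:
  fixes W :: "nat \<Rightarrow> nat \<Rightarrow> (nat \<Rightarrow> 's \<times> 'v list) rel"
  assumes "distinct Q"
  shows "sem (ssem W) (seqs (map (\<lambda>i. Seq (Atom (Pop i (f i))) (Atom (Push i (f i)))) Q)) =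
    {(c, c) | c. \<forall>i\<in>set Q. cstk c i \<noteq> [] \<and> hd (cstk c i) = f i}"
proof -
  have "sem (ssem W) (seqs (map (\<lambda>i. Seq (Atom (Pop i (f i))) (Atom (Push i (f i)))) Q)) =
    {(c, c'). (\<forall>i\<in>set Q. snd (snd (c i)) \<noteq> [] \<and> hd (snd (snd (c i))) = f i \<and> c' i = c i) \<and>
       (\<forall>i. i \<notin> set Q \<longrightarrow> c' i = c i)}"
  proof (intro sem_seqs_local)
    fix i assume "i \<in> set Q"
    show "sem (ssem W) (Seq (Atom (Pop i (f i))) (Atom (Push i (f i)))) =
      {(c, c(i := y)) | c y. snd (snd (c i)) \<noteq> [] \<and> hd (snd (snd (c i))) = f i \<and> y = c i}"
      unfolding sem_Pop_Push cstk_def by auto (metis fun_upd_triv prod_cases3)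
  qed fact
  also have "\<dots> = {(c, c) | c. \<forall>i\<in>set Q. cstk c i \<noteq> [] \<and> hd (cstk c i) = f i}"
    by (auto simp: cstk_def fun_eq_iff)
  finally show ?thesis .
qed

text \<open>Pouring a stack reverses it, so a stack is copied by pouring it into the scratch stack 0 first.\<close>

definition pour :: "'g list \<Rightarrow> nat \<Rightarrow> nat list \<Rightarrow> 'g satom com" where
  "pour al s Q = Seq (Star (choices (map (\<lambda>g. Seq (Atom (Pop s g)) (seqs (map (\<lambda>i. Atom (Push i g)) Q))) al)))
     (Atom (Empty s))"

lemma sem_pour:
  fixes c :: "('s, 'v, 'g) config"
  assumes "distinct Q" "s \<notin> set Q" "set (cstk c s) \<subseteq> set al"
  shows "(c, x) \<in> sem (ssem W) (pour al s Q) \<longleftrightarrow> x = with_stks c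
    (\<lambda>i. if i = s then [] else if i \<in> set Q then rev (cstk c s) @ cstk c i else cstk c i)"
proof -
  let ?R = "sem (ssem W) (choices (map (\<lambda>g. Seq (Atom (Pop s g)) (seqs (map (\<lambda>i. Atom (Push i g)) Q))) al))"
  let ?\<phi> = "\<lambda>c. with_stks c
    (\<lambda>i. if i = s then [] else if i \<in> set Q then rev (cstk c s) @ cstk c i else cstk c i)"
  have R: "?R = {(c, with_stks c (\<lambda>i. if i = s then w else if i \<in> set Q then g # cstk c i else cstk c i)) | c g w.
      g \<in> set al \<and> cstk c s = g # w}"
  proof -
    let ?P = "\<lambda>g c. with_stks c (\<lambda>i. if i \<in> set Q then g # cstk c i else cstk c i)"
    have 1: "?P g (setstk c s w) = with_stks c (\<lambda>i. if i = s then w else if i \<in> set Q then g # cstk c i else cstk c i)"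
      for c :: "('s, 'v, 'g) config" and g w
      using assms(2) by (auto simp: config_eq_iff)
    have "?R = {(c, ?P g (setstk c s w)) | c g w. g \<in> set al \<and> cstk c s = g # w}"
      unfolding sem_choices set_map UN_simps sem.simps ssem.simps sem_Push_all[OF assms(1)] relcomp_Collect
      by auto
    then show ?thesis unfolding 1 .
  qed
  have "(c, x) \<in> sem (ssem W) (pour al s Q) \<longleftrightarrow> (c, x) \<in> ?R\<^sup>* \<and> cstk x s = []"
    unfolding pour_def by auto
  also have "\<dots> \<longleftrightarrow> x = ?\<phi> c"
  proof (rule loop_sem[where V="\<lambda>c. set (cstk c s) \<subseteq> set al" and m="\<lambda>c. length (cstk c s)"])
    \<comment> \<open>One round moves \<open>g\<close> from the source to each target
      \<open>u\<close>, and \<open>rev (g # w) @ u = rev w @ g # u\<close> keeps the prediction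
      unchanged.\<close>
    show "?\<phi> c' = ?\<phi> c" if "(c, c') \<in> ?R" for c c'
      using that assms(2) unfolding R by (auto simp: config_eq_iff fun_eq_iff)
    show "?\<phi> c = c" if "cstk c s = []" for c
      using that by (auto simp: config_eq_iff fun_eq_iff)
    show "\<exists>c'. (c, c') \<in> ?R \<and> set (cstk c' s) \<subseteq> set al \<and> length (cstk c' s) < length (cstk c s)"
      if "set (cstk c s) \<subseteq> set al" "cstk c s \<noteq> []" for c
      using that unfolding R by (cases "cstk c s") auto
  qed fact
  finally show ?thesis .
qed

lemma setstk_cstk: "setstk c i (cstk c i) = c"
  by (simp add: config_eq_iff)

lemma setstk_setstk: "setstk (setstk c i u) i w = setstk c i w"
  by (simp add: config_eq_iff)

lemma sem_Push_word:
  "sem (ssem W) (seqs (map (\<lambda>g. Atom (Push i g)) w)) = {(c, setstk c i (rev w @ cstk c i)) | c. True}"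
  by (induction w) (auto simp: setstk_cstk setstk_setstk)

section \<open>The given system and its ordinary steps as a program\<close>

locale pcpa =
  fixes A :: "('s, 'v, 'g) pcpa"
  assumes rcpcpa: "rcpcpa A"
begin

abbreviation n :: nat where "n \<equiv> deg A"

lemma wf: "wf_pcpa A"
  using rcpcpa by (simp add: rcpcpa_def)

lemma wf_simps:
  "1 \<le> n" "finite (inp A)" "finite (stk A)" "queries A \<subseteq> {1..n}" "inj_on (qsym A) {1..n}"
  "qsym A ` {1..n} \<subseteq> stk A"
  using wf by (simp_all add: wf_pcpa_def)

lemma wf_comp:
  assumes "i \<in> {1..n}"
  shows "finite (states (comp A i))" "init (comp A i) \<in> states (comp A i)" "bottom (comp A i) \<in> stk A"
    "finals (comp A i) \<subseteq> states (comp A i)" "finite (trans (comp A i) q a B)"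
  using wf assms by (simp_all add: wf_pcpa_def)

definition al :: "'g list" where
  "al = (SOME l. set l = stk A)"

lemma set_al: "set al = stk A"
  unfolding al_def by (rule someI_ex[OF finite_list[OF wf_simps(3)]])

text \<open>The part of a transition that touches the stack. State and input symbol are left out
  because the program does not hold them. The index of such a rule in \<open>toks\<close> becomes a
  token of the new system.\<close>

definition rules :: "('g \<times> 'g list) set" where
  "rules = {(B, \<beta>). \<exists>i\<in>{1..n}. \<exists>q a p. (p, \<beta>) \<in> trans (comp A i) q a B}"

lemma trans_wf:
  assumes "i \<in> {1..n}" "(p, \<beta>) \<in> trans (comp A i) q a B"
  shows "q \<in> states (comp A i)" "B \<in> stk A" "a \<in> insert None (Some ` inp A)" "p \<in> states (comp A i)"
    "set \<beta> \<subseteq> stk A"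
proof -
  have 1: "trans (comp A i) q a B \<noteq> {} \<longrightarrow>
      q \<in> states (comp A i) \<and> B \<in> stk A \<and> (case a of None \<Rightarrow> True | Some b \<Rightarrow> b \<in> inp A)"
    and 2: "\<forall>(p, \<beta>) \<in> trans (comp A i) q a B. p \<in> states (comp A i) \<and> set \<beta> \<subseteq> stk A"
    using wf assms(1) by (simp_all add: wf_pcpa_def)
  show "q \<in> states (comp A i)" "B \<in> stk A" using 1 assms(2) by fast+
  show "p \<in> states (comp A i)" "set \<beta> \<subseteq> stk A" using 2 assms(2) by fast+
  show "a \<in> insert None (Some ` inp A)" using 1 assms(2) by (cases a) auto
qed

lemma finite_rules: "finite rules"
proof (rule finite_subset)
  show "rules \<subseteq> (\<Union>i\<in>{1..n}. \<Union>q\<in>states (comp A i). \<Union>a\<in>insert None (Some ` inp A). \<Union>B\<in>stk A.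
    (\<lambda>(p, \<beta>). (B, \<beta>)) ` trans (comp A i) q a B)"
  proof clarify
    fix B \<beta> assume "(B, \<beta>) \<in> rules"
    then obtain i q a p where *: "i \<in> {1..n}" "(p, \<beta>) \<in> trans (comp A i) q a B"
      unfolding rules_def by auto
    note t = trans_wf[OF *]
    have "(B, \<beta>) \<in> (\<lambda>(p, \<beta>). (B, \<beta>)) ` trans (comp A i) q a B"
      using *(2) by force
    with *(1) t(1,2,3) show "(B, \<beta>) \<in> (\<Union>i\<in>{1..n}. \<Union>q\<in>states (comp A i). \<Union>a\<in>insert None (Some ` inp A). \<Union>B\<in>stk A.
      (\<lambda>(p, \<beta>). (B, \<beta>)) ` trans (comp A i) q a B)"
      by blast
  qed
  show "finite (\<Union>i\<in>{1..n}. \<Union>q\<in>states (comp A i). \<Union>a\<in>insert None (Some ` inp A). \<Union>B\<in>stk A.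
    (\<lambda>(p, \<beta>). (B, \<beta>)) ` trans (comp A i) q a B)"
    using wf_comp(1,5) wf_simps(2,3) by (intro finite_UN_I) auto
qed

definition toks :: "('g \<times> 'g list) list" where
  "toks = (SOME l. set l = rules)"

lemma set_toks: "set toks = rules"
  unfolding toks_def by (rule someI_ex[OF finite_list[OF finite_rules]])

text \<open>Complements \<open>rules\<close>: \<open>t\<close> fixes the stack part of the
  transition, which is left to the program, and only state and input move here.\<close>

definition fire :: "nat \<Rightarrow> nat \<Rightarrow> 's \<times> 'v list \<Rightarrow> 's \<times> 'v list \<Rightarrow> bool" where
  "fire i t u v \<longleftrightarrow> i \<in> {1..n} \<and> t < length toks \<and>
     (\<exists>a. (fst v, snd (toks ! t)) \<in> trans (comp A i) (fst u) a (fst (toks ! t)) \<and> snd u = opt_word a @ snd v)"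

definition W :: "nat \<Rightarrow> nat \<Rightarrow> (nat \<Rightarrow> 's \<times> 'v list) rel" where
  "W i t = {(r, r(i := v)) | r v. fire i t (r i) v}"

text \<open>Transitions may be defined on query symbols, but no ordinary step takes place while one
  is on top; the filter removes these rules. The right-hand side is pushed from its last symbol on,
  hence \<open>rev\<close>.\<close>

definition ord_code :: "nat \<Rightarrow> 'g satom com" where
  "ord_code i = choices (map (\<lambda>t. Seq (Atom (Get i t)) (Seq (Atom (Pop i (fst (toks ! t))))
     (seqs (map (\<lambda>g. Atom (Push i g)) (rev (snd (toks ! t)))))))
     (filter (\<lambda>t. \<not> is_query A (fst (toks ! t))) [0..<length toks]))"

definition ord_local :: "nat \<Rightarrow> 's \<times> 'v list \<times> 'g list \<Rightarrow> 's \<times> 'v list \<times> 'g list \<Rightarrow> bool" where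
  "ord_local i u v \<longleftrightarrow> snd (snd u) \<noteq> [] \<and> \<not> is_query A (hd (snd (snd u))) \<and>
     (\<exists>a \<beta>. (fst v, \<beta>) \<in> trans (comp A i) (fst u) a (hd (snd (snd u))) \<and>
       fst (snd u) = opt_word a @ fst (snd v) \<and> snd (snd v) = \<beta> @ tl (snd (snd u)))"

lemma sem_ord_code:
  assumes "i \<in> {1..n}"
  shows "sem (ssem W) (ord_code i) = {(c, c(i := y)) | c y. ord_local i (c i) y}"
proof -
  have "(c, x) \<in> sem (ssem W) (ord_code i) \<longleftrightarrow> (\<exists>y. x = c(i := y) \<and> ord_local i (c i) y)" for c x
  proof
    assume "(c, x) \<in> sem (ssem W) (ord_code i)"
    then obtain t c1 w where t: "t < length toks" "\<not> is_query A (fst (toks ! t))"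
      "(proj c, proj c1) \<in> W i t" "cstk c1 = cstk c" "cstk c i = fst (toks ! t) # w"
      "x = setstk c1 i (snd (toks ! t) @ w)"
      by (auto simp: ord_code_def sem_Push_word config_eq_iff)
    from t(3) obtain v where v: "fire i t (proj c i) v" "proj c1 = (proj c)(i := v)"
      unfolding W_def by auto
    have "x = c(i := (fst v, snd v, snd (toks ! t) @ w))"
    proof
      fix k
      have "proj c1 k = ((proj c)(i := v)) k" "cstk c1 k = cstk c k" using v t(4) by auto
      then show "x k = (c(i := (fst v, snd v, snd (toks ! t) @ w))) k"
        unfolding t(6) setstk_def proj_def cst_def cin_def cstk_def by (auto simp: prod_eq_iff split: if_splits)
    qed
    moreover have "ord_local i (c i) (fst v, snd v, snd (toks ! t) @ w)"
      using v(1) t(2,5) unfolding ord_local_def fire_def proj_def cst_def cin_def cstk_def by auto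
    ultimately show "\<exists>y. x = c(i := y) \<and> ord_local i (c i) y" by blast
  next
    assume "\<exists>y. x = c(i := y) \<and> ord_local i (c i) y"
    then obtain y a \<beta> B w where y: "x = c(i := y)" "cstk c i = B # w" "\<not> is_query A B"
      "(fst y, \<beta>) \<in> trans (comp A i) (cst c i) a B" "cin c i = opt_word a @ fst (snd y)" "snd (snd y) = \<beta> @ w"
      unfolding ord_local_def cst_def cin_def cstk_def by (auto simp: neq_Nil_conv)
    have "(B, \<beta>) \<in> set toks" unfolding set_toks rules_def
      by (simp del: One_nat_def) (rule bexI[of _ i], use y(4) assms in blast, rule assms)
    then obtain t where t: "t < length toks" "toks ! t = (B, \<beta>)" by (metis in_set_conv_nth)
    let ?c1 = "c(i := (fst y, fst (snd y), cstk c i))"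
    have "cstk ?c1 = cstk c" "proj ?c1 = (proj c)(i := (fst y, fst (snd y)))"
      by (auto simp: proj_def cst_def cin_def cstk_def)
    then have "(c, ?c1) \<in> ssem W (Get i t)"
      using y t assms unfolding W_def fire_def by (auto simp: proj_def intro!: exI[of _ "(fst y, fst (snd y))"])
    moreover have "(?c1, setstk ?c1 i w) \<in> ssem W (Pop i B)"
      using y(2) by (auto simp: cstk_def)
    moreover have "(setstk ?c1 i w, x) \<in> sem (ssem W) (seqs (map (\<lambda>g. Atom (Push i g)) (rev \<beta>)))"
    proof -
      have "x = setstk (setstk ?c1 i w) i (\<beta> @ w)"
        using y by (auto simp: setstk_def cst_def cin_def prod_eq_iff fun_eq_iff)
      then show ?thesis unfolding sem_Push_word by auto
    qed
    ultimately have "(c, x) \<in> sem (ssem W) (Seq (Atom (Get i t)) (Seq (Atom (Pop i B))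
        (seqs (map (\<lambda>g. Atom (Push i g)) (rev \<beta>)))))"
      unfolding sem.simps fst_conv snd_conv by (intro relcompI)
    then show "(c, x) \<in> sem (ssem W) (ord_code i)"
      unfolding ord_code_def sem_choices using t y(3) by (auto simp del: sem.simps intro!: bexI[of _ t])
  qed
  then show ?thesis
    by (intro set_eqI, case_tac x) blast
qed

lemma sem_ord: "sem (ssem W) (seqs (map ord_code [1..<Suc n])) = {(c, c'). ord_step A c c'}"
proof -
  have s: "set [1..<Suc n] = {1..n}" by auto
  have "sem (ssem W) (seqs (map ord_code [1..<Suc n])) =
    {(c, c'). (\<forall>i\<in>{1..n}. ord_local i (c i) (c' i)) \<and> (\<forall>i. i \<notin> {1..n} \<longrightarrow> c' i = c i)}"
    unfolding s[symmetric]
  proof (rule sem_seqs_local)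
    show "sem (ssem W) (ord_code i) = {(c, c(i := y)) | c y. ord_local i (c i) y}" if "i \<in> set [1..<Suc n]" for i
      by (rule sem_ord_code) (use that in auto)
  qed simp
  also have "\<dots> = {(c, c'). ord_step A c c'}"
    unfolding ord_step_def ord_local_def cst_def cin_def cstk_def
    by (auto simp del: One_nat_def)
  finally show ?thesis .
qed

section \<open>The communication step as a program\<close>

definition queriers :: "(nat \<Rightarrow> 'g) \<Rightarrow> nat \<Rightarrow> nat list" where
  "queriers f j = (if j \<in> queries A \<and> \<not> is_query A (f j) then filter (\<lambda>i. f i = qsym A j) [1..<Suc n] else [])"

text \<open>The detour through scratch stack 0 restores the order of the symbols, and the second
  pouring serves all queriers of \<open>j\<close> at once.\<close>

definition deliver :: "(nat \<Rightarrow> 'g) \<Rightarrow> nat \<Rightarrow> 'g satom com" where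
  "deliver f j = Seq (seqs (map (\<lambda>i. Atom (Pop i (f i))) (queriers f j)))
     (Seq (pour al j [0]) (Seq (pour al 0 (queriers f j)) (Atom (Push j (bottom (comp A j))))))"

text \<open>A querier has a query symbol on top and therefore answers nobody. The last two facts
  separate senders from receivers, which makes the deliveries of one communication step
  independent.\<close>

lemma queriersD:
  assumes "i \<in> set (queriers f j)"
  shows "i \<in> {1..n}" "j \<in> {1..n}" "j \<in> queries A" "f i = qsym A j" "is_query A (f i)" "\<not> is_query A (f j)" "i \<noteq> j"
    "queriers f i = []"
  using assms wf_simps(4) unfolding queriers_def by (auto simp: is_query_def split: if_splits)

lemma distinct_queriers: "distinct (queriers f j)"
  by (simp add: queriers_def)

lemma sem_deliver:
  assumes "j \<in> {1..n}" "cstk c 0 = []" "set (cstk c j) \<subseteq> stk A"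
  shows "(c, x) \<in> sem (ssem W) (deliver f j) \<longleftrightarrow>
    (\<forall>i\<in>set (queriers f j). cstk c i \<noteq> [] \<and> hd (cstk c i) = f i) \<and>
    x = with_stks c (\<lambda>i. if i = j then [bottom (comp A j)] else
      if i \<in> set (queriers f j) then cstk c j @ tl (cstk c i) else cstk c i)"
    (is "_ \<longleftrightarrow> ?T \<and> x = ?x")
proof -
  let ?Q = "queriers f j"
  let ?c1 = "with_stks c (\<lambda>i. if i \<in> set ?Q then tl (cstk c i) else cstk c i)"
  let ?c2 = "with_stks c (\<lambda>i. if i = j then [] else if i = 0 then rev (cstk c j) else
    if i \<in> set ?Q then tl (cstk c i) else cstk c i)"
  let ?c3 = "with_stks c (\<lambda>i. if i = j then [] else
    if i \<in> set ?Q then cstk c j @ tl (cstk c i) else cstk c i)"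
  have j: "j \<notin> set ?Q" "0 \<notin> set ?Q" "j \<noteq> 0"
    using queriersD(7)[of j f j] queriersD(1)[of 0 f j] assms(1) by auto
  have 1: "(c, y) \<in> sem (ssem W) (seqs (map (\<lambda>i. Atom (Pop i (f i))) ?Q)) \<longleftrightarrow> ?T \<and> y = ?c1" for y
    by (subst sem_Pop_all[OF distinct_queriers]) auto
  have 2: "(?c1, y) \<in> sem (ssem W) (pour al j [0]) \<longleftrightarrow> y = ?c2" for y
  proof -
    have "(?c1, y) \<in> sem (ssem W) (pour al j [0]) \<longleftrightarrow> y = with_stks ?c1
      (\<lambda>i. if i = j then [] else if i \<in> set [0] then rev (cstk ?c1 j) @ cstk ?c1 i else cstk ?c1 i)"
      by (rule sem_pour) (use j assms(3) set_al in auto)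
    also have "with_stks ?c1
      (\<lambda>i. if i = j then [] else if i \<in> set [0] then rev (cstk ?c1 j) @ cstk ?c1 i else cstk ?c1 i) = ?c2"
      using j assms(2) by (auto simp: config_eq_iff fun_eq_iff)
    finally show ?thesis .
  qed
  have 3: "(?c2, y) \<in> sem (ssem W) (pour al 0 ?Q) \<longleftrightarrow> y = ?c3" for y
  proof -
    have "(?c2, y) \<in> sem (ssem W) (pour al 0 ?Q) \<longleftrightarrow> y = with_stks ?c2
      (\<lambda>i. if i = 0 then [] else if i \<in> set ?Q then rev (cstk ?c2 0) @ cstk ?c2 i else cstk ?c2 i)"
      by (rule sem_pour) (use j assms(3) set_al distinct_queriers in auto)
    also have "with_stks ?c2
      (\<lambda>i. if i = 0 then [] else if i \<in> set ?Q then rev (cstk ?c2 0) @ cstk ?c2 i else cstk ?c2 i) = ?c3"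
      using j assms(2) by (auto simp: config_eq_iff fun_eq_iff)
    finally show ?thesis .
  qed
  have 4: "(?c3, y) \<in> ssem W (Push j (bottom (comp A j))) \<longleftrightarrow> y = ?x" for y
  proof -
    have "setstk ?c3 j (bottom (comp A j) # cstk ?c3 j) = ?x"
      by (auto simp: config_eq_iff)
    then show ?thesis by auto
  qed
  show ?thesis
    unfolding deliver_def sem.simps relcomp_unfold by (simp add: 1 2 3 4 del: ssem.simps)
qed

definition source :: "(nat \<Rightarrow> 'g) \<Rightarrow> nat \<Rightarrow> nat" where
  "source f i = inv_into {1..n} (qsym A) (f i)"

lemma source_eq: "i \<in> set (queriers f j) \<Longrightarrow> source f i = j"
  unfolding source_def using queriersD[of i f j] wf_simps(5) by (metis inv_into_f_f)

text \<open>No delivery alters the stack of another sender, and a querier has a single source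
  because \<open>qsym\<close> is injective. Hence the deliveries use the stacks of the original
  configuration although they run one after the other.\<close>

lemma sem_delivers:
  assumes "distinct js" "\<forall>j\<in>set js. queriers f j \<noteq> []" "cstk c 0 = []"
    "\<forall>j\<in>set js. set (cstk c j) \<subseteq> stk A"
    "\<forall>j\<in>set js. \<forall>i\<in>set (queriers f j). cstk c i \<noteq> [] \<and> hd (cstk c i) = f i"
  shows "(c, x) \<in> sem (ssem W) (seqs (map (deliver f) js)) \<longleftrightarrow>
    x = with_stks c (\<lambda>i. if i \<in> set js then [bottom (comp A i)] else
      if \<exists>j\<in>set js. i \<in> set (queriers f j) then cstk c (source f i) @ tl (cstk c i) else cstk c i)"
  using assms
proof (induction js arbitrary: c)
  case Nil
  then show ?case by (auto simp: config_eq_iff)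
next
  case (Cons j js)
  let ?c1 = "with_stks c (\<lambda>i. if i = j then [bottom (comp A j)] else
      if i \<in> set (queriers f j) then cstk c j @ tl (cstk c i) else cstk c i)"
  obtain i0 where "i0 \<in> set (queriers f j)" using Cons.prems(2) by (cases "queriers f j") auto
  from queriersD(2)[OF this] have j: "j \<in> {1..n}" "j \<noteq> 0" by auto
  have other: "i \<noteq> j" "i \<notin> set (queriers f j)" if "i \<in> set js" for i
    using that Cons.prems(1,2) queriersD(8)[of i f j] by auto
  have disj: "i \<notin> set (queriers f j) \<and> i \<noteq> j" if "i \<in> set (queriers f j')" "j' \<in> set js" for i j'
    using source_eq[of i f j] source_eq[of i f j'] queriersD(8)[of i f j'] that Cons.prems(1,2) by auto
  have 0: "0 \<notin> set (queriers f j)" using queriersD(1)[of 0 f j] by auto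
  have "(c, x) \<in> sem (ssem W) (seqs (map (deliver f) (j # js))) \<longleftrightarrow>
     (?c1, x) \<in> sem (ssem W) (seqs (map (deliver f) js))"
  proof -
    have "(c, y) \<in> sem (ssem W) (deliver f j) \<longleftrightarrow> y = ?c1" for y
      using Cons.prems j by (subst sem_deliver) auto
    then show ?thesis by (auto simp: relcomp_unfold)
  qed
  also have "\<dots> \<longleftrightarrow> x = with_stks ?c1 (\<lambda>i. if i \<in> set js then [bottom (comp A i)] else
      if \<exists>j\<in>set js. i \<in> set (queriers f j) then cstk ?c1 (source f i) @ tl (cstk ?c1 i) else cstk ?c1 i)"
  proof (rule Cons.IH)
    show "distinct js" "\<forall>j\<in>set js. queriers f j \<noteq> []" using Cons.prems by auto
    show "cstk ?c1 0 = []" using Cons.prems j 0 by auto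
    show "\<forall>j\<in>set js. set (cstk ?c1 j) \<subseteq> stk A" using Cons.prems other by auto
    show "\<forall>j\<in>set js. \<forall>i\<in>set (queriers f j). cstk ?c1 i \<noteq> [] \<and> hd (cstk ?c1 i) = f i"
      using Cons.prems disj by auto
  qed
  also have "with_stks ?c1 (\<lambda>i. if i \<in> set js then [bottom (comp A i)] else
      if \<exists>j\<in>set js. i \<in> set (queriers f j) then cstk ?c1 (source f i) @ tl (cstk ?c1 i) else cstk ?c1 i) =
    with_stks c (\<lambda>i. if i \<in> set (j # js) then [bottom (comp A i)] else
      if \<exists>j\<in>set (j # js). i \<in> set (queriers f j) then cstk c (source f i) @ tl (cstk c i) else cstk c i)"
  proof -
    have "(if i \<in> set js then [bottom (comp A i)] else
      if \<exists>j\<in>set js. i \<in> set (queriers f j) then cstk ?c1 (source f i) @ tl (cstk ?c1 i) else cstk ?c1 i) =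
      (if i \<in> set (j # js) then [bottom (comp A i)] else
      if \<exists>j\<in>set (j # js). i \<in> set (queriers f j) then cstk c (source f i) @ tl (cstk c i) else cstk c i)" for i
    proof -
      consider "i \<in> set js" | "i \<notin> set js" "\<exists>j\<in>set js. i \<in> set (queriers f j)" | "i \<notin> set js" "\<not> (\<exists>j\<in>set js. i \<in> set (queriers f j))"
        by blast
      then show ?thesis
      proof cases
        case 2
        then obtain j' where j': "j' \<in> set js" "i \<in> set (queriers f j')" by auto
        then have "source f i = j'" by (simp add: source_eq)
        with 2 j' disj[OF j'(2,1)] other[OF j'(1)] show ?thesis by auto
      next
        case 3
        then show ?thesis using source_eq[of i f j] queriersD(7)[of i f j] by auto
      qed auto
    qed
    then show ?thesis by simp
  qed
  finally show ?case .
qed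

definition com_result :: "(nat \<Rightarrow> 'g) \<Rightarrow> ('s, 'v, 'g) config \<Rightarrow> ('s, 'v, 'g) config" where
  "com_result f c = with_stks c (\<lambda>i. if queriers f i \<noteq> [] then [bottom (comp A i)] else
      if \<exists>j. i \<in> set (queriers f j) then cstk c (source f i) @ tl (cstk c i) else cstk c i)"

text \<open>\<open>f\<close> is a guess of all top symbols. It is verified before any stack changes,
  because the deliveries destroy the tops that decide about them.\<close>

definition com_code :: "(nat \<Rightarrow> 'g) \<Rightarrow> 'g satom com" where
  "com_code f = Seq (seqs (map (\<lambda>i. Seq (Atom (Pop i (f i))) (Atom (Push i (f i)))) [1..<Suc n]))
     (seqs (map (deliver f) (filter (\<lambda>j. queriers f j \<noteq> []) [1..<Suc n])))"

definition good :: "('s, 'v, 'g) config \<Rightarrow> bool" where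
  "good c \<longleftrightarrow> cstk c 0 = [] \<and> (\<forall>i\<in>{1..n}. set (cstk c i) \<subseteq> stk A)"

lemma queriers_nonempty: "queriers f j \<noteq> [] \<Longrightarrow> j \<in> {1..n}"
  using queriersD(2)[of "hd (queriers f j)" f j] by simp

lemma sem_com_code:
  assumes "good c"
  shows "(c, x) \<in> sem (ssem W) (com_code f) \<longleftrightarrow>
    (\<forall>i\<in>{1..n}. cstk c i \<noteq> [] \<and> hd (cstk c i) = f i) \<and> x = com_result f c"
proof -
  let ?js = "filter (\<lambda>j. queriers f j \<noteq> []) [1..<Suc n]"
  have s: "set [1..<Suc n] = {1..n}" by auto
  have js: "j \<in> set ?js \<longleftrightarrow> queriers f j \<noteq> []" for j
    using queriers_nonempty[of f j] by auto
  have "(c, x) \<in> sem (ssem W) (com_code f) \<longleftrightarrow>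
    (\<forall>i\<in>{1..n}. cstk c i \<noteq> [] \<and> hd (cstk c i) = f i) \<and> (c, x) \<in> sem (ssem W) (seqs (map (deliver f) ?js))"
    unfolding com_code_def sem.simps(4) sem_test_tops[OF distinct_upt] s relcomp_unfold by auto
  also have "\<dots> \<longleftrightarrow> (\<forall>i\<in>{1..n}. cstk c i \<noteq> [] \<and> hd (cstk c i) = f i) \<and> x = com_result f c"
  proof (rule conj_cong[OF refl])
    assume t: "\<forall>i\<in>{1..n}. cstk c i \<noteq> [] \<and> hd (cstk c i) = f i"
    have "(c, x) \<in> sem (ssem W) (seqs (map (deliver f) ?js)) \<longleftrightarrow>
     x = with_stks c (\<lambda>i. if i \<in> set ?js then [bottom (comp A i)] else
      if \<exists>j\<in>set ?js. i \<in> set (queriers f j) then cstk c (source f i) @ tl (cstk c i) else cstk c i)"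
    proof (rule sem_delivers)
      show "distinct ?js" by simp
      show "\<forall>j\<in>set ?js. queriers f j \<noteq> []" by simp
      show "cstk c 0 = []" "\<forall>j\<in>set ?js. set (cstk c j) \<subseteq> stk A" using assms unfolding good_def by auto
      show "\<forall>j\<in>set ?js. \<forall>i\<in>set (queriers f j). cstk c i \<noteq> [] \<and> hd (cstk c i) = f i"
        using t queriersD(1) by blast
    qed
    also have "with_stks c (\<lambda>i. if i \<in> set ?js then [bottom (comp A i)] else
      if \<exists>j\<in>set ?js. i \<in> set (queriers f j) then cstk c (source f i) @ tl (cstk c i) else cstk c i) = com_result f c"
    proof -
      have *: "(\<exists>j\<in>set ?js. i \<in> set (queriers f j)) \<longleftrightarrow> (\<exists>j. i \<in> set (queriers f j))" for i
        using js by fastforce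
      show ?thesis unfolding com_result_def js * by (rule refl)
    qed
    finally show "(c, x) \<in> sem (ssem W) (seqs (map (deliver f) ?js)) \<longleftrightarrow> x = com_result f c" .
  qed
  finally show ?thesis .
qed

text \<open>Senders and receivers are disjoint and every receiver has one source, so the clauses of
  \<open>com_step\<close> never conflict and the successor is a function of the
  configuration.\<close>

lemma com_step_iff:
  assumes t: "\<forall>i\<in>{1..n}. cstk c i \<noteq> [] \<and> hd (cstk c i) = f i"
  shows "com_step A c x \<longleftrightarrow> (\<exists>i\<in>{1..n}. is_query A (f i)) \<and> x = com_result f c"
proof -
  have answers: "answers A c i j \<longleftrightarrow> i \<in> set (queriers f j)" for i j
  proof
    assume a: "answers A c i j"
    then have "i \<in> {1..n}" "j \<in> {1..n}" by (auto simp: answers_def)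
    with a t show "i \<in> set (queriers f j)" by (auto simp: answers_def queriers_def simp del: upt_Suc)
  next
    assume q: "i \<in> set (queriers f j)"
    note d = queriersD[OF q]
    with t show "answers A c i j" unfolding answers_def by auto
  qed
  have sends: "sends A c j \<longleftrightarrow> queriers f j \<noteq> []" for j
    unfolding sends_def answers by (cases "queriers f j") auto
  have out: "cstk (com_result f c) i = cstk c i" if "i \<notin> {1..n}" for i
    using that queriers_nonempty[of f i] queriersD(1)[of i f] unfolding com_result_def by auto
  have q: "queriers f i = []" if "i \<in> set (queriers f j)" for i j
    using queriersD(8)[OF that] .
  have same: "c i = d i \<longleftrightarrow> cst c i = cst d i \<and> cin c i = cin d i \<and> cstk c i = cstk d i" for c d :: "('s, 'v, 'g) config" and i
    by (auto simp: cst_def cin_def cstk_def prod_eq_iff)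
  have r: "cst (com_result f c) = cst c" "cin (com_result f c) = cin c" by (auto simp: com_result_def)
  have loc: "((\<forall>j. i \<in> set (queriers f j) \<longrightarrow> w = cstk c j @ tl (cstk c i)) \<and>
        (queriers f i \<noteq> [] \<longrightarrow> w = [bottom (comp A i)]) \<and>
        ((\<nexists>j. i \<in> set (queriers f j)) \<and> \<not> queriers f i \<noteq> [] \<longrightarrow> w = cstk c i)) \<longleftrightarrow> w = cstk (com_result f c) i" for i w
  proof (cases "\<exists>j. i \<in> set (queriers f j)")
    case True
    then obtain j where j: "i \<in> set (queriers f j)" by auto
    have "i \<in> set (queriers f j') \<longleftrightarrow> j' = j" for j'
      using source_eq[OF j] source_eq[of i f j'] j by auto
    then show ?thesis using q[OF j] source_eq[OF j] by (auto simp: com_result_def)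
  next
    case False
    then show ?thesis by (auto simp: com_result_def)
  qed
  have "com_step A c x \<longleftrightarrow> (\<exists>i\<in>{1..n}. is_query A (f i)) \<and> (\<forall>i. i \<notin> {1..n} \<longrightarrow> x i = c i) \<and>
     (\<forall>i\<in>{1..n}. cst x i = cst c i \<and> cin x i = cin c i \<and> cstk x i = cstk (com_result f c) i)"
    unfolding com_step_def answers sends loc using t by auto
  also have "\<dots> \<longleftrightarrow> (\<exists>i\<in>{1..n}. is_query A (f i)) \<and> (\<forall>i. x i = com_result f c i)"
    unfolding same using out by (auto simp: r)
  finally show ?thesis by (simp add: fun_eq_iff)
qed

text \<open>The guess of the tops ranges over the finitely many \<open>n\<close>-tuples of stack
  symbols; component \<open>i\<close> is the list entry \<open>i - 1\<close>.\<close>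

definition com_codes :: "'g satom com" where
  "com_codes = choices (map (\<lambda>\<tau>. com_code (\<lambda>i. \<tau> ! (i - 1)))
     (filter (\<lambda>\<tau>. \<exists>i\<in>{1..n}. is_query A (\<tau> ! (i - 1))) (List.n_lists n al)))"

lemma sem_com_codes:
  assumes "good c"
  shows "(c, x) \<in> sem (ssem W) com_codes \<longleftrightarrow> com_step A c x"
proof
  assume "(c, x) \<in> sem (ssem W) com_codes"
  then obtain \<tau> where t: "\<exists>i\<in>{1..n}. is_query A (\<tau> ! (i - 1))" "(c, x) \<in> sem (ssem W) (com_code (\<lambda>i. \<tau> ! (i - 1)))"
    unfolding com_codes_def by auto
  from t(2) have "\<forall>i\<in>{1..n}. cstk c i \<noteq> [] \<and> hd (cstk c i) = \<tau> ! (i - 1)" "x = com_result (\<lambda>i. \<tau> ! (i - 1)) c"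
    unfolding sem_com_code[OF assms] by auto
  then show "com_step A c x" using com_step_iff[of c "\<lambda>i. \<tau> ! (i - 1)" x] t(1) by auto
next
  assume st: "com_step A c x"
  define \<tau> where "\<tau> = map (\<lambda>i. hd (cstk c i)) [1..<Suc n]"
  have ne: "\<forall>i\<in>{1..n}. cstk c i \<noteq> []" using st by (auto simp: com_step_def)
  have nth: "\<tau> ! (i - 1) = hd (cstk c i)" if "i \<in> {1..n}" for i
    using that unfolding \<tau>_def by (subst nth_map) (auto simp del: upt_Suc)
  with ne have t: "\<forall>i\<in>{1..n}. cstk c i \<noteq> [] \<and> hd (cstk c i) = \<tau> ! (i - 1)" by auto
  have "hd (cstk c i) \<in> set al" if "i \<in> {1..n}" for i
    using assms that ne hd_in_set[of "cstk c i"] unfolding good_def set_al by blast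
  then have "set \<tau> \<subseteq> set al" by (auto simp: \<tau>_def simp del: upt_Suc)
  then have "\<tau> \<in> set (List.n_lists n al)" by (auto simp: set_n_lists \<tau>_def)
  moreover from st have "\<exists>i\<in>{1..n}. is_query A (\<tau> ! (i - 1))" "x = com_result (\<lambda>i. \<tau> ! (i - 1)) c"
    unfolding com_step_iff[OF t] by auto
  moreover from this t have "(c, x) \<in> sem (ssem W) (com_code (\<lambda>i. \<tau> ! (i - 1)))"
    unfolding sem_com_code[OF assms] by auto
  ultimately show "(c, x) \<in> sem (ssem W) com_codes"
    unfolding com_codes_def by auto
qed

section \<open>Runs of the given system as one program\<close>

lemma good_step:
  assumes "good c" "step A c x"
  shows "good x"
  using assms(2) unfolding step_def
proof
  assume o: "ord_step A c x"
  have "set (cstk x i) \<subseteq> stk A" if i: "i \<in> {1..n}" for i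
  proof -
    from o i obtain a p \<beta> where "(p, \<beta>) \<in> trans (comp A i) (cst c i) a (hd (cstk c i))"
      "cstk x i = \<beta> @ tl (cstk c i)" "cstk c i \<noteq> []"
      unfolding ord_step_def by blast
    moreover from this have "set (tl (cstk c i)) \<subseteq> stk A"
    proof -
      have "set (cstk c i) \<subseteq> stk A" using assms(1) i unfolding good_def by blast
      then show ?thesis by (cases "cstk c i") auto
    qed
    ultimately show ?thesis
      using trans_wf(5)[OF i] by auto
  qed
  moreover have "cstk x 0 = []"
    using o assms(1) unfolding ord_step_def good_def cstk_def by auto
  ultimately show "good x" by (simp add: good_def)
next
  assume o: "com_step A c x"
  then have "\<forall>i\<in>{1..n}. cstk c i \<noteq> [] \<and> hd (cstk c i) = hd (cstk c i)" by (auto simp: com_step_def)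
  from com_step_iff[OF this] o have x: "x = com_result (\<lambda>i. hd (cstk c i)) c" by blast
  have "set (cstk x i) \<subseteq> stk A" if i: "i \<in> {1..n}" for i
  proof -
    have tl: "set (tl (cstk c i)) \<subseteq> stk A"
    proof -
      have "set (cstk c i) \<subseteq> stk A" using assms(1) i unfolding good_def by blast
      then show ?thesis by (cases "cstk c i") auto
    qed
    have "set (cstk c (source (\<lambda>i. hd (cstk c i)) i)) \<subseteq> stk A" if "i \<in> set (queriers (\<lambda>i. hd (cstk c i)) j)" for j
      using source_eq[OF that] queriersD(2)[OF that] assms(1) unfolding good_def by auto
    then show ?thesis using tl assms(1) i wf_comp(3)[OF i] unfolding x com_result_def good_def by auto
  qed
  moreover have "cstk x 0 = []"
    using assms(1) queriers_nonempty[of _ 0] queriersD(1)[of 0] unfolding x com_result_def good_def by auto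
  ultimately show "good x" by (simp add: good_def)
qed

definition body :: "'g satom com" where
  "body = Choice (seqs (map ord_code [1..<Suc n])) com_codes"

lemma sem_body: "good c \<Longrightarrow> (c, x) \<in> sem (ssem W) body \<longleftrightarrow> step A c x"
  unfolding body_def step_def sem.simps sem_ord using sem_com_codes by auto

lemma sem_Star_body:
  assumes "good c"
  shows "(c, x) \<in> sem (ssem W) (Star body) \<longleftrightarrow> (step A)\<^sup>*\<^sup>* c x"
proof
  assume "(c, x) \<in> sem (ssem W) (Star body)"
  then have "(c, x) \<in> (sem (ssem W) body)\<^sup>*" by simp
  then have "(step A)\<^sup>*\<^sup>* c x \<and> good x"
  proof (induction rule: rtrancl_induct)
    case (step y z)
    then show ?case using sem_body[of y z] good_step[of y z] by (meson rtranclp.rtrancl_into_rtrancl)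
  qed (simp add: assms)
  then show "(step A)\<^sup>*\<^sup>* c x" ..
next
  assume "(step A)\<^sup>*\<^sup>* c x"
  then have "(c, x) \<in> (sem (ssem W) body)\<^sup>* \<and> good x"
  proof (induction rule: rtranclp_induct)
    case (step y z)
    then show ?case using sem_body[of y z] good_step[of y z] by (meson rtrancl.rtrancl_into_rtrancl)
  qed (simp add: assms)
  then show "(c, x) \<in> sem (ssem W) (Star body)" by simp
qed

text \<open>\<open>init_cfg\<close> puts a symbol on the stack of every index, in particular of 0,
  while the program needs stack 0 empty. Steps depend only on the components from 1 to
  \<open>n\<close>, so the two kinds of initial configuration can be exchanged.\<close>

definition agree :: "('s, 'v, 'g) config \<Rightarrow> ('s, 'v, 'g) config \<Rightarrow> bool" where
  "agree c d \<longleftrightarrow> (\<forall>i\<in>{1..n}. c i = d i)"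

lemma agree_step:
  assumes "agree c d" "step A c c'"
  shows "\<exists>d'. step A d d' \<and> agree c' d'"
proof -
  define d' where "d' i = (if i \<in> {1..n} then c' i else d i)" for i
  have eq: "cst d i = cst c i" "cin d i = cin c i" "cstk d i = cstk c i"
    "cst d' i = cst c' i" "cin d' i = cin c' i" "cstk d' i = cstk c' i" if "i \<in> {1..n}" for i
    using assms(1) that by (auto simp: agree_def d'_def cst_def cin_def cstk_def)
  have out: "d' i = d i" if "i \<notin> {1..n}" for i
    using that by (auto simp: d'_def)
  have answers: "answers A d i j \<longleftrightarrow> answers A c i j" for i j
    unfolding answers_def using eq by auto
  then have sends: "sends A d j \<longleftrightarrow> sends A c j" for j by (simp add: sends_def)
  have J: "cstk d j = cstk c j" if "answers A c i j" for i j
    using that eq by (auto simp: answers_def)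
  have "ord_step A d d'" if "ord_step A c c'"
    using that unfolding ord_step_def by (simp add: eq out del: One_nat_def)
  moreover have "com_step A d d'" if "com_step A c c'"
    using that unfolding com_step_def answers sends by (simp add: eq J out del: One_nat_def)
  ultimately have "step A d d'" using assms(2) by (auto simp: step_def)
  moreover have "agree c' d'" by (simp add: agree_def d'_def)
  ultimately show ?thesis by blast
qed

lemma agree_steps:
  assumes "(step A)\<^sup>*\<^sup>* c c'" "agree c d"
  shows "\<exists>d'. (step A)\<^sup>*\<^sup>* d d' \<and> agree c' d'"
  using assms
proof (induction rule: rtranclp_induct)
  case (step y z)
  then show ?case using agree_step by (meson rtranclp.rtrancl_into_rtrancl)
qed auto

definition accepting :: "(nat \<Rightarrow> 's \<times> 'v list) \<Rightarrow> bool" where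
  "accepting r \<longleftrightarrow> (\<forall>i\<in>{1..n}. snd (r i) = [] \<and> fst (r i) \<in> finals (comp A i))"

text \<open>The program pushes the initial symbols itself, so that every run starts with empty
  stacks, that is, with the number 1.\<close>

definition prog :: "'g satom com" where
  "prog = Seq (seqs (map (\<lambda>i. Atom (Push i (bottom (comp A i)))) [1..<Suc n])) (Star body)"

definition blank :: "'v list \<Rightarrow> ('s, 'v, 'g) config" where
  "blank x = with_stks (init_cfg A x) (\<lambda>_. [])"

definition start :: "'v list \<Rightarrow> ('s, 'v, 'g) config" where
  "start x = with_stks (init_cfg A x) (\<lambda>i. if i \<in> {1..n} then [bottom (comp A i)] else [])"

lemma good_start: "good (start x)"
  unfolding good_def start_def using wf_comp(3) by auto

lemma sem_prog: "(blank x, c) \<in> sem (ssem W) prog \<longleftrightarrow> (step A)\<^sup>*\<^sup>* (start x) c"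
proof -
  have s: "set [1..<Suc n] = {1..n}" by auto
  have "sem (ssem W) (seqs (map (\<lambda>i. Atom (Push i (bottom (comp A i)))) [1..<Suc n])) =
    {(c, c'). (\<forall>i\<in>set [1..<Suc n]. c' i = (fst (c i), fst (snd (c i)), bottom (comp A i) # snd (snd (c i)))) \<and>
      (\<forall>i. i \<notin> set [1..<Suc n] \<longrightarrow> c' i = c i)}"
    by (intro sem_seqs_local) (auto simp: setstk_eq_upd cstk_def)
  then have init: "(blank x, c) \<in> sem (ssem W) (seqs (map (\<lambda>i. Atom (Push i (bottom (comp A i)))) [1..<Suc n]))
      \<longleftrightarrow> c = start x" for c
    unfolding s by (auto simp: blank_def start_def with_stks_def fun_eq_iff cst_def cin_def simp del: upt_Suc)
  have "(blank x, c) \<in> sem (ssem W) prog \<longleftrightarrow> (start x, c) \<in> sem (ssem W) (Star body)"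
    unfolding prog_def sem.simps(4) relcomp_unfold
    by (simp only: mem_Collect_eq case_prod_conv init simp_thms)
  then show ?thesis using sem_Star_body[OF good_start] by simp
qed

lemma accepting_prog:
  "(\<exists>c. (blank x, c) \<in> sem (ssem W) prog \<and> accepting (proj c)) \<longleftrightarrow>
   (\<exists>c. (step A)\<^sup>*\<^sup>* (init_cfg A x) c \<and> (\<forall>i\<in>{1..n}. cin c i = [] \<and> cst c i \<in> finals (comp A i)))"
proof -
  have a: "agree (start x) (init_cfg A x)" "agree (init_cfg A x) (start x)"
    by (auto simp: agree_def start_def init_cfg_def with_stks_def cst_def cin_def)
  have acc: "accepting (proj c) \<longleftrightarrow> (\<forall>i\<in>{1..n}. cin c i = [] \<and> cst c i \<in> finals (comp A i))" for c
    by (simp add: accepting_def proj_def)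
  have acc': "accepting (proj d)" if "agree c d" "accepting (proj c)" for c d
    using that by (auto simp: accepting_def agree_def proj_def cst_def cin_def)
  show ?thesis
    unfolding sem_prog acc[symmetric] using agree_steps[OF _ a(1)] agree_steps[OF _ a(2)] acc' by blast
qed

section \<open>Compilation to a single number\<close>

primrec satom_ok :: "'g satom \<Rightarrow> bool" where
  "satom_ok (Push i g) \<longleftrightarrow> i \<le> n \<and> g \<in> stk A"
| "satom_ok (Pop i g) \<longleftrightarrow> i \<le> n \<and> g \<in> stk A"
| "satom_ok (Empty i) \<longleftrightarrow> i \<le> n"
| "satom_ok (Get i t) \<longleftrightarrow> i \<in> {1..n} \<and> t < length toks"

primrec natom_ok :: "natom \<Rightarrow> bool" where
  "natom_ok (Frac v u) \<longleftrightarrow> 0 < v \<and> 0 < u"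
| "natom_ok (NDiv v) \<longleftrightarrow> 0 < v"
| "natom_ok (Recv i t) \<longleftrightarrow> i \<in> {1..n} \<and> t < length toks"

lemma ord_code_ok:
  assumes "i \<in> {1..n}" "a \<in> set_com (ord_code i)"
  shows "satom_ok a"
proof -
  from assms(2) obtain t where t: "t < length toks"
    "a = Get i t \<or> a = Pop i (fst (toks ! t)) \<or> (\<exists>g\<in>set (snd (toks ! t)). a = Push i g)"
    unfolding ord_code_def by auto
  from t(1) have "toks ! t \<in> rules" using set_toks nth_mem by blast
  then obtain k q a p where "k \<in> {1..n}" "(p, snd (toks ! t)) \<in> trans (comp A k) q a (fst (toks ! t))"
    unfolding rules_def by (auto simp: case_prod_beta simp del: atLeastAtMost_iff)
  from trans_wf(2,5)[OF this] have "fst (toks ! t) \<in> stk A" "set (snd (toks ! t)) \<subseteq> stk A" by auto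
  with t assms(1) show ?thesis by auto
qed

lemma pour_ok:
  assumes "a \<in> set_com (pour al s Q)" "s \<le> n" "set Q \<subseteq> {0..n}"
  shows "satom_ok a"
  using assms unfolding pour_def by (auto simp: set_al)

lemma com_code_ok:
  assumes "a \<in> set_com (com_code f)" "\<forall>i\<in>{1..n}. f i \<in> stk A"
  shows "satom_ok a"
proof -
  have s: "set [1..<Suc n] = {1..n}" by auto
  from assms(1) consider i where "i \<in> {1..n}" "a = Pop i (f i) \<or> a = Push i (f i)" |
    j where "j \<in> {1..n}" "a \<in> set_com (deliver f j)"
    unfolding com_code_def com.set set_com_seqs set_map set_filter s by auto
  then show ?thesis
  proof cases
    case (1 i)
    then show ?thesis using assms(2) by auto
  next
    case (2 j)
    have Q: "set (queriers f j) \<subseteq> {1..n}" using queriersD(1) by blast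
    from 2(2) consider i where "i \<in> set (queriers f j)" "a = Pop i (f i)" | "a \<in> set_com (pour al j [0])" |
      "a \<in> set_com (pour al 0 (queriers f j))" | "a = Push j (bottom (comp A j))"
      unfolding deliver_def com.set set_com_seqs set_map by auto
    then show ?thesis
    proof cases
      case 1
      then show ?thesis using Q assms(2) by auto
    next
      case 2
      show ?thesis by (rule pour_ok[OF 2]) (use \<open>j \<in> {1..n}\<close> in auto)
    next
      case 3
      show ?thesis by (rule pour_ok[OF 3]) (use Q in auto)
    next
      case 4
      then show ?thesis using \<open>j \<in> {1..n}\<close> wf_comp(3)[of j] by auto
    qed
  qed
qed

lemma prog_ok:
  assumes "a \<in> set_com prog"
  shows "satom_ok a"
proof -
  have s: "set [1..<Suc n] = {1..n}" by auto
  from assms consider i where "i \<in> {1..n}" "a = Push i (bottom (comp A i))" |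
    i where "i \<in> {1..n}" "a \<in> set_com (ord_code i)" | "a \<in> set_com com_codes"
    unfolding prog_def body_def com.set set_com_seqs set_map s by auto
  then show ?thesis
  proof cases
    case (1 i)
    then show ?thesis using wf_comp(3)[of i] by auto
  next
    case (2 i)
    then show ?thesis by (rule ord_code_ok)
  next
    case 3
    then obtain \<tau> where t: "\<tau> \<in> set (List.n_lists n al)" "a \<in> set_com (com_code (\<lambda>i. \<tau> ! (i - 1)))"
      unfolding com_codes_def by auto
    from t(1) have l: "length \<tau> = n" "set \<tau> \<subseteq> stk A" by (auto simp: set_n_lists set_al)
    have "\<tau> ! (i - 1) \<in> stk A" if "i \<in> {1..n}" for i
    proof -
      have "i - 1 < length \<tau>" using that l(1) by auto
      then show ?thesis using l(2) nth_mem by blast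
    qed
    then show ?thesis using com_code_ok[OF t(2)] by auto
  qed
qed

text \<open>Two changes of representation are composed, from stacks to counters and from counters to
  a number. Acceptance depends on states and inputs only, which both of them leave as they
  are.\<close>

lemma number_program:
  "\<exists>c. (\<forall>a\<in>set_com c. natom_ok a) \<and>
    (\<forall>x. (\<exists>N r. ((1, proj (init_cfg A x)), (N, r)) \<in> sem (nsem W) c \<and> accepting r) \<longleftrightarrow>
      (\<exists>c. (step A)\<^sup>*\<^sup>* (init_cfg A x) c \<and> (\<forall>i\<in>{1..n}. cin c i = [] \<and> cst c i \<in> finals (comp A i))))"
proof -
  obtain d0 :: "'g \<Rightarrow> nat" and k where d0: "d0 ` stk A = {i. i < k}" "inj_on d0 (stk A)"
    using finite_imp_inj_to_nat_seg[OF wf_simps(3)] by blast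
  define d where "d g = Suc (d0 g)" for g
  interpret stack_coding d "Suc (Suc k)" "stk A" n
  proof
    show "inj_on d (stk A)" using d0(2) by (auto simp: d_def inj_on_def)
    show "d g < Suc (Suc k)" if "g \<in> stk A" for g
      using imageI[OF that, of d0] unfolding d0(1) d_def by simp
  qed (auto simp: d_def)
  define c2 where "c2 = bind_com satom_code prog"
  define c3 where "c3 = bind_com (\<lambda>a. Atom (catom_code a)) c2"
  have set_bind: "set_com (bind_com f c) = (\<Union>a\<in>set_com c. set_com (f a))" for f :: "'x \<Rightarrow> 'y com" and c
    by (induction c) auto
  have ok2: "catom_bounded (Suc n) a \<and> natom_ok (catom_code a)" if "a \<in> set_com c2" for a
  proof -
    from that obtain b where b: "b \<in> set_com prog" "a \<in> set_com (satom_code b)"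
      unfolding c2_def set_bind by auto
    show ?thesis using prog_ok[OF b(1)] b(2) prime_gt_0_nat[OF prime_pr]
      by (cases b) (auto simp: push_code_def pop_code_def)
  qed
  have R1: "(stack_rel :: (('s, 'v, 'g) config \<times> _) set) O sem (csem W) c2 = sem (ssem W) prog O stack_rel"
    unfolding c2_def sem_bind_com
  proof (rule sem_refine, rule ballI, rule stack_rel_simulates)
    fix a assume "a \<in> set_com prog"
    from prog_ok[OF this] show "satom_bounded a" by (cases a) auto
  qed
  have R2: "godel_rel (Suc n) O sem (nsem W) c3 = sem (csem W) c2 O godel_rel (Suc n)"
    unfolding c3_def sem_bind_com
    by (rule sem_refine) (use godel_rel_simulates[of "Suc n" _ W] ok2 in auto)
  let ?T = "stack_rel O godel_rel (Suc n)"
  have R: "?T O sem (nsem W) c3 = sem (ssem W) prog O ?T"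
    unfolding O_assoc R2 unfolding O_assoc[symmetric] R1 ..
  have T: "(c, y) \<in> ?T \<longleftrightarrow> valid c \<and> y = (godel (Suc n) (vals c), proj c)" for c :: "('s, 'v, 'g) config" and y
    unfolding stack_rel_def godel_rel_def by auto
  have "valid (blank x)" for x :: "'v list" by (auto simp: valid_def blank_def)
  moreover have "vals (blank x) = (\<lambda>_. 0)" for x :: "'v list" by (auto simp: vals_def blank_def)
  moreover have "proj (blank x) = proj (init_cfg A x)" for x by (simp add: blank_def)
  ultimately have 0: "(blank x, y) \<in> ?T \<longleftrightarrow> y = (1, proj (init_cfg A x))" for x y
    unfolding T by (simp add: godel_def)
  have "(\<exists>N r. ((1, proj (init_cfg A x)), (N, r)) \<in> sem (nsem W) c3 \<and> accepting r) \<longleftrightarrow>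
    (\<exists>c. (blank x, c) \<in> sem (ssem W) prog \<and> accepting (proj c))" for x
  proof
    assume "\<exists>N r. ((1, proj (init_cfg A x)), (N, r)) \<in> sem (nsem W) c3 \<and> accepting r"
    then obtain N r where "((1, proj (init_cfg A x)), (N, r)) \<in> sem (nsem W) c3" "accepting r" by blast
    then have "(blank x, (N, r)) \<in> ?T O sem (nsem W) c3"
      by - (rule relcompI[where r="?T" and b="(1, proj (init_cfg A x))"], simp_all only: 0)
    then obtain c where "(blank x, c) \<in> sem (ssem W) prog" "(c, (N, r)) \<in> ?T"
      unfolding R by (rule relcompEpair)
    with \<open>accepting r\<close> show "\<exists>c. (blank x, c) \<in> sem (ssem W) prog \<and> accepting (proj c)"
      unfolding T by auto
  next
    assume "\<exists>c. (blank x, c) \<in> sem (ssem W) prog \<and> accepting (proj c)"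
    then obtain c where c: "(blank x, c) \<in> sem (ssem W) prog" "accepting (proj c)" by blast
    show "\<exists>N r. ((1, proj (init_cfg A x)), (N, r)) \<in> sem (nsem W) c3 \<and> accepting r"
    proof -
      \<comment> \<open>\<open>?T\<close> is defined on valid configurations only, so the
        configuration that is reached must be shown valid before its code can be used.\<close>
      have "(step A)\<^sup>*\<^sup>* (start x) c" using c(1) by (simp add: sem_prog)
      then have "good c"
        by (induction rule: rtranclp_induct) (auto intro: good_start good_step)
      then have "valid c"
        unfolding good_def valid_def by (metis Suc_leI atLeastAtMost_iff empty_subsetI gr0I list.set(1) One_nat_def)
      then have "(blank x, (godel (Suc n) (vals c), proj c)) \<in> sem (ssem W) prog O ?T"
        by - (rule relcompI[OF c(1)], subst T, simp)
      then obtain y where "(blank x, y) \<in> ?T" "(y, (godel (Suc n) (vals c), proj c)) \<in> sem (nsem W) c3"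
        unfolding R[symmetric] by (rule relcompEpair)
      then show ?thesis unfolding 0 using c(2) by auto
    qed
  qed
  moreover have "\<forall>a\<in>set_com c3. natom_ok a" unfolding c3_def set_bind using ok2 by auto
  ultimately show ?thesis using accepting_prog by auto
qed

end

section \<open>The simulating system\<close>

instance natom :: countable
  by countable_datatype

text \<open>\<open>Idle\<close> is the stack of a reader that offers nothing. The controller has no
  rule for it, so fetching it ends the run.\<close>

datatype sym = Bot nat | One | Base | Idle | Tok nat | Qs nat

instance sym :: countable
  by countable_datatype

type_synonym edge = "nat \<times> natom \<times> nat"

text \<open>In \<open>Pass e r w\<close>, \<open>r\<close> counts the symbols removed from the
  current block and \<open>w\<close> the waiting steps still owed for the last complete block.
  \<open>Drain\<close> waits for the incomplete block once only \<open>Base\<close> is left.\<close>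

datatype ctrl = Begin | Node nat | Fetch edge | Pass edge nat nat | Drain edge nat | Reload edge | Halt

instance ctrl :: countable
  by countable_datatype

text \<open>Every instruction becomes one pass from \<open>v * q + r\<close> to
  \<open>u * q + r\<close> under a condition on the remainder \<open>r\<close>:
  \<open>NDiv v\<close> is the fraction \<open>v / v\<close> with \<open>r \<noteq> 0\<close>, and
  \<open>Recv\<close> is \<open>1 / 1\<close>.\<close>

primrec divisor :: "natom \<Rightarrow> nat" where
  "divisor (Frac v u) = v"
| "divisor (NDiv v) = v"
| "divisor (Recv i t) = 1"

primrec multiplier :: "natom \<Rightarrow> nat" where
  "multiplier (Frac v u) = u"
| "multiplier (NDiv v) = v"
| "multiplier (Recv i t) = 1"

primrec residue_ok :: "natom \<Rightarrow> nat \<Rightarrow> bool" where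
  "residue_ok (Frac v u) r \<longleftrightarrow> r = 0"
| "residue_ok (NDiv v) r \<longleftrightarrow> r \<noteq> 0"
| "residue_ok (Recv i t) r \<longleftrightarrow> r = 0"

primrec is_Recv :: "natom \<Rightarrow> bool" where
  "is_Recv (Frac v u) \<longleftrightarrow> False"
| "is_Recv (NDiv v) \<longleftrightarrow> False"
| "is_Recv (Recv i t) \<longleftrightarrow> True"

abbreviation atom_of :: "edge \<Rightarrow> natom" where
  "atom_of e \<equiv> fst (snd e)"

text \<open>A number \<^term>\<open>N\<close> is stored as \<^term>\<open>N\<close> copies of \<^const>\<open>One\<close> above \<^const>\<open>Base\<close> on the stack of
  the controller, component 1. The clock, component \<open>n + 2\<close>, pushes a \<^const>\<open>One\<close> once in \<open>L\<close> ordinary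
  steps. To multiply by \<open>u / v\<close>, the controller empties its stack, spending \<open>u * L\<close> steps on every \<open>v\<close>
  symbols, and then queries the clock for its stack. Component \<open>i + 1\<close> keeps the state and the unread
  input of component \<open>i\<close> of the simulated system; it commits itself to a transition by offering a
  \<^const>\<open>Tok\<close> for it.\<close>

locale compiled = pcpa A for A :: "('s, 'v, 'g) pcpa" +
  fixes E :: "edge set" and st h :: nat
  assumes finite_E: "finite E" and E_ok: "(p, a, q) \<in> E \<Longrightarrow> natom_ok a"
begin

text \<open>The period of the clock. It is at least every divisor, so removing a block fits into the
  \<open>u * L\<close> steps allotted to it. It is at least 5, so an overhead of at most 4 steps is
  lost when whole periods are counted.\<close>

definition L :: nat where
  "L = 5 + (\<Sum>e\<in>E. divisor (atom_of e))"

text \<open>A common bound on the waiting counters, which keeps the state set finite: the first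
  summand covers \<open>Pass\<close>, the second one \<open>Drain\<close>.\<close>

definition bound :: nat where
  "bound = (\<Sum>e\<in>E. multiplier (atom_of e) * L + L * divisor (atom_of e))"

lemma L_ge: "5 \<le> L"
  by (simp add: L_def)

lemma divisor_le: "e \<in> E \<Longrightarrow> divisor (atom_of e) \<le> L"
  unfolding L_def using member_le_sum[of e E "\<lambda>e. divisor (atom_of e)"] finite_E by auto

lemma bound_ge:
  assumes "e \<in> E"
  shows "multiplier (atom_of e) * L + L * divisor (atom_of e) \<le> bound"
  unfolding bound_def using assms finite_E
  by (intro member_le_sum[of e E "\<lambda>e. multiplier (atom_of e) * L + L * divisor (atom_of e)"]) auto

lemma edge_pos:
  assumes "e \<in> E"
  shows "0 < divisor (atom_of e)" "0 < multiplier (atom_of e)"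
proof -
  obtain p a q where e: "e = (p, a, q)" by (cases e)
  with assms have "natom_ok a" using E_ok by blast
  then show "0 < divisor (atom_of e)" "0 < multiplier (atom_of e)" unfolding e by (cases a; auto)+
qed

definition nodes :: "nat set" where
  "nodes = {st, h} \<union> fst ` E \<union> (\<lambda>e. snd (snd e)) ` E"

lemma finite_nodes: "finite nodes"
  unfolding nodes_def using finite_E by simp

text \<open>Removing symbols already takes time. Therefore \<open>last\<close> deducts the steps of
  its block, and \<open>drain\<close> deducts one of the \<open>L\<close> steps that each of the
  \<open>r\<close> leftover symbols is worth. \<open>reload\<close> gives up \<open>Base\<close>
  because the stack of the clock brings its own. \<open>Halt\<close> loops so that the input can
  still be read to its end.\<close>

inductive ctr :: "ctrl \<Rightarrow> sym \<Rightarrow> ctrl \<Rightarrow> sym list \<Rightarrow> bool" where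
  starting: "ctr Begin (Bot 1) (Node st) [One, Base]"
| pass: "(p, a, q) \<in> E \<Longrightarrow> \<not> is_Recv a \<Longrightarrow> X \<in> {One, Base} \<Longrightarrow> ctr (Node p) X (Pass (p, a, q) 0 0) [X]"
| fetch: "(p, Recv i t, q) \<in> E \<Longrightarrow> X \<in> {One, Base} \<Longrightarrow> ctr (Node p) X (Fetch (p, Recv i t, q)) [Qs (Suc i), X]"
| fetched: "ctr (Fetch (p, Recv i t, q)) (Tok t) (Pass (p, Recv i t, q) 0 0) []"
| pop: "Suc r < divisor (atom_of e) \<Longrightarrow> ctr (Pass e r 0) One (Pass e (Suc r) 0) []"
| last: "Suc r = divisor (atom_of e) \<Longrightarrow>
    ctr (Pass e r 0) One (Pass e 0 (multiplier (atom_of e) * L - divisor (atom_of e))) []"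
| wait: "X \<in> {One, Base} \<Longrightarrow> ctr (Pass e r (Suc w)) X (Pass e r w) [X]"
| drain: "residue_ok (atom_of e) r \<Longrightarrow> ctr (Pass e r 0) Base (Drain e ((L - 1) * r)) [Base]"
| drain_wait: "ctr (Drain e (Suc w)) Base (Drain e w) [Base]"
| reload: "ctr (Drain e 0) Base (Reload e) [Qs (n + 2)]"
| reloaded: "X \<in> {One, Base} \<Longrightarrow> ctr (Reload (p, a, q)) X (Node q) [X]"
| halt: "X \<in> {One, Base} \<Longrightarrow> ctr (Node h) X Halt [X]"
| halted: "X \<in> {One, Base} \<Longrightarrow> ctr Halt X Halt [X]"

primrec ctrl_ok :: "ctrl \<Rightarrow> bool" where
  "ctrl_ok Begin \<longleftrightarrow> True"
| "ctrl_ok (Node p) \<longleftrightarrow> p \<in> nodes"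
| "ctrl_ok (Fetch e) \<longleftrightarrow> e \<in> E"
| "ctrl_ok (Pass e r w) \<longleftrightarrow> e \<in> E \<and> r < divisor (atom_of e) \<and> w \<le> bound"
| "ctrl_ok (Drain e w) \<longleftrightarrow> e \<in> E \<and> w \<le> bound"
| "ctrl_ok (Reload e) \<longleftrightarrow> e \<in> E"
| "ctrl_ok Halt \<longleftrightarrow> True"

lemma finite_ctrl_ok: "finite {k. ctrl_ok k}"
proof (rule finite_subset)
  show "{k. ctrl_ok k} \<subseteq> {Begin, Halt} \<union> Node ` nodes \<union> Fetch ` E \<union> Reload ` E \<union>
    (\<lambda>(e, r, w). Pass e r w) ` (E \<times> {..L} \<times> {..bound}) \<union> (\<lambda>(e, w). Drain e w) ` (E \<times> {..bound})"
  proof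
    fix k assume "k \<in> {k. ctrl_ok k}"
    then show "k \<in> {Begin, Halt} \<union> Node ` nodes \<union> Fetch ` E \<union> Reload ` E \<union>
    (\<lambda>(e, r, w). Pass e r w) ` (E \<times> {..L} \<times> {..bound}) \<union> (\<lambda>(e, w). Drain e w) ` (E \<times> {..bound})"
      using divisor_le by (cases k) (force simp: image_iff Bex_def)+
  qed
qed (use finite_E finite_nodes in auto)

lemma ctr_ok:
  assumes "ctr k X k' \<beta>" "ctrl_ok k"
  shows "ctrl_ok k'"
  using assms
proof cases
  case (pass p a q)
  then show ?thesis using edge_pos[of "(p, a, q)"] by auto
next
  case (fetched p i t q)
  then show ?thesis using assms(2) by auto
next
  case (last r e)
  then show ?thesis using assms(2) bound_ge[of e] edge_pos[of e] by auto
next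
  case (drain e r)
  then have "(L - 1) * r \<le> L * divisor (atom_of e)" using assms(2) by (intro mult_le_mono) auto
  then show ?thesis using drain assms(2) bound_ge[of e] by auto
next
  case (reloaded p a q)
  then show ?thesis using assms(2) by (force simp: nodes_def)
qed (auto simp: nodes_def)

text \<open>A filler for the first coordinate in the states of controller and clock, which hold no
  state of \<open>A\<close>.\<close>

definition s0 :: 's where
  "s0 = init (comp A 1)"

definition cq :: "ctrl \<Rightarrow> ('s \<times> nat) \<times> bool" where
  "cq k = ((s0, to_nat k), False)"

lemma cq_inject [simp]: "cq k = cq k' \<longleftrightarrow> k = k'"
  by (simp add: cq_def)

definition clock_tr :: "('s \<times> nat) \<times> bool \<Rightarrow> sym \<Rightarrow> ('s \<times> nat) \<times> bool \<Rightarrow> sym list \<Rightarrow> bool" where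
  "clock_tr q X q' \<beta> \<longleftrightarrow> (\<exists>m f. q = ((s0, m), f) \<and>
    (X = Bot (n + 2) \<and> m \<le> L \<and> q' = ((s0, 1), m \<noteq> 0) \<and> \<beta> = [Base] \<or>
     X \<in> {One, Base} \<and> 1 \<le> m \<and> m < L \<and> q' = ((s0, Suc m), False) \<and> \<beta> = [X] \<or>
     X \<in> {One, Base} \<and> m = L \<and> q' = ((s0, 1), False) \<and> \<beta> = [One, X]))"

text \<open>The mode \<open>m\<close> is 0 at the start, 1 when idle and 2 once a transition is
  committed. State and input move at the commitment; the token then stays until it is fetched, so a
  reader is ahead of the simulation by at most one transition.\<close>

definition reader_tr :: "nat \<Rightarrow> ('s \<times> nat) \<times> bool \<Rightarrow> 'v option \<Rightarrow> sym \<Rightarrow> ('s \<times> nat) \<times> bool \<Rightarrow> sym list \<Rightarrow> bool" where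
  "reader_tr i q a X q' \<beta> \<longleftrightarrow> (\<exists>s m f. q = ((s, m), f) \<and> s \<in> states (comp A i) \<and>
    (a = None \<and> X = Bot (Suc i) \<and> m \<le> 2 \<and> q' = ((s, 1), m \<noteq> 0) \<and> \<beta> = [Idle] \<or>
     a = None \<and> X = Idle \<and> m = 1 \<and> q' = ((s, 1), False) \<and> \<beta> = [Idle] \<or>
     X = Idle \<and> m = 1 \<and> (\<exists>p t. t < length toks \<and>
       (p, snd (toks ! t)) \<in> trans (comp A i) s a (fst (toks ! t)) \<and> q' = ((p, 2), False) \<and> \<beta> = [Tok t]) \<or>
     a = None \<and> m = 2 \<and> (\<exists>t<length toks. X = Tok t) \<and> q' = ((s, 2), False) \<and> \<beta> = [X]))"

text \<open>\<open>a\<close> is unconstrained for controller and clock: they must consume the input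
  in order to accept, but its content does not influence them.\<close>

definition tr :: "nat \<Rightarrow> ('s \<times> nat) \<times> bool \<Rightarrow> 'v option \<Rightarrow> sym \<Rightarrow> ('s \<times> nat) \<times> bool \<Rightarrow> sym list \<Rightarrow> bool" where
  "tr i q a X q' \<beta> \<longleftrightarrow>
    (if i = 1 then \<exists>k k'. ctrl_ok k \<and> q = cq k \<and> q' = cq k' \<and> ctr k X k' \<beta>
     else if i = n + 2 then clock_tr q X q' \<beta>
     else reader_tr (i - 1) q a X q' \<beta>)"

definition G :: "sym \<Rightarrow> 'g + nat" where
  "G X = Inr (to_nat X)"

lemma G_inject [simp]: "G X = G Y \<longleftrightarrow> X = Y"
  by (simp add: G_def)

definition syms :: "sym set" where
  "syms = {One, Base, Idle} \<union> Bot ` {1..n + 2} \<union> Qs ` {1..n + 2} \<union> Tok ` {..<length toks}"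

lemma finite_syms: "finite syms"
  by (simp add: syms_def)

definition Qst :: "nat \<Rightarrow> ('s \<times> nat) set" where
  "Qst i = (if i = 1 then {s0} \<times> to_nat ` {k. ctrl_ok k} else if i = n + 2 then {s0} \<times> {..L}
    else states (comp A (i - 1)) \<times> {..2})"

definition btrans :: "nat \<Rightarrow> ('s \<times> nat) \<times> bool \<Rightarrow> 'v option \<Rightarrow> 'g + nat \<Rightarrow> ((('s \<times> nat) \<times> bool) \<times> ('g + nat) list) set" where
  "btrans i q a g = {(q', map G \<beta>) | q' \<beta> X. g = G X \<and> X \<in> syms \<and> a \<in> insert None (Some ` inp A) \<and> tr i q a X q' \<beta>}"

text \<open>Mode 1 in the final states of a reader excludes a committed transition that was never
  fetched, after which its state would be ahead of the simulated one.\<close>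

definition B :: "(('s \<times> nat) \<times> bool, 'v, 'g + nat) pcpa" where
  "B = \<lparr>deg = n + 2, inp = inp A, stk = G ` syms,
    comp = (\<lambda>i. \<lparr>states = Qst i \<times> UNIV, trans = btrans i,
      init = (if i = 1 then cq Begin else if i = n + 2 then ((s0, 0), False) else ((init (comp A (i - 1)), 0), False)),
      bottom = G (Bot i),
      finals = (if i = 1 then {cq Halt} else if i = n + 2 then Qst i \<times> UNIV
        else {((s, 1), f) | s f. s \<in> finals (comp A (i - 1))})\<rparr>),
    qsym = (\<lambda>i. G (Qs i)), queries = {2..n + 2}\<rparr>"

lemma B_simps [simp]:
  "deg B = n + 2" "inp B = inp A" "stk B = G ` syms" "qsym B i = G (Qs i)" "queries B = {2..n + 2}"
  "states (comp B i) = Qst i \<times> UNIV" "trans (comp B i) = btrans i" "bottom (comp B i) = G (Bot i)"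
  "init (comp B i) = (if i = 1 then cq Begin else if i = n + 2 then ((s0, 0), False) else ((init (comp A (i - 1)), 0), False))"
  "finals (comp B i) = (if i = 1 then {cq Halt} else if i = n + 2 then Qst i \<times> UNIV
        else {((s, 1), f) | s f. s \<in> finals (comp A (i - 1))})"
  by (simp_all add: B_def)

section \<open>Well-formedness and centralization of the simulating system\<close>

lemma is_query_B: "is_query B (G X) \<longleftrightarrow> (\<exists>j\<in>{2..n + 2}. X = Qs j)"
  by (auto simp: is_query_def)

lemma tr_closed:
  assumes "i \<in> {1..n + 2}" "X \<in> syms" "tr i q a X q' \<beta>"
  shows "q \<in> Qst i \<times> UNIV" "q' \<in> Qst i \<times> UNIV" "set \<beta> \<subseteq> syms" "length \<beta> \<le> 2"
proof -
  have "q \<in> Qst i \<times> UNIV \<and> q' \<in> Qst i \<times> UNIV \<and> set \<beta> \<subseteq> syms \<and> length \<beta> \<le> 2"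
  proof (cases "i = 1")
    case True
    with assms(3) obtain k k' where k: "ctrl_ok k" "q = cq k" "q' = cq k'" "ctr k X k' \<beta>"
      unfolding tr_def by auto
    have "set \<beta> \<subseteq> syms \<and> length \<beta> \<le> 2"
      using k(4)
    proof cases
      case (fetch p i t q)
      then have "i \<in> {1..n}" using E_ok[of p "Recv i t" q] by simp
      then show ?thesis using fetch by (auto simp: syms_def)
    qed (auto simp: syms_def)
    then show ?thesis using k ctr_ok[OF k(4,1)] True by (auto simp: Qst_def cq_def)
  next
    case i: False
    show ?thesis
    proof (cases "i = n + 2")
      case True
      then show ?thesis using assms(3) i L_ge unfolding tr_def clock_tr_def
        by (auto simp: syms_def Qst_def)
    next
      case False
      with i assms(1) have "i - 1 \<in> {1..n}" by auto
      note t = trans_wf(4)[OF this]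
      from False i assms(3) have "reader_tr (i - 1) q a X q' \<beta>" by (simp add: tr_def)
      then show ?thesis using False i assms(2) t unfolding reader_tr_def
        by (auto simp: syms_def Qst_def)
    qed
  qed
  then show "q \<in> Qst i \<times> UNIV" "q' \<in> Qst i \<times> UNIV" "set \<beta> \<subseteq> syms" "length \<beta> \<le> 2" by auto
qed

lemma finite_Qst:
  assumes "i \<in> {1..n + 2}"
  shows "finite (Qst i)"
proof (cases "i = 1 \<or> i = n + 2")
  case False
  with assms have "i - 1 \<in> {1..n}" by auto
  from wf_comp(1)[OF this] False show ?thesis by (simp add: Qst_def)
qed (auto simp: Qst_def finite_ctrl_ok)

lemma finite_btrans:
  assumes "i \<in> {1..n + 2}"
  shows "finite (btrans i q a g)"
proof (rule finite_subset)
  show "btrans i q a g \<subseteq> (Qst i \<times> UNIV) \<times> map G ` {\<beta>. set \<beta> \<subseteq> syms \<and> length \<beta> \<le> 2}"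
    unfolding btrans_def using tr_closed(2,3,4)[OF assms] by blast
  show "finite ((Qst i \<times> (UNIV :: bool set)) \<times> map G ` {\<beta>. set \<beta> \<subseteq> syms \<and> length \<beta> \<le> 2})"
    using finite_Qst[OF assms] finite_lists_length_le[OF finite_syms] by auto
qed

lemma wf_B: "wf_pcpa B"
  unfolding wf_pcpa_def B_simps
proof (intro conjI ballI allI)
  show "1 \<le> n + 2" by simp
  show "finite (inp A)" by (rule wf_simps(2))
  show "finite (G ` syms)" using finite_syms by simp
  show "{2..n + 2} \<subseteq> {1..n + 2}" by simp
  show "inj_on (\<lambda>i. G (Qs i)) {1..n + 2}" by (simp add: inj_on_def)
  show "(\<lambda>i. G (Qs i)) ` {1..n + 2} \<subseteq> G ` syms" by (auto simp: syms_def)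
  fix i assume i: "i \<in> {1..n + 2}"
  have r: "i - 1 \<in> {1..n}" if "i \<noteq> 1" "i \<noteq> n + 2" using that i by auto
  show "finite (Qst i \<times> (UNIV :: bool set))" using finite_Qst[OF i] by simp
  show "(if i = 1 then cq Begin else if i = n + 2 then ((s0, 0), False) else ((init (comp A (i - 1)), 0), False))
    \<in> Qst i \<times> UNIV"
    using wf_comp(2)[OF r] by (auto simp: Qst_def cq_def)
  show "G (Bot i) \<in> G ` syms" using i by (auto simp: syms_def)
  show "(if i = 1 then {cq Halt} else if i = n + 2 then Qst i \<times> UNIV
        else {((s, 1), f) | s f. s \<in> finals (comp A (i - 1))}) \<subseteq> Qst i \<times> UNIV"
    using wf_comp(4)[OF r] by (auto simp: Qst_def cq_def)
  fix q a g
  show "finite (btrans i q a g)" by (rule finite_btrans[OF i])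
  show "btrans i q a g \<noteq> {} \<longrightarrow> q \<in> Qst i \<times> UNIV \<and> g \<in> G ` syms \<and> (case a of None \<Rightarrow> True | Some b \<Rightarrow> b \<in> inp A)"
  proof
    assume "btrans i q a g \<noteq> {}"
    then obtain x where "x \<in> btrans i q a g" by blast
    then obtain q' \<beta> X where x: "g = G X" "X \<in> syms" "a \<in> insert None (Some ` inp A)" "tr i q a X q' \<beta>"
      unfolding btrans_def by blast
    from x(3) have "case a of None \<Rightarrow> True | Some b \<Rightarrow> b \<in> inp A" by (cases a) auto
    with x tr_closed(1)[OF i x(2,4)]
    show "q \<in> Qst i \<times> UNIV \<and> g \<in> G ` syms \<and> (case a of None \<Rightarrow> True | Some b \<Rightarrow> b \<in> inp A)" by simp
  qed
  fix pb assume "pb \<in> btrans i q a g"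
  then obtain q' \<beta> X where x: "pb = (q', map G \<beta>)" "X \<in> syms" "tr i q a X q' \<beta>"
    unfolding btrans_def by blast
  from tr_closed(2,3)[OF i x(2,3)]
  show "case pb of (p, \<beta>) \<Rightarrow> p \<in> Qst i \<times> UNIV \<and> set \<beta> \<subseteq> G ` syms"
    unfolding x(1) by auto
qed

lemma tr_no_query:
  assumes "i \<in> {2..n + 2}" "tr i q a X q' \<beta>" "Y \<in> set \<beta>"
  shows "Y \<noteq> Qs j" "Y \<noteq> Bot k"
  using assms unfolding tr_def clock_tr_def reader_tr_def by (auto split: if_splits)

lemma centralized_B: "centralized B"
  unfolding centralized_def B_simps btrans_def
proof (intro ballI allI impI)
  fix i q a g p \<beta> Y
  assume i: "i \<in> {2..n + 2}" and Y: "Y \<in> set \<beta>"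
    and "(p, \<beta>) \<in> {(q', map G \<beta>) | q' \<beta> X. g = G X \<and> X \<in> syms \<and> a \<in> insert None (Some ` inp A) \<and> tr i q a X q' \<beta>}"
  then obtain X \<beta>' where b: "\<beta> = map G \<beta>'" "tr i q a X p \<beta>'" by blast
  then obtain Z where "Y = G Z" "Z \<in> set \<beta>'" using Y by auto
  with tr_no_query(1)[OF i b(2)] show "\<not> is_query B Y" by (auto simp: is_query_B)
qed

lemma rcpcpa_B: "rcpcpa B"
  using wf_B centralized_B by (simp add: rcpcpa_def)

subsection \<open>The communication property\<close>

definition local_step :: "nat \<Rightarrow> (('s \<times> nat) \<times> bool) \<times> 'v list \<times> ('g + nat) list \<Rightarrow>
    (('s \<times> nat) \<times> bool) \<times> 'v list \<times> ('g + nat) list \<Rightarrow> bool" where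
  "local_step i u v \<longleftrightarrow> (\<exists>X w a \<beta>. snd (snd u) = G X # w \<and> X \<in> syms \<and> (\<forall>j\<in>{2..n + 2}. X \<noteq> Qs j) \<and>
     a \<in> insert None (Some ` inp A) \<and> tr i (fst u) a X (fst v) \<beta> \<and>
     fst (snd u) = opt_word a @ fst (snd v) \<and> snd (snd v) = map G \<beta> @ w)"

lemma ord_step_B:
  "ord_step B c c' \<longleftrightarrow> (\<forall>i\<in>{1..n + 2}. local_step i (c i) (c' i)) \<and> (\<forall>i. i \<notin> {1..n + 2} \<longrightarrow> c' i = c i)"
proof -
  have "(cstk c i \<noteq> [] \<and> \<not> is_query B (hd (cstk c i)) \<and>
    (\<exists>a p \<beta>. (p, \<beta>) \<in> trans (comp B i) (cst c i) a (hd (cstk c i)) \<and>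
        cin c i = opt_word a @ cin c' i \<and> cst c' i = p \<and> cstk c' i = \<beta> @ tl (cstk c i))) \<longleftrightarrow>
    local_step i (c i) (c' i)" (is "?l \<longleftrightarrow> ?r") for i
  proof
    assume ?l
    then obtain g w a \<beta> where *: "cstk c i = g # w" "\<not> is_query B g" "(cst c' i, \<beta>) \<in> btrans i (cst c i) a g"
      "cin c i = opt_word a @ cin c' i" "cstk c' i = \<beta> @ w"
      by (auto simp: neq_Nil_conv)
    from *(3) obtain X \<beta>' where "g = G X" "X \<in> syms" "a \<in> insert None (Some ` inp A)" "tr i (cst c i) a X (cst c' i) \<beta>'"
      "\<beta> = map G \<beta>'"
      unfolding btrans_def by blast
    with * show ?r unfolding local_step_def cst_def[symmetric] cin_def[symmetric] cstk_def[symmetric]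
      by (auto simp: is_query_B intro!: exI[of _ X] exI[of _ w] exI[of _ a] exI[of _ \<beta>'])
  next
    assume ?r
    then obtain X w a \<beta> where *: "cstk c i = G X # w" "X \<in> syms" "\<forall>j\<in>{2..n + 2}. X \<noteq> Qs j"
      "a \<in> insert None (Some ` inp A)" "tr i (cst c i) a X (cst c' i) \<beta>"
      "cin c i = opt_word a @ cin c' i" "cstk c' i = map G \<beta> @ w"
      unfolding local_step_def cst_def[symmetric] cin_def[symmetric] cstk_def[symmetric] by blast
    then have "(cst c' i, map G \<beta>) \<in> btrans i (cst c i) a (G X)"
      unfolding btrans_def by blast
    with * show ?l
      by (intro conjI exI[of _ a] exI[of _ "cst c' i"] exI[of _ "map G \<beta>"]) (simp_all add: is_query_B)
  qed
  then show ?thesis unfolding ord_step_def B_simps(1) by blast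
qed

definition quiet :: "(('s \<times> nat) \<times> bool, 'v, 'g + nat) config \<Rightarrow> bool" where
  "quiet c \<longleftrightarrow> (\<forall>i\<in>{2..n + 2}. \<exists>v. v \<noteq> [] \<and> cstk c i = map G v \<and> set v \<inter> range Qs = {})"

lemma answers_B:
  assumes "quiet c"
  shows "answers B c i j \<longleftrightarrow> i = 1 \<and> j \<in> {2..n + 2} \<and> (\<exists>w. cstk c 1 = G (Qs j) # w)"
proof -
  have no: "cstk c i \<noteq> [] \<and> hd (cstk c i) \<noteq> G (Qs k)" if "i \<in> {2..n + 2}" for i k
  proof -
    from assms that obtain v where "v \<noteq> []" "cstk c i = map G v" "set v \<inter> range Qs = {}"
      unfolding quiet_def by blast
    then show ?thesis by (cases v) auto
  qed
  show ?thesis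
  proof
    assume a: "answers B c i j"
    then have "i \<in> {1..n + 2}" "j \<in> {2..n + 2}" "cstk c i \<noteq> []" "hd (cstk c i) = G (Qs j)"
      by (auto simp: answers_def)
    with no[of i j] show "i = 1 \<and> j \<in> {2..n + 2} \<and> (\<exists>w. cstk c 1 = G (Qs j) # w)"
      by (cases "i = 1") (auto simp: neq_Nil_conv)
  next
    assume a: "i = 1 \<and> j \<in> {2..n + 2} \<and> (\<exists>w. cstk c 1 = G (Qs j) # w)"
    then show "answers B c i j"
      using no[of j] unfolding answers_def by (auto simp: is_query_def)
  qed
qed

text \<open>Only component 1 can have a query on top, and the component that it asks is never
  querying itself. So the query is answered at once, and the step is one explicit update.\<close>

lemma com_step_B:
  assumes "quiet c"
  shows "com_step B c c' \<longleftrightarrow> (\<exists>j\<in>{2..n + 2}. \<exists>w. cstk c 1 = G (Qs j) # w \<and>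
    c' = setstk (setstk c 1 (cstk c j @ w)) j [G (Bot j)])"
proof -
  have no: "cstk c i \<noteq> [] \<and> \<not> is_query B (hd (cstk c i))" if "i \<in> {2..n + 2}" for i
  proof -
    from assms that obtain v where "v \<noteq> []" "cstk c i = map G v" "set v \<inter> range Qs = {}"
      unfolding quiet_def by blast
    then show ?thesis by (cases v) (auto simp: is_query_B)
  qed
  have same: "c = d \<longleftrightarrow> (\<forall>i. cst c i = cst d i \<and> cin c i = cin d i \<and> cstk c i = cstk d i)"
    for c d :: "(('s \<times> nat) \<times> bool, 'v, 'g + nat) config"
    by (auto simp: config_eq_iff fun_eq_iff)
  show ?thesis
  proof
    assume a: "com_step B c c'"
    then obtain i where i: "i \<in> {1..n + 2}" "cstk c i \<noteq> []" "is_query B (hd (cstk c i))"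
      unfolding com_step_def by auto
    with no[of i] have "i = 1" by force
    with i obtain j w where j: "j \<in> {2..n + 2}" "cstk c 1 = G (Qs j) # w"
      by (auto simp: neq_Nil_conv is_query_def)
    have ans: "answers B c i k \<longleftrightarrow> i = 1 \<and> k = j" for i k
      unfolding answers_B[OF assms] using j by auto
    have snd: "sends B c i \<longleftrightarrow> i = j" for i
      by (simp add: sends_def ans)
    have out: "c' k = c k" if "k \<notin> {1..n + 2}" for k using a that unfolding com_step_def by simp
    have "cst c' k = cst c k \<and> cin c' k = cin c k \<and>
      cstk c' k = (if k = j then [G (Bot j)] else if k = 1 then cstk c j @ w else cstk c k)" for k
    proof (cases "k \<in> {1..n + 2}")
      case True
      then have "cst c' k = cst c k" "cin c' k = cin c k" "answers B c k j \<longrightarrow> cstk c' k = cstk c j @ tl (cstk c k)"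
        "sends B c k \<longrightarrow> cstk c' k = [bottom (comp B k)]"
        "(\<nexists>j. answers B c k j) \<and> \<not> sends B c k \<longrightarrow> cstk c' k = cstk c k"
        using a unfolding com_step_def B_simps(1) by blast+
      then show ?thesis using j by (auto simp: ans snd)
    next
      case False
      then show ?thesis using out[OF False] j by (auto simp: cst_def cin_def cstk_def)
    qed
    then have "c' = setstk (setstk c 1 (cstk c j @ w)) j [G (Bot j)]"
      unfolding same by auto
    with j show "\<exists>j\<in>{2..n + 2}. \<exists>w. cstk c 1 = G (Qs j) # w \<and>
      c' = setstk (setstk c 1 (cstk c j @ w)) j [G (Bot j)]" by blast
  next
    assume "\<exists>j\<in>{2..n + 2}. \<exists>w. cstk c 1 = G (Qs j) # w \<and>
      c' = setstk (setstk c 1 (cstk c j @ w)) j [G (Bot j)]"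
    then obtain j w where j: "j \<in> {2..n + 2}" "cstk c 1 = G (Qs j) # w"
      "c' = setstk (setstk c 1 (cstk c j @ w)) j [G (Bot j)]" by blast
    have ans: "answers B c i k \<longleftrightarrow> i = 1 \<and> k = j" for i k
      unfolding answers_B[OF assms] using j by auto
    have snd: "sends B c i \<longleftrightarrow> i = j" for i
      by (simp add: sends_def ans)
    have ne: "cstk c i \<noteq> []" if "i \<in> {1..n + 2}" for i
      using no[of i] j(2) that by (cases "i = 1") auto
    have q: "\<exists>i\<in>{1..n + 2}. is_query B (hd (cstk c i))"
      by (rule bexI[of _ 1]) (use j in \<open>auto simp: is_query_B\<close>)
    have out: "c' k = c k" if "k \<notin> {1..n + 2}" for k
      using that j(1) unfolding j(3) setstk_def by auto
    have "cst c' = cst c" "cin c' = cin c"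
      "cstk c' = (\<lambda>k. if k = j then [G (Bot j)] else if k = 1 then cstk c j @ w else cstk c k)"
      unfolding j(3) by auto
    then show "com_step B c c'"
      unfolding com_step_def B_simps(1,8) ans snd using ne q out j(1,2) by (auto simp del: One_nat_def)
  qed
qed

lemma tr_flag:
  assumes "i \<in> {2..n + 2}" "tr i q a X q' \<beta>"
  shows "snd q' \<longleftrightarrow> X = Bot i \<and> snd (fst q) \<noteq> 0" "snd (fst q') \<noteq> 0" "\<beta> \<noteq> []" "set \<beta> \<inter> range Qs = {}"
    "hd \<beta> \<noteq> Bot k"
  using assms unfolding tr_def clock_tr_def reader_tr_def by (auto split: if_splits)

text \<open>The trace that a delivery leaves in its sender until the next ordinary step replaces the
  initial symbol.\<close>

definition fresh :: "(('s \<times> nat) \<times> bool, 'v, 'g + nat) config \<Rightarrow> nat \<Rightarrow> bool" where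
  "fresh c j \<longleftrightarrow> cstk c j \<noteq> [] \<and> hd (cstk c j) = G (Bot j) \<and> snd (fst (cst c j)) \<noteq> 0"

primrec waiting :: "ctrl \<Rightarrow> bool" where
  "waiting Begin \<longleftrightarrow> False"
| "waiting (Node p) \<longleftrightarrow> False"
| "waiting (Fetch e) \<longleftrightarrow> True"
| "waiting (Pass e r w) \<longleftrightarrow> False"
| "waiting (Drain e w) \<longleftrightarrow> False"
| "waiting (Reload e) \<longleftrightarrow> True"
| "waiting Halt \<longleftrightarrow> False"

text \<open>Queries are pushed only on the way from a non-waiting to a waiting state, so the
  ordinary step right after a communication pushes none. This gap lets the flag be cleared before
  the next query is answered.\<close>

lemma ctr_queries:
  assumes "ctr k X k' \<beta>"
  shows "set (tl \<beta>) \<inter> range Qs = {}" "\<beta> \<noteq> [] \<Longrightarrow> hd \<beta> = Qs j \<Longrightarrow> waiting k' \<and> \<not> waiting k" "k' \<noteq> Begin"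
  using assms by (cases; auto)+

text \<open>The last conjunct is the core. A query on top was pushed from a non-waiting state, in
  which no component was fresh, so the step that pushed it left no flag set.\<close>

definition cinv :: "(('s \<times> nat) \<times> bool, 'v, 'g + nat) config \<Rightarrow> bool" where
  "cinv c \<longleftrightarrow> quiet c \<and> (\<exists>k w. cst c 1 = cq k \<and> cstk c 1 = map G w \<and> set (tl w) \<inter> range Qs = {} \<and>
     (k \<noteq> Begin \<longrightarrow> (\<forall>j\<in>{2..n + 2}. snd (fst (cst c j)) \<noteq> 0)) \<and>
     (\<not> waiting k \<longrightarrow> (\<forall>j\<in>{2..n + 2}. \<not> fresh c j)) \<and>
     (w \<noteq> [] \<and> hd w \<in> range Qs \<longrightarrow> waiting k \<and> (\<forall>j\<in>{2..n + 2}. \<not> fresh c j \<and> \<not> snd (cst c j))))"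

lemma cinvE:
  assumes "cinv c"
  obtains k w where "quiet c" "cst c 1 = cq k" "cstk c 1 = map G w" "set (tl w) \<inter> range Qs = {}"
     "k \<noteq> Begin \<longrightarrow> (\<forall>j\<in>{2..n + 2}. snd (fst (cst c j)) \<noteq> 0)"
     "\<not> waiting k \<longrightarrow> (\<forall>j\<in>{2..n + 2}. \<not> fresh c j)"
     "w \<noteq> [] \<and> hd w \<in> range Qs \<longrightarrow> waiting k \<and> (\<forall>j\<in>{2..n + 2}. \<not> fresh c j \<and> \<not> snd (cst c j))"
  using assms unfolding cinv_def by (elim conjE exE) (rule that; assumption)

lemma quietE:
  assumes "quiet c" "i \<in> {2..n + 2}"
  obtains v where "v \<noteq> []" "cstk c i = map G v" "set v \<inter> range Qs = {}"
  using bspec[OF assms(1)[unfolded quiet_def] assms(2)] by (elim conjE exE) (rule that; assumption)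

lemma cinv_init: "cinv (init_cfg B x)"
proof -
  have "quiet (init_cfg B x)"
    unfolding quiet_def init_cfg_def cstk_def by (auto intro: exI[of _ "[Bot _]"])
  moreover have "cst (init_cfg B x) 1 = cq Begin" "cstk (init_cfg B x) 1 = map G [Bot 1]"
    by (auto simp: init_cfg_def cst_def cstk_def)
  moreover have "\<not> fresh (init_cfg B x) j" if "j \<in> {2..n + 2}" for j
    using that by (auto simp: init_cfg_def cst_def cstk_def fresh_def)
  ultimately show ?thesis
    unfolding cinv_def by (intro conjI exI[of _ Begin] exI[of _ "[Bot 1]"]) auto
qed

lemma local_stepE:
  assumes "ord_step B c c'" "i \<in> {1..n + 2}"
  obtains X w a \<beta> where "cstk c i = G X # w" "X \<in> syms" "\<forall>j\<in>{2..n + 2}. X \<noteq> Qs j"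
    "a \<in> insert None (Some ` inp A)" "tr i (cst c i) a X (cst c' i) \<beta>"
    "cin c i = opt_word a @ cin c' i" "cstk c' i = map G \<beta> @ w"
  using assms unfolding ord_step_B local_step_def cst_def[symmetric] cin_def[symmetric] cstk_def[symmetric] by blast

lemma ord_step_flags:
  assumes "ord_step B c c'" "j \<in> {2..n + 2}"
  shows "snd (cst c' j) \<longleftrightarrow> fresh c j" "\<not> fresh c' j" "snd (fst (cst c' j)) \<noteq> 0"
proof -
  from assms(2) have "j \<in> {1..n + 2}" by auto
  from local_stepE[OF assms(1) this] obtain X w a \<beta> where *: "cstk c j = G X # w" "X \<in> syms" "\<forall>j\<in>{2..n + 2}. X \<noteq> Qs j"
      "a \<in> insert None (Some ` inp A)" "tr j (cst c j) a X (cst c' j) \<beta>"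
      "cin c j = opt_word a @ cin c' j" "cstk c' j = map G \<beta> @ w" .
  note t = tr_flag[OF assms(2) *(5)]
  show "snd (cst c' j) \<longleftrightarrow> fresh c j" "snd (fst (cst c' j)) \<noteq> 0"
    using t(1,2) *(1) by (auto simp: fresh_def)
  show "\<not> fresh c' j"
    using t(3,5) *(7) by (cases \<beta>) (auto simp: fresh_def)
qed

lemma cinv_ord_step:
  assumes "cinv c" "ord_step B c c'"
  shows "cinv c'"
proof -
  have q: "quiet c" using assms(1) by (simp add: cinv_def)
  have "quiet c'"
    unfolding quiet_def
  proof
    fix i assume i: "i \<in> {2..n + 2}"
    then have "i \<in> {1..n + 2}" by auto
    from local_stepE[OF assms(2) this] obtain X w a \<beta> where *: "cstk c i = G X # w" "X \<in> syms" "\<forall>j\<in>{2..n + 2}. X \<noteq> Qs j"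
      "a \<in> insert None (Some ` inp A)" "tr i (cst c i) a X (cst c' i) \<beta>"
      "cin c i = opt_word a @ cin c' i" "cstk c' i = map G \<beta> @ w" .
    from quietE[OF q i] obtain v where v: "v \<noteq> []" "cstk c i = map G v" "set v \<inter> range Qs = {}" .
    from v(2) *(1) obtain v' where "v = X # v'" "w = map G v'" by (cases v) auto
    with v tr_flag(3,4)[OF i *(5)] *(7) show "\<exists>v. v \<noteq> [] \<and> cstk c' i = map G v \<and> set v \<inter> range Qs = {}"
      by (intro exI[of _ "\<beta> @ v'"]) auto
  qed
  have "1 \<in> {1..n + 2}" by simp
  from local_stepE[OF assms(2) this] obtain X w a \<beta> where *: "cstk c 1 = G X # w" "X \<in> syms" "\<forall>j\<in>{2..n + 2}. X \<noteq> Qs j"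
      "a \<in> insert None (Some ` inp A)" "tr 1 (cst c 1) a X (cst c' 1) \<beta>"
      "cin c 1 = opt_word a @ cin c' 1" "cstk c' 1 = map G \<beta> @ w" .
  from cinvE[OF assms(1)] obtain k w0 where k0: "quiet c" "cst c 1 = cq k" "cstk c 1 = map G w0" "set (tl w0) \<inter> range Qs = {}"
     "k \<noteq> Begin \<longrightarrow> (\<forall>j\<in>{2..n + 2}. snd (fst (cst c j)) \<noteq> 0)"
     "\<not> waiting k \<longrightarrow> (\<forall>j\<in>{2..n + 2}. \<not> fresh c j)"
     "w0 \<noteq> [] \<and> hd w0 \<in> range Qs \<longrightarrow> waiting k \<and> (\<forall>j\<in>{2..n + 2}. \<not> fresh c j \<and> \<not> snd (cst c j))" .
  note k = k0(2-4,6)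
  from k0(3) *(1) obtain w' where w': "w0 = X # w'" "w = map G w'" by (cases w0) auto
  from *(5) k(1) obtain k' where k': "cst c' 1 = cq k'" "ctr k X k' \<beta>"
    by (auto simp: tr_def)
  have st: "cstk c' 1 = map G (\<beta> @ w')" using *(7) w'(2) by simp
  have tl: "set (tl (\<beta> @ w')) \<inter> range Qs = {}"
    using ctr_queries(1)[OF k'(2)] k(3) w'(1) by (cases \<beta>; cases w') auto
  have hd: "waiting k' \<and> \<not> waiting k" if "\<beta> @ w' \<noteq> []" "hd (\<beta> @ w') \<in> range Qs"
    using ctr_queries(2)[OF k'(2)] that k(3) w'(1) by (cases \<beta>; cases w') auto
  show ?thesis
    unfolding cinv_def
  proof (intro conjI exI[of _ k'] exI[of _ "\<beta> @ w'"] impI ballI)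
    show "quiet c'" "cst c' 1 = cq k'" "cstk c' 1 = map G (\<beta> @ w')" "set (tl (\<beta> @ w')) \<inter> range Qs = {}"
      by fact+
    fix j assume j: "j \<in> {2..n + 2}"
    show "snd (fst (cst c' j)) \<noteq> 0" "\<not> fresh c' j" "\<not> fresh c' j" by (rule ord_step_flags[OF assms(2) j])+
    assume "\<beta> @ w' \<noteq> [] \<and> hd (\<beta> @ w') \<in> range Qs"
    with hd k(4) j have "\<not> fresh c j" by blast
    with ord_step_flags(1)[OF assms(2) j] show "\<not> snd (cst c' j)" by simp
  next
    assume "\<beta> @ w' \<noteq> [] \<and> hd (\<beta> @ w') \<in> range Qs"
    with hd show "waiting k'" by blast
  qed
qed

text \<open>A query on top excludes freshness before the communication, so afterwards exactly the
  sender is fresh.\<close>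

lemma cinv_com_step:
  assumes "cinv c" "com_step B c c'"
  shows "cinv c'" and "j \<in> {2..n + 2} \<Longrightarrow> fresh c' j \<longleftrightarrow> sends B c j" and "j \<in> {2..n + 2} \<Longrightarrow> \<not> fresh c j"
proof -
  have q: "quiet c" using assms(1) by (simp add: cinv_def)
  from assms(2) obtain j0 u where j: "j0 \<in> {2..n + 2}" "cstk c 1 = G (Qs j0) # u"
    "c' = setstk (setstk c 1 (cstk c j0 @ u)) j0 [G (Bot j0)]"
    unfolding com_step_B[OF q] by blast
  from cinvE[OF assms(1)] obtain k w0 where k0: "quiet c" "cst c 1 = cq k" "cstk c 1 = map G w0" "set (tl w0) \<inter> range Qs = {}"
     "k \<noteq> Begin \<longrightarrow> (\<forall>j\<in>{2..n + 2}. snd (fst (cst c j)) \<noteq> 0)"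
     "\<not> waiting k \<longrightarrow> (\<forall>j\<in>{2..n + 2}. \<not> fresh c j)"
     "w0 \<noteq> [] \<and> hd w0 \<in> range Qs \<longrightarrow> waiting k \<and> (\<forall>j\<in>{2..n + 2}. \<not> fresh c j \<and> \<not> snd (cst c j))" .
  note k = k0(2-5,7)
  from k(2) j(2) obtain w where w: "w0 = Qs j0 # w" "u = map G w" by auto
  from k(5) w(1) have k5: "waiting k" "\<And>j. j \<in> {2..n + 2} \<Longrightarrow> \<not> fresh c j" by auto
  then have "k \<noteq> Begin" by auto
  with k(4) have m: "\<And>j. j \<in> {2..n + 2} \<Longrightarrow> snd (fst (cst c j)) \<noteq> 0" by blast
  from quietE[OF q j(1)] obtain v where v: "v \<noteq> []" "cstk c j0 = map G v" "set v \<inter> range Qs = {}" .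
  have c': "cst c' = cst c" "cstk c' = (cstk c)(1 := cstk c j0 @ u, j0 := [G (Bot j0)])" unfolding j(3) by simp_all
  have "quiet c'"
    using q j(1) unfolding quiet_def c' by (auto intro!: exI[of _ "[Bot j0]"])
  moreover have "cstk c' 1 = map G (v @ w)" using j(1) unfolding c' by (simp add: v w)
  moreover have "set (tl (v @ w)) \<inter> range Qs = {}" using v k(3) w(1) by (cases v) auto
  moreover have "\<not> (hd (v @ w) \<in> range Qs)" using v by (cases v) auto
  ultimately show "cinv c'"
    unfolding cinv_def c'(1) using k(1) m k5(1)
    by - (rule conjI, assumption, rule exI[of _ k], rule exI[of _ "v @ w"], simp)
  show "\<not> fresh c j" if "j \<in> {2..n + 2}" using k5(2)[OF that] .
  show "fresh c' j \<longleftrightarrow> sends B c j" if "j \<in> {2..n + 2}"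
  proof -
    have "sends B c j \<longleftrightarrow> j = j0"
      unfolding sends_def answers_B[OF q] using j(1,2) that by auto
    moreover have "fresh c' j0" using m[OF j(1)] by (simp add: fresh_def c')
    moreover have "\<not> fresh c' j" if "j \<noteq> j0"
      using k5(2)[OF \<open>j \<in> {2..n + 2}\<close>] that \<open>j \<in> {2..n + 2}\<close> by (auto simp: fresh_def c')
    ultimately show ?thesis by blast
  qed
qed

lemma not_sends_ord: "ord_step B c c' \<Longrightarrow> \<not> sends B c j"
  unfolding ord_step_def sends_def answers_def is_query_def by blast

lemma comm_property_B: "comm_property B"
  unfolding comm_property_def
proof (intro conjI ballI allI impI)
  show "\<exists>Q. states (comp B i) = Q \<times> UNIV" for i by (rule exI[of _ "Qst i"]) simp
  show "\<not> snd (init (comp B j))" for j by (simp add: cq_def)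
next
  fix x r m j
  assume *: "set x \<subseteq> inp B \<and> r 0 = init_cfg B x \<and> (\<forall>k<m. step B (r k) (r (Suc k)))"
  have inv: "cinv (r k)" if "k \<le> m" for k
    using that
  proof (induction k)
    case 0
    then show ?case using * cinv_init by simp
  next
    case (Suc k)
    then show ?case using * cinv_ord_step[of "r k"] cinv_com_step(1)[of "r k"] unfolding step_def by (meson Suc_le_lessD less_imp_le_nat)
  qed
  have ctl: "\<not> snd (cst c 1)" if "cinv c" for c
    using that unfolding cinv_def by (auto simp: cq_def)
  show "\<not> snd (cst (r k) i)" "\<not> snd (cst (r k) j)" if "k < m" "answers B (r k) i j" for k i
  proof -
    have c: "cinv (r k)" using inv that(1) by simp
    then have q: "quiet (r k)" by (simp add: cinv_def)
    from that(2) have a: "i = 1" "j \<in> {2..n + 2}" "\<exists>w. cstk (r k) 1 = G (Qs j) # w"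
      unfolding answers_B[OF q] by auto
    show "\<not> snd (cst (r k) i)" using ctl[OF c] a(1) by simp
    show "\<not> snd (cst (r k) j)" using c a(2,3) unfolding cinv_def by fastforce
  qed
  fix t assume j: "j \<in> {1..deg B}" and t: "t < m" "ord_step B (r t) (r (Suc t))"
  let ?S = "\<lambda>t. \<exists>k<t. sends B (r k) j \<and> (\<forall>l. k < l \<and> l < t \<longrightarrow> \<not> ord_step B (r l) (r (Suc l)))"
  show "snd (cst (r (Suc t)) j) \<longleftrightarrow> ?S t"
  proof (cases "j = 1")
    case True
    have "\<not> sends B (r k) j" if "k < t" for k
      using inv[of k] that t(1) answers_B[of "r k" _ j] True unfolding sends_def cinv_def by auto
    then show ?thesis using ctl[OF inv[of "Suc t"]] t(1) True by auto
  next
    case False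
    with j have j: "j \<in> {2..n + 2}" by auto
    \<comment> \<open>Freshness records the deliveries since the last ordinary step; by
      \<open>ord_step_flags\<close> the next ordinary step copies it into the flag.\<close>
    have "fresh (r t) j \<longleftrightarrow> ?S t" if "t \<le> m" for t
      using that
    proof (induction t)
      case 0
      have "\<not> fresh (r 0) j"
        using * j by (auto simp: init_cfg_def cst_def cstk_def fresh_def)
      then show ?case by simp
    next
      case (Suc t)
      then have IH: "fresh (r t) j \<longleftrightarrow> ?S t" and c: "cinv (r t)" and s: "step B (r t) (r (Suc t))"
        using inv * by auto
      from s consider "ord_step B (r t) (r (Suc t))" | "com_step B (r t) (r (Suc t))" by (auto simp: step_def)
      then show ?case
      proof cases
        case 1
        then have "\<not> fresh (r (Suc t)) j" using ord_step_flags(2) j by blast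
        moreover have "\<not> ?S (Suc t)" using 1 not_sends_ord[OF 1] by (metis less_antisym lessI)
        ultimately show ?thesis by simp
      next
        case 2
        note f = cinv_com_step(2,3)[OF c 2 j]
        have "?S (Suc t) \<longleftrightarrow> sends B (r t) j"
        proof
          assume "?S (Suc t)"
          then obtain k where k: "k < Suc t" "sends B (r k) j" "\<forall>l. k < l \<and> l < Suc t \<longrightarrow> \<not> ord_step B (r l) (r (Suc l))"
            by blast
          \<comment> \<open>Nothing is fresh while a query is pending, so by the induction
            hypothesis \<open>j\<close> has sent nothing earlier since the last ordinary
            step.\<close>
          then have "\<not> k < t" using f(2) IH by auto
          with k show "sends B (r t) j" by (auto simp: less_Suc_eq)
        next
          assume "sends B (r t) j"
          then show "?S (Suc t)" by (intro exI[of _ t]) auto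
        qed
        with f(1) show ?thesis by simp
      qed
    qed
    then show ?thesis using ord_step_flags(1)[OF t(2) j] t(1) by simp
  qed
qed

subsection \<open>Soundness\<close>

definition reach :: "(nat \<Rightarrow> 's \<times> 'v list) \<Rightarrow> nat \<Rightarrow> nat \<Rightarrow> (nat \<Rightarrow> 's \<times> 'v list) \<Rightarrow> bool" where
  "reach r0 p N r \<longleftrightarrow> ((st, (1, r0)), (p, (N, r))) \<in> (grel (nsem W) E)\<^sup>*"

text \<open>The moment when the edge \<open>e\<close> has been chosen and its action on states and
  inputs carried out, while its arithmetic is still ahead.\<close>

definition pre :: "(nat \<Rightarrow> 's \<times> 'v list) \<Rightarrow> edge \<Rightarrow> nat \<Rightarrow> (nat \<Rightarrow> 's \<times> 'v list) \<Rightarrow> bool" where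
  "pre r0 e N r \<longleftrightarrow> e \<in> E \<and> (\<exists>r1. reach r0 (fst e) N r1 \<and>
     (case atom_of e of Recv i t \<Rightarrow> (r1, r) \<in> W i t | _ \<Rightarrow> r = r1))"

lemma nsem_iff:
  assumes "0 < divisor a"
  shows "((N, r), (N', r')) \<in> nsem W a \<longleftrightarrow>
    (case a of Recv i t \<Rightarrow> (r, r') \<in> W i t | _ \<Rightarrow> r' = r) \<and>
    residue_ok a (N mod divisor a) \<and> N' = multiplier a * (N div divisor a) + N mod divisor a"
  using assms by (cases a) (auto simp: mod_eq_0_iff_dvd mult.commute)

lemma pre_reach:
  assumes "pre r0 e (divisor (atom_of e) * q + r) rr" "r < divisor (atom_of e)" "residue_ok (atom_of e) r"
  shows "reach r0 (snd (snd e)) (multiplier (atom_of e) * q + r) rr"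
proof -
  obtain p a p' where e: "e = (p, a, p')" by (cases e)
  from assms(1) obtain r1 where r1: "e \<in> E" "reach r0 p (divisor a * q + r) r1"
    "case a of Recv i t \<Rightarrow> (r1, rr) \<in> W i t | _ \<Rightarrow> rr = r1"
    unfolding pre_def e by auto
  have "((divisor a * q + r, r1), (multiplier a * q + r, rr)) \<in> nsem W a"
    using r1(3) assms(2,3) unfolding e by (subst nsem_iff) auto
  then have "((p, (divisor a * q + r, r1)), (p', (multiplier a * q + r, rr))) \<in> grel (nsem W) E"
    using r1(1) unfolding e by (auto intro: grelI)
  with r1(2) show ?thesis unfolding reach_def e by (auto intro: rtrancl_into_rtrancl)
qed

definition unary :: "nat \<Rightarrow> sym list" where
  "unary N = replicate N One @ [Base]"

lemma unary_simps [simp]: "unary 0 = [Base]" "unary (Suc N) = One # unary N"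
  by (simp_all add: unary_def)

lemma unary_Cons: "unary N = X # w \<longleftrightarrow> (N = 0 \<and> X = Base \<and> w = []) \<or> (\<exists>k. N = Suc k \<and> X = One \<and> w = unary k)"
  by (cases N) auto

text \<open>The part of a configuration that the controller sees: its state and stack, the number of ordinary steps
  since the clock was last reset, and the states and unread inputs that the readers stand for.\<close>

inductive mstep :: "ctrl \<Rightarrow> sym list \<Rightarrow> nat \<Rightarrow> (nat \<Rightarrow> 's \<times> 'v list) \<Rightarrow>
    ctrl \<Rightarrow> sym list \<Rightarrow> nat \<Rightarrow> (nat \<Rightarrow> 's \<times> 'v list) \<Rightarrow> bool" where
  ord: "ctr k X k' \<beta> \<Longrightarrow> mstep k (X # w) a r k' (\<beta> @ w) (Suc a) r"
| recv: "fire i t (r i) v \<Longrightarrow> mstep k (Qs (Suc i) # w) a r k (Tok t # w) a (r(i := v))"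
| stuck: "X \<in> insert Idle (range Bot) \<Longrightarrow> mstep k (Qs j # w) a r k (X # w) a r"
| clock: "mstep k (Qs (n + 2) # w) (Suc a) r k (unary (a div L) @ w) 0 r"

text \<open>The age of the clock when a pass begins: one step for entering the node, one for
  choosing the edge, and for \<open>Recv\<close> one more for dropping the token.\<close>

definition age0 :: "natom \<Rightarrow> nat" where
  "age0 a = (if is_Recv a then 3 else 2)"

text \<open>During a pass, elapsed plus owed time \<open>a + w\<close> is determined by the number
  \<open>q\<close> of finished blocks and by \<open>r\<close>; this is where the product is stored.
  A fetched token \<open>t'\<close> may differ from the expected \<open>t\<close>, but then no rule
  continues. The last clause absorbs the runs that are blocked by a useless answer and claims
  nothing about them.\<close>

inductive minv :: "(nat \<Rightarrow> 's \<times> 'v list) \<Rightarrow> ctrl \<Rightarrow> sym list \<Rightarrow> nat \<Rightarrow> (nat \<Rightarrow> 's \<times> 'v list) \<Rightarrow> bool"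
  for r0 where
  "minv r0 Begin [Bot 1] 0 r0"
| "reach r0 p N r \<Longrightarrow> minv r0 (Node p) (unary N) 1 r"
| "reach r0 p N r \<Longrightarrow> (p, Recv i t, q) \<in> E \<Longrightarrow> minv r0 (Fetch (p, Recv i t, q)) (Qs (Suc i) # unary N) 2 r"
| "reach r0 p N r \<Longrightarrow> (p, Recv i t, q) \<in> E \<Longrightarrow> (r, r') \<in> W i t' \<Longrightarrow>
    minv r0 (Fetch (p, Recv i t, q)) (Tok t' # unary N) 2 r'"
| "pre r0 e (k + divisor (atom_of e) * q + r) rr \<Longrightarrow> r < divisor (atom_of e) \<Longrightarrow> (w \<noteq> 0 \<longrightarrow> r = 0) \<Longrightarrow>
    a + w = age0 (atom_of e) + q * multiplier (atom_of e) * L + r \<Longrightarrow> minv r0 (Pass e r w) (unary k) a rr"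
| "pre r0 e (divisor (atom_of e) * q + r) rr \<Longrightarrow> r < divisor (atom_of e) \<Longrightarrow> residue_ok (atom_of e) r \<Longrightarrow>
    a + w = age0 (atom_of e) + 1 + q * multiplier (atom_of e) * L + r * L \<Longrightarrow> minv r0 (Drain e w) [Base] a rr"
| "pre r0 e (divisor (atom_of e) * q + r) rr \<Longrightarrow> r < divisor (atom_of e) \<Longrightarrow> residue_ok (atom_of e) r \<Longrightarrow>
    a = age0 (atom_of e) + 2 + (multiplier (atom_of e) * q + r) * L \<Longrightarrow> minv r0 (Reload e) [Qs (n + 2)] a rr"
| "reach r0 (snd (snd e)) N r \<Longrightarrow> minv r0 (Reload e) (unary N) 0 r"
| "reach r0 h N r \<Longrightarrow> minv r0 Halt (unary M) a r"
| "waiting k \<Longrightarrow> X \<in> insert Idle (range Bot) \<Longrightarrow> minv r0 k (X # w) a r"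

lemma minv_step:
  assumes "minv r0 k w a r" "mstep k w a r k' w' a' r'"
  shows "minv r0 k' w' a' r'"
  using assms(1)
proof cases
  case 1
  have "reach r0 st 1 r0" unfolding reach_def by simp
  from minv.intros(2)[OF this] have m: "minv r0 (Node st) [One, Base] 1 r0" by simp
  from assms(2) obtain \<beta> where c: "ctr Begin (Bot 1) k' \<beta>" "w' = \<beta>" "a' = 1" "r' = r0"
    using 1 by cases auto
  from c(1) show ?thesis by cases (use m c in auto)
next
  case (2 p N)
  from assms(2) obtain X \<beta> u where c: "ctr (Node p) X k' \<beta>" "unary N = X # u" "w' = \<beta> @ u" "a' = Suc a" "r' = r"
    using 2 by (cases; cases N) auto
  from c(1) show ?thesis
  proof cases
    case (pass b q)
    have "pre r0 (p, b, q) N r"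
      unfolding pre_def using pass 2 by (cases b) auto
    then show ?thesis
      using minv.intros(5)[of r0 "(p, b, q)" N 0 0 r 0 2] edge_pos[of "(p, b, q)"] pass c 2
      by (simp add: age0_def numeral_2_eq_2)
  next
    case (fetch i t q)
    then show ?thesis using minv.intros(3)[of r0 p N r i t q] c 2 by (simp add: numeral_2_eq_2)
  next
    case halt
    then show ?thesis using minv.intros(9)[of r0 N r N] c 2 by simp
  qed
next
  case (3 p N i t q)
  have i: "i \<in> {1..n}" using E_ok[of p "Recv i t" q] 3 by simp
  from assms(2) 3 consider t' v where "fire i t' (r i) v" "w' = Tok t' # unary N" "a' = 2" "r' = r(i := v)" "k' = k" |
    "w' = Idle # unary N" "k' = k" | x where "w' = Bot x # unary N" "k' = k"
    using i by (auto elim!: mstep.cases ctr.cases)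
  then show ?thesis
  proof cases
    case (1 t' v)
    then have "(r, r') \<in> W i t'" unfolding W_def by blast
    with 1 3 minv.intros(4) show ?thesis by simp
  next
    case 2
    then show ?thesis using 3 minv.intros(10)[of k' Idle] by simp
  next
    case (3 x)
    then show ?thesis using \<open>k = Fetch (p, Recv i t, q)\<close> minv.intros(10)[of k' "Bot x"] by simp
  qed
next
  case (4 p N r1 i t q t')
  from assms(2) 4 have s: "t' = t" "k' = Pass (p, Recv i t, q) 0 0" "w' = unary N" "a' = 3" "r' = r"
    by (auto elim!: mstep.cases ctr.cases)
  have "pre r0 (p, Recv i t, q) N r" using 4 s(1) unfolding pre_def by auto
  then show ?thesis using minv.intros(5)[of r0 "(p, Recv i t, q)" N 0 0 r 0 3] s by (simp add: age0_def)
next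
  case (5 e k0 q rs v)
  let ?v = "divisor (atom_of e)" and ?u = "multiplier (atom_of e)"
  have e: "e \<in> E" using 5 by (simp add: pre_def)
  note pos = edge_pos[OF e]
  have le: "?v \<le> ?u * L" using divisor_le[OF e] pos(2) by (metis le_trans mult_le_mono1 nat_mult_1 Suc_leI One_nat_def)
  from assms(2) obtain X \<beta> w1 where c: "ctr (Pass e rs v) X k' \<beta>" "unary k0 = X # w1" "w' = \<beta> @ w1" "a' = Suc a" "r' = r"
    using 5 by (cases; cases k0) auto
  from c(1) show ?thesis
  proof cases
    case pop
    from pop c(2) obtain k1 where k1: "k0 = Suc k1" "w1 = unary k1" by (auto simp: unary_Cons)
    show ?thesis
      using minv.intros(5)[of r0 e k1 q "Suc rs" r 0 a'] 5 pop k1 c by simp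
  next
    case last
    from last c(2) obtain k1 where k1: "k0 = Suc k1" "w1 = unary k1" by (auto simp: unary_Cons)
    \<comment> \<open>With its last symbol the block moves from the remainder into \<open>q\<close>.
      The waiting time is a difference of natural numbers, and \<open>le\<close> ensures that it is
      not cut off at 0.\<close>
    have eq: "k1 + ?v * Suc q + 0 = k0 + ?v * q + rs" using k1 last by simp
    have p: "pre r0 e (k1 + ?v * Suc q + 0) r" unfolding eq by (rule 5)
    have "a' = age0 (atom_of e) + q * ?u * L + ?v" using 5 last c(4) by simp
    then have "a' + (?u * L - ?v) = age0 (atom_of e) + Suc q * ?u * L + 0"
      using le by (simp add: add_mult_distrib)
    from minv.intros(5)[OF p pos(1) _ this] show ?thesis
      using last k1 c by simp
  next
    case (wait v')
    then show ?thesis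
      using minv.intros(5)[of r0 e k0 q rs r v' a'] 5 c by simp
  next
    case drain
    then have "k0 = 0" "w1 = []" using c(2) by (auto simp: unary_Cons)
    \<comment> \<open>The leftover symbols took \<open>rs\<close> steps to remove; together with the
      waiting each is worth one period, which puts the remainder back into the number.\<close>
    moreover have "rs + (L - 1) * rs = rs * L" using L_ge by (cases L) auto
    ultimately show ?thesis
      using minv.intros(6)[of r0 e q rs r a' "(L - 1) * rs"] 5 drain c by simp
  qed
next
  case (6 e q rs v)
  from assms(2) obtain \<beta> where c: "ctr (Drain e v) Base k' \<beta>" "w' = \<beta>" "a' = Suc a" "r' = r"
    using 6 by cases auto
  from c(1) show ?thesis
  proof cases
    case (drain_wait v')
    then show ?thesis using minv.intros(6)[of r0 e q rs r a' v'] 6 c by simp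
  next
    case reload
    then show ?thesis using minv.intros(7)[of r0 e q rs r a'] 6 c by (simp add: algebra_simps)
  qed
next
  case (7 e q rs)
  let ?N = "multiplier (atom_of e) * q + rs"
  \<comment> \<open>The overhead is below one period and vanishes in the division.\<close>
  have d: "(age0 (atom_of e) + 1 + ?N * L) div L = ?N"
  proof -
    have "(x + ?N * L) div L = ?N" if "x < L" for x
      using that by simp
    from this[of "age0 (atom_of e) + 1"] show ?thesis using L_ge by (simp add: age0_def)
  qed
  from assms(2) 7 consider "w' = unary ((age0 (atom_of e) + 1 + ?N * L) div L)" "a' = 0" "r' = r" "k' = k" |
    "w' = [Idle]" "k' = k" | x where "w' = [Bot x]" "k' = k"
    by (auto elim!: mstep.cases ctr.cases simp: fire_def)
  then show ?thesis
  proof cases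
    case 1
    have "reach r0 (snd (snd e)) ?N r" using pre_reach[of r0 e q rs r] 7 by simp
    from minv.intros(8)[OF this] show ?thesis using 1 7 d by simp
  next
    case 2
    then show ?thesis using 7 minv.intros(10)[of k' Idle] by simp
  next
    case (3 x)
    then show ?thesis using \<open>k = Reload e\<close> minv.intros(10)[of k' "Bot x"] by simp
  qed
next
  case (8 e N)
  from assms(2) obtain X \<beta> u where c: "ctr (Reload e) X k' \<beta>" "unary N = X # u" "w' = \<beta> @ u" "a' = Suc a" "r' = r"
    using 8 by (cases; cases N) auto
  from c(1) show ?thesis
    by cases (use c 8 minv.intros(2)[of r0 _ N r] in auto)
next
  case (9 N M)
  from assms(2) obtain X \<beta> u where c: "ctr Halt X k' \<beta>" "unary M = X # u" "w' = \<beta> @ u" "a' = Suc a" "r' = r"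
    using 9 by (cases; cases M) auto
  from c(1) show ?thesis
    by cases (use c 9 minv.intros(9)[of r0 N r M] in auto)
next
  case 10
  then show ?thesis using assms(2) by (auto elim!: mstep.cases ctr.cases)
qed

text \<open>At age 0 the phase is left over from before the reset. The first step only turns the
  initial symbol into \<open>Base\<close>, so counting is by \<open>a - 1\<close>.\<close>

definition clk :: "(('s \<times> nat) \<times> bool, 'v, 'g + nat) config \<Rightarrow> nat \<Rightarrow> bool" where
  "clk c a \<longleftrightarrow> (\<exists>m f. cst c (n + 2) = ((s0, m), f) \<and>
    (a = 0 \<and> m \<le> L \<and> cstk c (n + 2) = [G (Bot (n + 2))] \<or>
     a \<noteq> 0 \<and> m = Suc ((a - 1) mod L) \<and> cstk c (n + 2) = map G (unary ((a - 1) div L))))"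

text \<open>\<open>u\<close> is what the reader stands for, not what it holds: while a token is on
  offer the reader is already past the transition, and \<open>u\<close> is still the situation
  before it.\<close>

definition rd :: "(('s \<times> nat) \<times> bool, 'v, 'g + nat) config \<Rightarrow> nat \<Rightarrow> 's \<times> 'v list \<Rightarrow> bool" where
  "rd c i u \<longleftrightarrow> (\<exists>s m f. cst c (Suc i) = ((s, m), f) \<and>
    (m = 1 \<and> cstk c (Suc i) = [G Idle] \<and> u = (s, cin c (Suc i)) \<or>
     m \<le> 2 \<and> cstk c (Suc i) = [G (Bot (Suc i))] \<and> u = (s, cin c (Suc i)) \<or>
     m = 2 \<and> (\<exists>t. cstk c (Suc i) = [G (Tok t)] \<and> fire i t u (s, cin c (Suc i)))))"

definition desc :: "(('s \<times> nat) \<times> bool, 'v, 'g + nat) config \<Rightarrow> ctrl \<Rightarrow> sym list \<Rightarrow> nat \<Rightarrow> (nat \<Rightarrow> 's \<times> 'v list) \<Rightarrow> bool" where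
  "desc c k w a r \<longleftrightarrow> cst c 1 = cq k \<and> cstk c 1 = map G w \<and> clk c a \<and> (\<forall>i\<in>{1..n}. rd c i (r i))"

section \<open>Steps of the simulating system as controller steps\<close>

lemma clk_ord_step:
  assumes "ord_step B c c'" "clk c a"
  shows "clk c' (Suc a)"
proof -
  have "n + 2 \<in> {1..n + 2}" by simp
  from local_stepE[OF assms(1) this] obtain X w o' \<beta> where *: "cstk c (n + 2) = G X # w" "X \<in> syms"
    "\<forall>j\<in>{2..n + 2}. X \<noteq> Qs j" "o' \<in> insert None (Some ` inp A)" "tr (n + 2) (cst c (n + 2)) o' X (cst c' (n + 2)) \<beta>"
    "cin c (n + 2) = opt_word o' @ cin c' (n + 2)" "cstk c' (n + 2) = map G \<beta> @ w" .
  from *(5) have t: "clock_tr (cst c (n + 2)) X (cst c' (n + 2)) \<beta>" by (simp add: tr_def)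
  from assms(2) obtain m f where m: "cst c (n + 2) = ((s0, m), f)"
    "a = 0 \<and> m \<le> L \<and> cstk c (n + 2) = [G (Bot (n + 2))] \<or>
     a \<noteq> 0 \<and> m = Suc ((a - 1) mod L) \<and> cstk c (n + 2) = map G (unary ((a - 1) div L))"
    unfolding clk_def by blast
  have L: "0 < L" using L_ge by simp
  show ?thesis
  proof (cases a)
    case 0
    then show ?thesis using m t * unfolding clock_tr_def clk_def by auto
  next
    case (Suc b)
    with m have m: "cst c (n + 2) = ((s0, Suc (b mod L)), f)" "cstk c (n + 2) = map G (unary (b div L))" by auto
    from m(2) *(1) obtain w' where w': "unary (b div L) = X # w'" "w = map G w'" by auto
    then have X: "X \<in> {One, Base}" by (auto simp: unary_Cons)
    show ?thesis
    proof (cases "Suc (b mod L) = L")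
      case True
      with t m X have "cst c' (n + 2) = ((s0, 1), False)" "\<beta> = [One, X]" unfolding clock_tr_def by auto
      moreover have "Suc b mod L = 0" "Suc b div L = Suc (b div L)" using True by (simp_all add: mod_Suc div_Suc)
      ultimately show ?thesis using *(7) w' Suc unfolding clk_def by auto
    next
      case False
      with t m X have "cst c' (n + 2) = ((s0, Suc (Suc (b mod L))), False)" "\<beta> = [X]" unfolding clock_tr_def by auto
      moreover have "Suc b mod L = Suc (b mod L)" "Suc b div L = b div L" using False by (simp_all add: mod_Suc div_Suc)
      ultimately show ?thesis using *(7) w' Suc unfolding clk_def by auto
    qed
  qed
qed

text \<open>A commitment changes the reader but not what it stands for. A transition takes effect
  only when its token is fetched.\<close>

lemma rd_ord_step:
  assumes "ord_step B c c'" "rd c i u" "i \<in> {1..n}"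
  shows "rd c' i u"
proof -
  have "Suc i \<in> {1..n + 2}" using assms(3) by simp
  from local_stepE[OF assms(1) this] obtain X w o' \<beta> where *: "cstk c (Suc i) = G X # w" "X \<in> syms"
    "\<forall>j\<in>{2..n + 2}. X \<noteq> Qs j" "o' \<in> insert None (Some ` inp A)" "tr (Suc i) (cst c (Suc i)) o' X (cst c' (Suc i)) \<beta>"
    "cin c (Suc i) = opt_word o' @ cin c' (Suc i)" "cstk c' (Suc i) = map G \<beta> @ w" .
  from *(5) assms(3) have t: "reader_tr i (cst c (Suc i)) o' X (cst c' (Suc i)) \<beta>" by (simp add: tr_def split: if_splits)
  from assms(2) obtain s m f where m: "cst c (Suc i) = ((s, m), f)"
    "m = 1 \<and> cstk c (Suc i) = [G Idle] \<and> u = (s, cin c (Suc i)) \<or>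
     m \<le> 2 \<and> cstk c (Suc i) = [G (Bot (Suc i))] \<and> u = (s, cin c (Suc i)) \<or>
     m = 2 \<and> (\<exists>t. cstk c (Suc i) = [G (Tok t)] \<and> fire i t u (s, cin c (Suc i)))"
    unfolding rd_def by blast
  from m(2) *(1) have w: "w = []" by auto
  from t m(1) consider "o' = None" "X = Bot (Suc i)" "cst c' (Suc i) = ((s, 1), m \<noteq> 0)" "\<beta> = [Idle]" |
    "o' = None" "X = Idle" "cst c' (Suc i) = ((s, 1), False)" "\<beta> = [Idle]" |
    p t where "X = Idle" "t < length toks" "(p, snd (toks ! t)) \<in> trans (comp A i) s o' (fst (toks ! t))"
      "cst c' (Suc i) = ((p, 2), False)" "\<beta> = [Tok t]" |
    t where "o' = None" "X = Tok t" "cst c' (Suc i) = ((s, 2), False)" "\<beta> = [Tok t]"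
    unfolding reader_tr_def by auto
  then show ?thesis
  proof cases
    case 1
    with m *(1) have "u = (s, cin c (Suc i))" by auto
    with 1 *(6,7) w show ?thesis unfolding rd_def by (auto simp: opt_word_def)
  next
    case 2
    with m *(1) have "u = (s, cin c (Suc i))" by auto
    with 2 *(6,7) w show ?thesis unfolding rd_def by (auto simp: opt_word_def)
  next
    case (3 p t)
    with m *(1) have u: "u = (s, cin c (Suc i))" by auto
    have "fire i t u (p, cin c' (Suc i))"
      unfolding fire_def u using 3 assms(3) *(6) by auto
    with 3 *(7) w show ?thesis unfolding rd_def by auto
  next
    case (4 t)
    with m *(1) have "fire i t u (s, cin c (Suc i))" by auto
    with 4 *(6,7) w show ?thesis unfolding rd_def by (auto simp: opt_word_def)
  qed
qed

lemma desc_ord_step: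
  assumes "desc c k w a r" "ord_step B c c'"
  shows "\<exists>k' w' a' r'. mstep k w a r k' w' a' r' \<and> desc c' k' w' a' r'"
proof -
  have "1 \<in> {1..n + 2}" by simp
  from local_stepE[OF assms(2) this] obtain X u o' \<beta> where *: "cstk c 1 = G X # u" "X \<in> syms"
    "\<forall>j\<in>{2..n + 2}. X \<noteq> Qs j" "o' \<in> insert None (Some ` inp A)" "tr 1 (cst c 1) o' X (cst c' 1) \<beta>"
    "cin c 1 = opt_word o' @ cin c' 1" "cstk c' 1 = map G \<beta> @ u" .
  from assms(1) have d: "cst c 1 = cq k" "cstk c 1 = map G w" "clk c a" "\<And>i. i \<in> {1..n} \<Longrightarrow> rd c i (r i)"
    unfolding desc_def by auto
  from d(2) *(1) obtain w' where w': "w = X # w'" "u = map G w'" by auto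
  from *(5) d(1) obtain k' where k': "cst c' 1 = cq k'" "ctr k X k' \<beta>"
    by (auto simp: tr_def)
  have "desc c' k' (\<beta> @ w') (Suc a) r"
    unfolding desc_def using k'(1) *(7) w'(2) clk_ord_step[OF assms(2) d(3)] rd_ord_step[OF assms(2) d(4)] by auto
  moreover have "mstep k w a r k' (\<beta> @ w') (Suc a) r"
    unfolding w'(1) by (rule mstep.ord[OF k'(2)])
  ultimately show ?thesis by blast
qed

lemma desc_com_step:
  assumes "desc c k w a r" "quiet c" "com_step B c c'"
  shows "\<exists>k' w' a' r'. mstep k w a r k' w' a' r' \<and> desc c' k' w' a' r'"
proof -
  from assms(3) obtain j u where j: "j \<in> {2..n + 2}" "cstk c 1 = G (Qs j) # u"
    "c' = setstk (setstk c 1 (cstk c j @ u)) j [G (Bot j)]"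
    unfolding com_step_B[OF assms(2)] by blast
  from assms(1) have d: "cst c 1 = cq k" "cstk c 1 = map G w" "clk c a" "\<And>i. i \<in> {1..n} \<Longrightarrow> rd c i (r i)"
    unfolding desc_def by auto
  from d(2) j(2) obtain w' where w': "w = Qs j # w'" "u = map G w'" by auto
  have c': "cst c' = cst c" "cin c' = cin c" "cstk c' = (cstk c)(1 := cstk c j @ u, j := [G (Bot j)])"
    unfolding j(3) by simp_all
  have rd': "rd c' i v" if "rd c i v" "Suc i \<noteq> j" "i \<noteq> 0" for i v
    using that unfolding rd_def c' by simp
  show ?thesis
  proof (cases "j = n + 2")
    case True
    from d(3) obtain m f where m: "cst c (n + 2) = ((s0, m), f)"
      "a = 0 \<and> m \<le> L \<and> cstk c (n + 2) = [G (Bot (n + 2))] \<or>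
       a \<noteq> 0 \<and> m = Suc ((a - 1) mod L) \<and> cstk c (n + 2) = map G (unary ((a - 1) div L))"
      unfolding clk_def by blast
    have "(a - Suc 0) mod L < L" using L_ge by simp
    then have "m \<le> L" using m(2) by auto
    then have clk: "clk c' 0" unfolding clk_def c' using m(1) True by auto
    have rds: "rd c' i (r i)" if "i \<in> {1..n}" for i using rd'[OF d(4)[OF that]] that True by auto
    from m(2) show ?thesis
    proof
      assume a: "a = 0 \<and> m \<le> L \<and> cstk c (n + 2) = [G (Bot (n + 2))]"
      then have "desc c' k (Bot (n + 2) # w') a r"
        unfolding desc_def using d(1) clk rds True w' by (auto simp: c')
      moreover have "mstep k w a r k (Bot (n + 2) # w') a r" unfolding w' by (rule mstep.stuck) simp
      ultimately show ?thesis by blast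
    next
      assume a: "a \<noteq> 0 \<and> m = Suc ((a - 1) mod L) \<and> cstk c (n + 2) = map G (unary ((a - 1) div L))"
      then obtain b where b: "a = Suc b" by (cases a) auto
      have "desc c' k (unary (b div L) @ w') 0 r"
        unfolding desc_def using a b d(1) clk rds True w' by (auto simp: c')
      moreover have "mstep k w a r k (unary (b div L) @ w') 0 r"
        unfolding w' b True by (rule mstep.clock)
      ultimately show ?thesis by blast
    qed
  next
    case False
    obtain i where i: "j = Suc i" "i \<in> {1..n}" using j(1) False by (cases j) auto
    have clk: "clk c' a" using d(3) False i unfolding clk_def c' by auto
    from d(4)[OF i(2)] obtain s m f where m: "cst c (Suc i) = ((s, m), f)"
      "m = 1 \<and> cstk c (Suc i) = [G Idle] \<and> r i = (s, cin c (Suc i)) \<or>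
       m \<le> 2 \<and> cstk c (Suc i) = [G (Bot (Suc i))] \<and> r i = (s, cin c (Suc i)) \<or>
       m = 2 \<and> (\<exists>t. cstk c (Suc i) = [G (Tok t)] \<and> fire i t (r i) (s, cin c (Suc i)))"
      unfolding rd_def by blast
    let ?v = "(s, cin c (Suc i))"
    have "m \<le> 2" using m(2) by auto
    then have "rd c' i ?v" unfolding rd_def c' using m(1) i by auto
    then have rds: "rd c' i' ((r(i := ?v)) i')" if "i' \<in> {1..n}" for i'
      using rd'[OF d(4)[OF that]] that i(1) by (cases "i' = i") auto
    from m(2) consider X where "X \<in> insert Idle (range Bot)" "cstk c (Suc i) = [G X]" "r i = ?v" |
      t where "cstk c (Suc i) = [G (Tok t)]" "fire i t (r i) ?v" by blast
    then show ?thesis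
    proof cases
      case (1 X)
      then have r: "r(i := ?v) = r" by auto
      have "desc c' k (X # w') a r"
        unfolding desc_def using d(1) clk rds[unfolded r] i 1(2) w' by (auto simp: c')
      moreover have "mstep k w a r k (X # w') a r" unfolding w' by (rule mstep.stuck[OF 1(1)])
      ultimately show ?thesis by blast
    next
      case (2 t)
      have "desc c' k (Tok t # w') a (r(i := ?v))"
        unfolding desc_def using d(1) clk rds i 2(1) w' by (auto simp: c')
      moreover have "mstep k w a r k (Tok t # w') a (r(i := ?v))"
        unfolding w' i(1) using 2(2) by (rule mstep.recv)
      ultimately show ?thesis by blast
    qed
  qed
qed

lemma desc_init: "desc (init_cfg B x) Begin [Bot 1] 0 (proj (init_cfg A x))"
  unfolding desc_def clk_def rd_def
  by (auto simp: init_cfg_def cst_def cin_def cstk_def proj_def)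

lemma run_inv:
  assumes "(step B)\<^sup>*\<^sup>* (init_cfg B x) c"
  shows "cinv c \<and> (\<exists>k w a r. minv (proj (init_cfg A x)) k w a r \<and> desc c k w a r)"
  using assms
proof (induction rule: rtranclp_induct)
  case base
  show ?case using cinv_init[of x] desc_init[of x] minv.intros(1)[of "proj (init_cfg A x)"] by blast
next
  case (step c c')
  then obtain k w a r where i: "cinv c" "minv (proj (init_cfg A x)) k w a r" "desc c k w a r" by blast
  have q: "quiet c" using i(1) by (simp add: cinv_def)
  have "cinv c'" using step(2) cinv_ord_step[OF i(1)] cinv_com_step(1)[OF i(1)] unfolding step_def by blast
  moreover have "\<exists>k' w' a' r'. mstep k w a r k' w' a' r' \<and> desc c' k' w' a' r'"
    using step(2) desc_ord_step[OF i(3)] desc_com_step[OF i(3) q] unfolding step_def by blast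
  ultimately show ?case using minv_step[OF i(2)] by blast
qed

lemma lang_sound:
  assumes "x \<in> lang_r B"
  shows "\<exists>N r. reach (proj (init_cfg A x)) h N r \<and> accepting r"
proof -
  from assms obtain c where c: "(step B)\<^sup>*\<^sup>* (init_cfg B x) c"
    "\<And>i. i \<in> {1..n + 2} \<Longrightarrow> cin c i = [] \<and> cst c i \<in> finals (comp B i)"
    unfolding lang_r_def by auto
  from run_inv[OF c(1)] obtain k w a r where i: "minv (proj (init_cfg A x)) k w a r" "desc c k w a r" by blast
  have "cst c 1 = cq Halt" using c(2)[of 1] by simp
  with i(2) have k: "k = Halt" unfolding desc_def by simp
  from i(1) obtain N where "reach (proj (init_cfg A x)) h N r"
    unfolding k by cases auto
  moreover have "snd (r i) = [] \<and> fst (r i) \<in> finals (comp A i)" if i': "i \<in> {1..n}" for i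
  proof -
    have "cin c (Suc i) = []" "cst c (Suc i) \<in> finals (comp B (Suc i))" using c(2)[of "Suc i"] i' by auto
    then obtain s f where s: "cst c (Suc i) = ((s, 1), f)" "s \<in> finals (comp A i)" "cin c (Suc i) = []"
      using i' by (auto split: if_splits)
    from i(2) i' have "rd c i (r i)" unfolding desc_def by blast
    \<comment> \<open>Mode 1 rules out the token case of \<open>rd\<close>, so \<open>r i\<close> is
      the state and input that the reader really has.\<close>
    with s show ?thesis unfolding rd_def by auto
  qed
  ultimately show ?thesis unfolding accepting_def by blast
qed

subsection \<open>Completeness\<close>

text \<open>There is no token case, because in the runs built here a reader commits only in the step
  in which its token is requested. \<open>b\<close> tells whether a reader may still show its
  initial symbol; \<open>local_step_load\<close> needs an idle one.\<close>

definition rdy :: "bool \<Rightarrow> (('s \<times> nat) \<times> bool, 'v, 'g + nat) config \<Rightarrow> nat \<Rightarrow> 's \<times> 'v list \<Rightarrow> bool" where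
  "rdy b c i u \<longleftrightarrow> (\<exists>s m f. cst c (Suc i) = ((s, m), f) \<and> u = (s, cin c (Suc i)) \<and> s \<in> states (comp A i) \<and>
    (m = 1 \<and> cstk c (Suc i) = [G Idle] \<or> b \<and> m \<le> 2 \<and> cstk c (Suc i) = [G (Bot (Suc i))]))"

definition cdesc :: "bool \<Rightarrow> 'v list \<Rightarrow> (('s \<times> nat) \<times> bool, 'v, 'g + nat) config \<Rightarrow>
    ctrl \<Rightarrow> sym list \<Rightarrow> nat \<Rightarrow> (nat \<Rightarrow> 's \<times> 'v list) \<Rightarrow> bool" where
  "cdesc b x c k w a r \<longleftrightarrow> cinv c \<and> cst c 1 = cq k \<and> ctrl_ok k \<and> cstk c 1 = map G w \<and> clk c a \<and>
     cin c 1 = x \<and> cin c (n + 2) = x \<and> (\<forall>i\<in>{1..n}. rdy b c i (r i))"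

section \<open>Steps with prescribed behaviour\<close>

lemma local_step_clock:
  assumes "clk c a" "cin c (n + 2) = opt_word o' @ x" "o' \<in> insert None (Some ` inp A)"
  shows "\<exists>v. local_step (n + 2) (c (n + 2)) v \<and> fst (snd v) = x"
proof -
  from assms(1) obtain m f where m: "cst c (n + 2) = ((s0, m), f)"
    "a = 0 \<and> m \<le> L \<and> cstk c (n + 2) = [G (Bot (n + 2))] \<or>
     a \<noteq> 0 \<and> m = Suc ((a - 1) mod L) \<and> cstk c (n + 2) = map G (unary ((a - 1) div L))"
    unfolding clk_def by blast
  obtain X w q' \<beta> where X: "cstk c (n + 2) = G X # w" "X \<in> syms" "\<forall>j. X \<noteq> Qs j" "clock_tr ((s0, m), f) X q' \<beta>"
  proof (cases "a = 0")
    case True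
    show thesis
      by (rule that[of "Bot (n + 2)" "[]" "((s0, 1), m \<noteq> 0)" "[Base]"])
        (use m True in \<open>auto simp: syms_def clock_tr_def\<close>)
  next
    case False
    with m have a: "m = Suc ((a - 1) mod L)" "cstk c (n + 2) = map G (unary ((a - 1) div L))" by auto
    obtain X u where u: "unary ((a - 1) div L) = X # u" "X \<in> {One, Base}"
      by (cases "(a - 1) div L") auto
    have "(a - 1) mod L < L" using L_ge by simp
    then have "m < L \<or> m = L" "1 \<le> m" using a(1) by auto
    then obtain q' \<beta> where "clock_tr ((s0, m), f) X q' \<beta>" using u(2) unfolding clock_tr_def by blast
    with that[of X "map G u" q' \<beta>] u a(2) show thesis by (auto simp: syms_def)
  qed
  from X(4) have "tr (n + 2) (cst c (n + 2)) o' X q' \<beta>" unfolding m(1) by (simp add: tr_def)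
  with X assms(2,3) show ?thesis
    unfolding local_step_def cst_def[symmetric] cin_def[symmetric] cstk_def[symmetric]
    by (intro exI[of _ "(q', x, map G \<beta> @ w)"]) auto
qed

lemma local_step_idle:
  assumes "rdy b c i u" "i \<in> {1..n}"
  shows "\<exists>f. local_step (Suc i) (c (Suc i)) (((fst u, 1), f), snd u, [G Idle])"
proof -
  from assms(1) obtain s m f where s: "cst c (Suc i) = ((s, m), f)" "u = (s, cin c (Suc i))" "s \<in> states (comp A i)"
    "m = 1 \<and> cstk c (Suc i) = [G Idle] \<or> b \<and> m \<le> 2 \<and> cstk c (Suc i) = [G (Bot (Suc i))]"
    unfolding rdy_def by blast
  then obtain X f' where X: "cstk c (Suc i) = [G X]" "X \<in> syms" "\<forall>j. X \<noteq> Qs j"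
    "reader_tr i ((s, m), f) None X ((s, 1), f') [Idle]"
    using assms(2) unfolding reader_tr_def syms_def by auto
  then have "tr (Suc i) (cst c (Suc i)) None X ((s, 1), f') [Idle]"
    using assms(2) s(1) by (simp add: tr_def)
  with X s show ?thesis
    unfolding local_step_def cst_def[symmetric] cin_def[symmetric] cstk_def[symmetric]
    by (intro exI[of _ f'] exI[of _ X] exI[of _ "[]"] exI[of _ None] exI[of _ "[Idle]"]) (auto simp: opt_word_def)
qed

lemma local_step_load:
  assumes "rdy False c i u" "i \<in> {1..n}" "fire i t u v"
  shows "local_step (Suc i) (c (Suc i)) (((fst v, 2), False), snd v, [G (Tok t)])"
proof -
  from assms(1) obtain s f where s: "cst c (Suc i) = ((s, 1), f)" "u = (s, cin c (Suc i))" "s \<in> states (comp A i)"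
    "cstk c (Suc i) = [G Idle]"
    unfolding rdy_def by blast
  from assms(3) obtain o' where o: "t < length toks" "(fst v, snd (toks ! t)) \<in> trans (comp A i) s o' (fst (toks ! t))"
    "cin c (Suc i) = opt_word o' @ snd v"
    unfolding fire_def s(2) by auto
  have "o' \<in> insert None (Some ` inp A)" using trans_wf(3)[OF assms(2) o(2)] .
  moreover have "tr (Suc i) (cst c (Suc i)) o' Idle ((fst v, 2), False) [Tok t]"
    using assms(2) s(1,3) o unfolding tr_def reader_tr_def by auto
  ultimately show ?thesis
    unfolding local_step_def cst_def[symmetric] cin_def[symmetric] cstk_def[symmetric]
    using s(4) o(3) by (intro exI[of _ Idle] exI[of _ "[]"] exI[of _ o'] exI[of _ "[Tok t]"]) (auto simp: syms_def)
qed

text \<open>The successors \<open>P\<close> of the readers are a parameter because a reader may idle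
  or commit. Controller and clock read the same \<open>o'\<close>, so that their inputs stay
  equal.\<close>

lemma ord_lift:
  assumes "cdesc b y c k (X # w) a r" "y = opt_word o' @ x" "o' \<in> insert None (Some ` inp A)"
    "ctr k X k' \<beta>" "X \<in> syms" "X \<notin> range Qs"
    "\<And>i. i \<in> {1..n} \<Longrightarrow> local_step (Suc i) (c (Suc i)) (P i)"
  shows "\<exists>c'. ord_step B c c' \<and> cinv c' \<and> cst c' 1 = cq k' \<and> ctrl_ok k' \<and> cstk c' 1 = map G (\<beta> @ w) \<and>
    clk c' (Suc a) \<and> cin c' 1 = x \<and> cin c' (n + 2) = x \<and> (\<forall>i\<in>{1..n}. c' (Suc i) = P i)"
proof -
  from assms(1) have d: "cinv c" "cst c 1 = cq k" "ctrl_ok k" "cstk c 1 = map G (X # w)" "clk c a" "cin c 1 = y"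
    "cin c (n + 2) = y" unfolding cdesc_def by auto
  from local_step_clock[OF d(5) d(7)[unfolded assms(2)] assms(3)]
  obtain v where v: "local_step (n + 2) (c (n + 2)) v" "fst (snd v) = x" by blast
  have "tr 1 (cst c 1) o' X (cq k') \<beta>" unfolding tr_def d(2) using d(3) assms(4) by auto
  then have l1: "local_step 1 (c 1) (cq k', x, map G (\<beta> @ w))"
    unfolding local_step_def cst_def[symmetric] cin_def[symmetric] cstk_def[symmetric]
    using d(4,6) assms(2,3,5,6)
    by (intro exI[of _ X] exI[of _ "map G w"] exI[of _ o'] exI[of _ \<beta>]) auto
  define c' where "c' i = (if i = 1 then (cq k', x, map G (\<beta> @ w)) else if i = n + 2 then v
    else if i \<in> {2..n + 1} then P (i - 1) else c i)" for i
  have "local_step i (c i) (c' i)" if i: "i \<in> {1..n + 2}" for i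
  proof -
    obtain j where j: "i = Suc j" "j < n + 2" using i by (cases i) auto
    then consider "i = 1" | "i = n + 2" | j where "i = Suc j" "j \<in> {1..n}"
      by (cases "j = 0"; cases "j = Suc n") auto
    then show ?thesis
      by cases (use l1 v(1) assms(7) in \<open>auto simp: c'_def\<close>)
  qed
  then have o: "ord_step B c c'" unfolding ord_step_B by (auto simp: c'_def)
  moreover have "cinv c'" by (rule cinv_ord_step[OF d(1) o])
  moreover have "clk c' (Suc a)" by (rule clk_ord_step[OF o d(5)])
  moreover have "ctrl_ok k'" by (rule ctr_ok[OF assms(4) d(3)])
  moreover have "cst c' 1 = cq k'" "cstk c' 1 = map G (\<beta> @ w)" "cin c' 1 = x" "cin c' (n + 2) = x"
    "\<forall>i\<in>{1..n}. c' (Suc i) = P i"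
    using v(2) by (auto simp: c'_def cst_def cin_def cstk_def)
  ultimately show ?thesis by blast
qed

lemma step_ord:
  assumes "cdesc b y c k (X # w) a r" "y = opt_word o' @ x" "o' \<in> insert None (Some ` inp A)"
    "ctr k X k' \<beta>" "X \<in> syms" "X \<notin> range Qs"
  shows "\<exists>c'. step B c c' \<and> cdesc False x c' k' (\<beta> @ w) (Suc a) r"
proof -
  have rd: "rdy b c i (r i)" if "i \<in> {1..n}" for i using assms(1) that unfolding cdesc_def by blast
  have "\<forall>i. \<exists>f. i \<in> {1..n} \<longrightarrow> local_step (Suc i) (c (Suc i)) (((fst (r i), 1), f), snd (r i), [G Idle])"
    using local_step_idle[OF rd] by blast
  then obtain f where f: "\<And>i. i \<in> {1..n} \<Longrightarrow> local_step (Suc i) (c (Suc i)) (((fst (r i), 1), f i), snd (r i), [G Idle])"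
    by metis
  from ord_lift[OF assms, of "\<lambda>i. (((fst (r i), 1), f i), snd (r i), [G Idle])"] f
  obtain c' where c': "ord_step B c c'" "cinv c'" "cst c' 1 = cq k'" "ctrl_ok k'" "cstk c' 1 = map G (\<beta> @ w)"
    "clk c' (Suc a)" "cin c' 1 = x" "cin c' (n + 2) = x"
    "\<forall>i\<in>{1..n}. c' (Suc i) = (((fst (r i), 1), f i), snd (r i), [G Idle])" by blast
  have "rdy False c' i (r i)" if i: "i \<in> {1..n}" for i
  proof -
    have "fst (r i) \<in> states (comp A i)" using rd[OF i] unfolding rdy_def by auto
    then show ?thesis using c'(9) i by (auto simp: rdy_def cst_def cin_def cstk_def)
  qed
  then have "cdesc False x c' k' (\<beta> @ w) (Suc a) r" unfolding cdesc_def using c'(2-8) by blast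
  with c'(1) show ?thesis unfolding step_def by blast
qed

lemma step_clock:
  assumes "cdesc b x c k (Qs (n + 2) # w) (Suc a) r"
  shows "\<exists>c'. step B c c' \<and> cdesc b x c' k (unary (a div L) @ w) 0 r"
proof -
  from assms have d: "cinv c" "cst c 1 = cq k" "ctrl_ok k" "cstk c 1 = map G (Qs (n + 2) # w)" "clk c (Suc a)" "cin c 1 = x"
    "cin c (n + 2) = x" "\<And>i. i \<in> {1..n} \<Longrightarrow> rdy b c i (r i)" unfolding cdesc_def by auto
  from d(5) obtain m f where m: "cst c (n + 2) = ((s0, m), f)"
    "m = Suc (a mod L)" "cstk c (n + 2) = map G (unary (a div L))" unfolding clk_def by auto
  have "a mod L < L" using L_ge by simp
  then have "m \<le> L" using m(2) by simp
  let ?c = "setstk (setstk c 1 (cstk c (n + 2) @ map G w)) (n + 2) [G (Bot (n + 2))]"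
  have q: "quiet c" using d(1) by (simp add: cinv_def)
  have s: "com_step B c ?c" unfolding com_step_B[OF q] using d(4) by (intro bexI[of _ "n + 2"]) auto
  have "rdy b ?c i (r i)" if "i \<in> {1..n}" for i
    using d(8)[OF that] that unfolding rdy_def by simp
  moreover have "clk ?c 0" unfolding clk_def using m(1) \<open>m \<le> L\<close> by simp
  ultimately have "cdesc b x ?c k (unary (a div L) @ w) 0 r"
    unfolding cdesc_def using cinv_com_step(1)[OF d(1) s] d(2,3,6,7) m(3) by simp
  with s show ?thesis unfolding step_def by blast
qed

text \<open>The reader commits in the same ordinary step in which the controller pushes its query,
  so the token is there when the communication follows.\<close>

lemma step_recv:
  assumes "cdesc False x c (Node p) (X # w) a r" "X \<in> {One, Base}" "(p, Recv i t, q) \<in> E" "fire i t' (r i) v"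
  shows "\<exists>c'. (step B)\<^sup>*\<^sup>* c c' \<and> cdesc True x c' (Fetch (p, Recv i t, q)) (Tok t' # X # w) (Suc a) (r(i := v))"
proof -
  have i: "i \<in> {1..n}" using E_ok[OF assms(3)] by simp
  have rd: "rdy False c i' (r i')" if "i' \<in> {1..n}" for i' using assms(1) that unfolding cdesc_def by blast
  have "\<forall>i. \<exists>f. i \<in> {1..n} \<longrightarrow> local_step (Suc i) (c (Suc i)) (((fst (r i), 1), f), snd (r i), [G Idle])"
    using local_step_idle[OF rd] by blast
  then obtain f where f: "\<And>i. i \<in> {1..n} \<Longrightarrow> local_step (Suc i) (c (Suc i)) (((fst (r i), 1), f i), snd (r i), [G Idle])"
    by metis
  let ?P = "\<lambda>i'. if i' = i then (((fst v, 2), False), snd v, [G (Tok t')]) else (((fst (r i'), 1), f i'), snd (r i'), [G Idle])"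
  have P: "local_step (Suc i') (c (Suc i')) (?P i')" if "i' \<in> {1..n}" for i'
    using f[OF that] local_step_load[OF rd[OF i] i assms(4)] by auto
  have ctr: "ctr (Node p) X (Fetch (p, Recv i t, q)) [Qs (Suc i), X]"
    using assms(2,3) by (intro ctr.fetch)
  have X: "X \<in> syms" "X \<notin> range Qs" using assms(2) by (auto simp: syms_def)
  have "x = opt_word None @ x" by (simp add: opt_word_def)
  from ord_lift[OF assms(1) this _ ctr X, of ?P] P
  obtain c1 where c1: "ord_step B c c1" "cinv c1" "cst c1 1 = cq (Fetch (p, Recv i t, q))" "ctrl_ok (Fetch (p, Recv i t, q))"
    "cstk c1 1 = map G ([Qs (Suc i), X] @ w)"
    "clk c1 (Suc a)" "cin c1 1 = x" "cin c1 (n + 2) = x" "\<forall>i'\<in>{1..n}. c1 (Suc i') = ?P i'" by blast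
  let ?c = "setstk (setstk c1 1 (cstk c1 (Suc i) @ map G (X # w))) (Suc i) [G (Bot (Suc i))]"
  have q: "quiet c1" using c1(2) by (simp add: cinv_def)
  have s: "com_step B c1 ?c" unfolding com_step_B[OF q] using c1(5) i by (intro bexI[of _ "Suc i"]) auto
  have ci: "cst c1 (Suc i) = ((fst v, 2), False)" "cin c1 (Suc i) = snd v" "cstk c1 (Suc i) = [G (Tok t')]"
    using c1(9) i by (auto simp: cst_def cin_def cstk_def)
  have v: "fst v \<in> states (comp A i)"
    using assms(4) trans_wf(4)[OF i] unfolding fire_def by blast
  have "rdy True ?c i' ((r(i := v)) i')" if i': "i' \<in> {1..n}" for i'
  proof (cases "i' = i")
    case True
    then show ?thesis using ci v i by (auto simp: rdy_def)
  next
    case False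
    have "fst (r i') \<in> states (comp A i')" using rd[OF i'] unfolding rdy_def by auto
    moreover have "cst c1 (Suc i') = ((fst (r i'), 1), f i')" "cin c1 (Suc i') = snd (r i')" "cstk c1 (Suc i') = [G Idle]"
      using c1(9) i' False by (auto simp: cst_def cin_def cstk_def)
    ultimately show ?thesis using False i' by (simp add: rdy_def prod_eq_iff)
  qed
  moreover have "clk ?c (Suc a)" using c1(6) i unfolding clk_def by simp
  ultimately have "cdesc True x ?c (Fetch (p, Recv i t, q)) (Tok t' # X # w) (Suc a) (r(i := v))"
    unfolding cdesc_def using cinv_com_step(1)[OF c1(2) s] c1(3,4,7,8) ci(3) i by simp
  moreover have "(step B)\<^sup>*\<^sup>* c ?c"
  proof (rule converse_rtranclp_into_rtranclp)
    show "step B c c1" using c1(1) by (simp add: step_def)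
    show "(step B)\<^sup>*\<^sup>* c1 ?c" using s by (intro r_into_rtranclp) (simp add: step_def)
  qed
  ultimately show ?thesis by blast
qed

text \<open>The quantification over all configurations that fit the description lets these
  statements be chained. Each ends with \<open>False\<close>, so only the first of a chain can start
  from readers that show their initial symbol.\<close>

definition go :: "bool \<Rightarrow> 'v list \<Rightarrow> ctrl \<Rightarrow> sym list \<Rightarrow> nat \<Rightarrow> (nat \<Rightarrow> 's \<times> 'v list) \<Rightarrow>
    ctrl \<Rightarrow> sym list \<Rightarrow> nat \<Rightarrow> (nat \<Rightarrow> 's \<times> 'v list) \<Rightarrow> bool" where
  "go b x k w a r k' w' a' r' \<longleftrightarrow> (\<forall>c. cdesc b x c k w a r \<longrightarrow>
     (\<exists>c'. (step B)\<^sup>*\<^sup>* c c' \<and> cdesc False x c' k' w' a' r'))"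

lemma go_refl: "go False x k w a r k w a r"
  unfolding go_def by blast

lemma go_trans:
  assumes "go b x k w a r k1 w1 a1 r1" "go False x k1 w1 a1 r1 k2 w2 a2 r2"
  shows "go b x k w a r k2 w2 a2 r2"
  using assms unfolding go_def by (meson rtranclp_trans)

lemma go_ord:
  assumes "ctr k X k' \<beta>" "X \<in> syms" "X \<notin> range Qs" "w' = \<beta> @ w"
  shows "go b x k (X # w) a r k' w' (Suc a) r"
  unfolding go_def assms(4)
proof (intro allI impI)
  fix c assume "cdesc b x c k (X # w) a r"
  from step_ord[OF this _ _ assms(1-3), of None x]
  show "\<exists>c'. (step B)\<^sup>*\<^sup>* c c' \<and> cdesc False x c' k' (\<beta> @ w) (Suc a) r"
    by (auto simp: opt_word_def)
qed

lemma unary_syms: "X \<in> {One, Base} \<Longrightarrow> X \<in> syms \<and> X \<notin> range Qs"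
  by (auto simp: syms_def)

lemma go_wait:
  assumes "X \<in> {One, Base}"
  shows "go False x (Pass e rs w) (X # u) a r (Pass e rs 0) (X # u) (a + w) r"
proof (induction w arbitrary: a)
  case 0
  show ?case by (simp add: go_refl)
next
  case (Suc w)
  have "go False x (Pass e rs (Suc w)) (X # u) a r (Pass e rs w) (X # u) (Suc a) r"
    using unary_syms[OF assms] by (intro go_ord[OF ctr.wait[OF assms]]) auto
  from go_trans[OF this Suc] show ?case by simp
qed

lemma go_drain: "go False x (Drain e w) [Base] a r (Drain e 0) [Base] (a + w) r"
proof (induction w arbitrary: a)
  case 0
  show ?case by (simp add: go_refl)
next
  case (Suc w)
  have "go False x (Drain e (Suc w)) [Base] a r (Drain e w) [Base] (Suc a) r"
    using unary_syms[of Base] by (intro go_ord[OF ctr.drain_wait]) auto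
  from go_trans[OF this Suc] show ?case by simp
qed

text \<open>Finished blocks, remainder and owed time are generalized so that the induction on the
  remaining symbols goes through. The final age depends on the instruction and on \<open>N\<close>
  alone, with one period for each unit of the new number.\<close>

lemma go_pass:
  assumes "e \<in> E" "residue_ok (atom_of e) (N mod divisor (atom_of e))"
    and "k + divisor (atom_of e) * q + rs = N" "rs < divisor (atom_of e)"
    and "a + w = age0 (atom_of e) + q * multiplier (atom_of e) * L + rs"
  shows "go False x (Pass e rs w) (unary k) a r (Drain e 0) [Base]
    (age0 (atom_of e) + 1 + (multiplier (atom_of e) * (N div divisor (atom_of e)) + N mod divisor (atom_of e)) * L) r"
    (is "go _ _ _ _ _ _ _ _ ?A _")
  using assms(3-)
proof (induction k arbitrary: q rs w a)
  case 0
  let ?v = "divisor (atom_of e)" and ?u = "multiplier (atom_of e)"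
  have N: "N div ?v = q" "N mod ?v = rs" using 0 by auto
  have "go False x (Pass e rs w) (unary 0) a r (Pass e rs 0) [Base] (a + w) r"
    using go_wait[of Base] by simp
  moreover have "go False x (Pass e rs 0) [Base] (a + w) r (Drain e ((L - 1) * rs)) [Base] (Suc (a + w)) r"
    using assms(2) N unary_syms[of Base] by (intro go_ord[OF ctr.drain]) auto
  moreover have "go False x (Drain e ((L - 1) * rs)) [Base] (Suc (a + w)) r (Drain e 0) [Base] (Suc (a + w) + (L - 1) * rs) r"
    by (rule go_drain)
  moreover have "rs + (L - 1) * rs = rs * L" using L_ge by (cases L) auto
  then have "Suc (a + w) + (L - 1) * rs = ?A"
    using 0(3) unfolding N by (simp add: algebra_simps)
  ultimately show ?case by (metis go_trans)
next
  case (Suc k)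
  let ?v = "divisor (atom_of e)" and ?u = "multiplier (atom_of e)"
  have w: "go False x (Pass e rs w) (unary (Suc k)) a r (Pass e rs 0) (One # unary k) (a + w) r"
    using go_wait[of One] by simp
  have One: "One \<in> syms" "One \<notin> range Qs" using unary_syms[of One] by auto
  show ?case
  proof (cases "Suc rs < ?v")
    case True
    have 1: "go False x (Pass e rs 0) (One # unary k) (a + w) r (Pass e (Suc rs) 0) (unary k) (Suc (a + w)) r"
      using One by (intro go_ord[OF ctr.pop[OF True]]) auto
    have "go False x (Pass e (Suc rs) 0) (unary k) (Suc (a + w)) r (Drain e 0) [Base] ?A r"
      by (rule Suc.IH[of q]) (use Suc.prems True in auto)
    with go_trans[OF w 1] show ?thesis by (rule go_trans)
  next
    case False
    then have v: "Suc rs = ?v" using Suc.prems by simp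
    have 1: "go False x (Pass e rs 0) (One # unary k) (a + w) r (Pass e 0 (?u * L - ?v)) (unary k) (Suc (a + w)) r"
      using One by (intro go_ord[OF ctr.last[OF v]]) auto
    note pos = edge_pos[OF assms(1)]
    have le: "?v \<le> ?u * L"
      using divisor_le[OF assms(1)] pos(2) by (metis le_trans mult_le_mono1 nat_mult_1 Suc_leI One_nat_def)
    have eq: "Suc (a + w) = age0 (atom_of e) + q * ?u * L + ?v" using Suc.prems v by simp
    have "go False x (Pass e 0 (?u * L - ?v)) (unary k) (Suc (a + w)) r (Drain e 0) [Base] ?A r"
    proof (rule Suc.IH[of "Suc q"])
      show "k + ?v * Suc q + 0 = N" using Suc.prems v by simp
      show "0 < ?v" by (rule pos)
      show "Suc (a + w) + (?u * L - ?v) = age0 (atom_of e) + Suc q * ?u * L + 0"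
        unfolding eq using le by (simp add: add_mult_distrib)
    qed
    with go_trans[OF w 1] show ?thesis by (rule go_trans)
  qed
qed

lemma go_reload: "go False x (Drain (p, b, q) 0) [Base] a r (Node q) (unary (a div L)) 1 r"
proof -
  let ?e = "(p, b, q)"
  have 1: "go False x (Drain ?e 0) [Base] a r (Reload ?e) [Qs (n + 2)] (Suc a) r"
    using unary_syms[of Base] by (intro go_ord[OF ctr.reload]) auto
  have 2: "go False x (Reload ?e) [Qs (n + 2)] (Suc a) r (Reload ?e) (unary (a div L)) 0 r"
    unfolding go_def using step_clock[of False x _ "Reload ?e" "[]" a r] by auto
  obtain X u where u: "unary (a div L) = X # u" "X \<in> {One, Base}" by (cases "a div L") auto
  have 3: "go False x (Reload ?e) (unary (a div L)) 0 r (Node q) (unary (a div L)) 1 r"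
    unfolding u(1) One_nat_def using unary_syms[OF u(2)] by (intro go_ord[OF ctr.reloaded[OF u(2)]]) auto
  from go_trans[OF go_trans[OF 1 2] 3] show ?thesis .
qed

lemma go_edge:
  assumes "(p, b, q) \<in> E" "((N, r), (N', r')) \<in> nsem W b"
  shows "go False x (Node p) (unary N) 1 r (Node q) (unary N') 1 r'"
proof -
  let ?e = "(p, b, q)"
  note pos = edge_pos[OF assms(1), simplified]
  from assms(2) have ns: "case b of Recv i t \<Rightarrow> (r, r') \<in> W i t | _ \<Rightarrow> r' = r"
    "residue_ok b (N mod divisor b)" "N' = multiplier b * (N div divisor b) + N mod divisor b"
    unfolding nsem_iff[OF pos(1)] by auto
  obtain X u where u: "unary N = X # u" "X \<in> {One, Base}" by (cases N) auto
  have 1: "go False x (Node p) (unary N) 1 r (Pass ?e 0 0) (unary N) (age0 b) r'"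
  proof (cases b)
    case (Recv i t)
    with ns(1) obtain v where v: "fire i t (r i) v" "r' = r(i := v)" unfolding W_def by auto
    have t: "t < length toks" using v(1) by (simp add: fire_def)
    show ?thesis
      unfolding go_def
    proof (intro allI impI)
      fix c assume c: "cdesc False x c (Node p) (unary N) 1 r"
      from step_recv[OF c[unfolded u(1)] u(2) assms(1)[unfolded Recv] v(1)] obtain c1 where
        c1: "(step B)\<^sup>*\<^sup>* c c1" "cdesc True x c1 (Fetch ?e) (Tok t # X # u) 2 r'"
        unfolding Recv v(2) by (auto simp: numeral_2_eq_2)
      have "go True x (Fetch ?e) (Tok t # X # u) 2 r' (Pass ?e 0 0) (X # u) (Suc 2) r'"
        unfolding Recv using t by (intro go_ord[OF ctr.fetched]) (auto simp: syms_def)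
      with c1(2) obtain c2 where c2: "(step B)\<^sup>*\<^sup>* c1 c2" "cdesc False x c2 (Pass ?e 0 0) (X # u) (Suc 2) r'"
        unfolding go_def by blast
      then show "\<exists>c'. (step B)\<^sup>*\<^sup>* c c' \<and> cdesc False x c' (Pass ?e 0 0) (unary N) (age0 b) r'"
        using rtranclp_trans[OF c1(1) c2(1)] unfolding u(1) Recv by (auto simp: age0_def)
    qed
  next
    case (Frac v w)
    then have "\<not> is_Recv b" "age0 b = Suc 1" "r' = r" using ns(1) by (auto simp: age0_def)
    then show ?thesis unfolding u(1)
      using unary_syms[OF u(2)] by (auto intro!: go_ord[OF ctr.pass[OF assms(1) _ u(2)]])
  next
    case (NDiv v)
    then have "\<not> is_Recv b" "age0 b = Suc 1" "r' = r" using ns(1) by (auto simp: age0_def)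
    then show ?thesis unfolding u(1)
      using unary_syms[OF u(2)] by (auto intro!: go_ord[OF ctr.pass[OF assms(1) _ u(2)]])
  qed
  have 2: "go False x (Pass ?e 0 0) (unary N) (age0 b) r' (Drain ?e 0) [Base] (age0 b + 1 + N' * L) r'"
    using go_pass[OF assms(1), of N N 0 0 "age0 b" 0 x r'] ns(2,3) pos(1) by simp
  have "(y + N' * L) div L = N'" if "y < L" for y
    using that by simp
  from this[of "age0 b + 1"] have "(age0 b + 1 + N' * L) div L = N'" using L_ge by (simp add: age0_def)
  with go_trans[OF go_trans[OF 1 2] go_reload] show ?thesis by simp
qed

lemma reach_run:
  assumes "reach (proj (init_cfg A x)) p N r"
  shows "\<exists>c. (step B)\<^sup>*\<^sup>* (init_cfg B x) c \<and> cdesc False x c (Node p) (unary N) 1 r"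
  using assms unfolding reach_def
proof (induction p "(N, r)" arbitrary: N r rule: rtrancl_induct2)
  case refl
  \<comment> \<open>Initially every reader shows its initial symbol, which the parameter
    \<open>True\<close> permits.\<close>
  have "rdy True (init_cfg B x) i (proj (init_cfg A x) i)" if "i \<in> {1..n}" for i
    using that wf_comp(2)[OF that] unfolding rdy_def
    by (auto simp: init_cfg_def cst_def cin_def cstk_def proj_def)
  then have "cdesc True x (init_cfg B x) Begin [Bot 1] 0 (proj (init_cfg A x))"
    using desc_init[of x] cinv_init[of x] unfolding cdesc_def desc_def
    by (auto simp: init_cfg_def cin_def)
  moreover have "go True x Begin [Bot 1] 0 (proj (init_cfg A x)) (Node st) (unary 1) (Suc 0) (proj (init_cfg A x))"
    by (rule go_ord[OF ctr.starting]) (auto simp: syms_def)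
  ultimately show ?case unfolding go_def by simp
next
  case (step p y q)
  obtain M s where y: "y = (M, s)" by (cases y)
  from step.hyps(3)[OF y] obtain c where c: "(step B)\<^sup>*\<^sup>* (init_cfg B x) c" "cdesc False x c (Node p) (unary M) 1 s"
    by blast
  from step.hyps(2) obtain b where "(p, b, q) \<in> E" "((M, s), (N, r)) \<in> nsem W b"
    unfolding y grel_def by auto
  from go_edge[OF this] c(2) obtain c' where "(step B)\<^sup>*\<^sup>* c c'" "cdesc False x c' (Node q) (unary N) 1 r"
    unfolding go_def by blast
  with c(1) show ?case by (meson rtranclp_trans)
qed

text \<open>Controller and clock postpone all reading until the simulation is over and then consume
  one symbol in each step, while the readers idle.\<close>

lemma halt_run:
  assumes "cdesc False x c Halt (unary N) a r" "set x \<subseteq> inp A"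
  shows "\<exists>c' a'. (step B)\<^sup>*\<^sup>* c c' \<and> cdesc False [] c' Halt (unary N) a' r"
  using assms
proof (induction x arbitrary: c a)
  case Nil
  then show ?case by blast
next
  case (Cons y x)
  obtain X u where u: "unary N = X # u" "X \<in> {One, Base}" by (cases N) auto
  from step_ord[OF Cons.prems(1)[unfolded u(1)] _ _ ctr.halted[OF u(2)], of "Some y" x] unary_syms[OF u(2)] Cons.prems(2)
  obtain c1 where "step B c c1" "cdesc False x c1 Halt (unary N) (Suc a) r"
    unfolding u(1) by (auto simp: opt_word_def)
  with Cons.IH[of c1 "Suc a"] Cons.prems(2) show ?case by (auto intro: converse_rtranclp_into_rtranclp)
qed

lemma lang_complete:
  assumes "reach (proj (init_cfg A x)) h N r" "accepting r" "set x \<subseteq> inp A"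
  shows "x \<in> lang_r B"
proof -
  from reach_run[OF assms(1)] obtain c where c: "(step B)\<^sup>*\<^sup>* (init_cfg B x) c" "cdesc False x c (Node h) (unary N) 1 r"
    by blast
  obtain X u where u: "unary N = X # u" "X \<in> {One, Base}" by (cases N) auto
  have "go False x (Node h) (unary N) 1 r Halt (unary N) (Suc 1) r"
    unfolding u(1) using unary_syms[OF u(2)] by (intro go_ord[OF ctr.halt[OF u(2)]]) auto
  with c(2) obtain c1 where c1: "(step B)\<^sup>*\<^sup>* c c1" "cdesc False x c1 Halt (unary N) (Suc 1) r"
    unfolding go_def by blast
  from halt_run[OF c1(2) assms(3)] obtain c2 a where c2: "(step B)\<^sup>*\<^sup>* c1 c2" "cdesc False [] c2 Halt (unary N) a r"
    by blast
  have d: "cst c2 1 = cq Halt" "clk c2 a" "cin c2 1 = []" "cin c2 (n + 2) = []" "\<And>i. i \<in> {1..n} \<Longrightarrow> rdy False c2 i (r i)"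
    using c2(2) unfolding cdesc_def by auto
  have "cin c2 i = [] \<and> cst c2 i \<in> finals (comp B i)" if i: "i \<in> {1..n + 2}" for i
  proof -
    obtain j where j: "i = Suc j" "j < n + 2" using i by (cases i) auto
    then consider "i = 1" | "i = n + 2" | j where "i = Suc j" "j \<in> {1..n}"
      by (cases "j = 0"; cases "j = Suc n") auto
    then show ?thesis
    proof cases
      case 1
      then show ?thesis using d by simp
    next
      case 2
      have "(a - Suc 0) mod L < L" using L_ge by simp
      with d(2) 2 d(4) show ?thesis unfolding clk_def by (auto simp: Qst_def)
    next
      case (3 j)
      with d(5)[OF 3(2)] assms(2) show ?thesis unfolding rdy_def accepting_def by fastforce
    qed
  qed
  moreover have "(step B)\<^sup>*\<^sup>* (init_cfg B x) c2" using c(1) c1(1) c2(1) by (meson rtranclp_trans)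
  ultimately show ?thesis unfolding lang_r_def B_simps(1,2) using assms(3) by blast
qed

lemma lang_B: "x \<in> lang_r B \<longleftrightarrow> set x \<subseteq> inp A \<and> (\<exists>N r. reach (proj (init_cfg A x)) h N r \<and> accepting r)"
proof
  assume x: "x \<in> lang_r B"
  then have "set x \<subseteq> inp A" unfolding lang_r_def by simp
  with lang_sound[OF x] show "set x \<subseteq> inp A \<and> (\<exists>N r. reach (proj (init_cfg A x)) h N r \<and> accepting r)" by blast
qed (use lang_complete in blast)

end

lemma (in pcpa) simulation:
  "\<exists>A' :: (('s \<times> nat) \<times> bool, 'v, 'g + nat) pcpa.
     rcpcpa A' \<and> inp A' = inp A \<and> comm_property A' \<and> lang_r A' = lang_r A"
proof -
  from number_program obtain c where c: "\<And>a. a \<in> set_com c \<Longrightarrow> natom_ok a"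
    "\<And>x. (\<exists>N r. ((1, proj (init_cfg A x)), (N, r)) \<in> sem (nsem W) c \<and> accepting r) \<longleftrightarrow>
      (\<exists>c. (step A)\<^sup>*\<^sup>* (init_cfg A x) c \<and> (\<forall>i\<in>{1..n}. cin c i = [] \<and> cst c i \<in> finals (comp A i)))"
    by blast
  \<comment> \<open>Silent edges become the fraction \<open>1 / 1\<close>, which is the identity.
    The nodes, being lists of programs, are numbered by countability.\<close>
  define g where "g = case_option (Frac 1 1) (\<lambda>a :: natom. a)"
  define E where "E = (\<lambda>(p, a, q). (to_nat p, g a, to_nat q)) ` edges c []"
  have g: "nsem W (g a) = osem (nsem W) a" for a
    by (cases a) (auto simp: g_def)
  interpret compiled A E "to_nat [c]" "to_nat ([] :: natom com list)"
  proof
    show "finite E" by (simp add: E_def finite_edges)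
    fix p a q assume "(p, a, q) \<in> E"
    then obtain p' b q' where b: "(p', b, q') \<in> edges c []" "a = g b" unfolding E_def by auto
    show "natom_ok a"
    proof (cases b)
      case None
      then show ?thesis using b(2) by (simp add: g_def)
    next
      case (Some b')
      then show ?thesis using b edges_atoms[of p' b' q' c "[]"] c(1) by (simp add: g_def)
    qed
  qed
  have "reach (proj (init_cfg A x)) (to_nat ([] :: natom com list)) N r \<longleftrightarrow>
    ((1, proj (init_cfg A x)), (N, r)) \<in> sem (nsem W) c" for x N r
    unfolding reach_def unfolding E_def grel_map[OF inj_to_nat] g edges_correct by (rule refl)
  then have "lang_r B = lang_r A"
    using lang_B c(2) unfolding lang_r_def[of A] by auto
  then show ?thesis using rcpcpa_B comm_property_B B_simps(2) by blast
qed

theorem theorem1: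
  fixes A :: "('s, 'v, 'g) pcpa"
  assumes "rcpcpa A"
  shows "\<exists>A' :: (('s \<times> nat) \<times> bool, 'v, 'g + nat) pcpa.
           rcpcpa A' \<and> inp A' = inp A \<and> comm_property A' \<and> lang_r A' = lang_r A"
  using assms by (intro pcpa.simulation) (rule pcpa.intro)

end
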